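(* Let $K$ be a field. (A.1) If $K$ is infinite, then the group $\mathrm{SAut}_0\,\mathbb{A}^2_K$ is not linear, even over a ring; that is, there are no integer $n\ge 1$, commutative ring $R$ and injective group homomorphism $\mathrm{SAut}_0\,\mathbb{A}^2_K\to \mathrm{GL}(n,R)$. (A.2) (For an arbitrary field $K$.) There is an injective group homomorphism $\mathrm{Aut}_{U(K)}\,\mathbb{A}^2_K\to \mathrm{SL}(2,K(t))$.
   Context: $\mathrm{Aut}\,\mathbb{A}^2_K$ is the group of polynomial automorphisms of the affine plane over $K$, i.e. pairs $\phi=(f,g)$ of polynomials in $K[x,y]$, written $(x,y)\mapsto(f,g)$, that are invertible under composition. $\mathrm{Aut}_0\,\mathbb{A}^2_K=\{\phi\in\mathrm{Aut}\,\mathbb{A}^2_K\mid \phi(\mathbf 0)=\mathbf 0\}$. $\mathrm{SAut}_0\,\mathbb{A}^2_K=\{\phi\in \mathrm{Aut}_0\,\mathbb{A}^2_K\mid \mathrm{Jac}(\phi)=1\}$, where $\mathrm{Jac}(\phi)=\det \mathrm{d}\phi$. For a subgroup $S\subset\mathrm{GL}(2,K)$, $\mathrm{Aut}_S\,\mathbb{A}^2_K=\{\phi\in\mathrm{Aut}_0\,\mathbb{A}^2_K\mid \mathrm{d}\phi|_{\mathbf 0}\in S\}$. $U(K)$ is the group of linear maps $(x,y)\mapsto(x,y+ax)$ with $a\in K$. $K(t)$ is the field of rational functions in one variable. Rings are associative, commutative and unital. *)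

theory Defs
  imports
    "HOL-Algebra.Group"
    "HOL-Computational_Algebra.Fraction_Field"
    "Jordan_Normal_Form.Determinant"
begin

section \<open>Polynomial endomorphisms of the affine plane\<close>

text \<open>
  \<open>K[x,y]\<close> is represented as \<open>K[x][y]\<close>, i.e. by the type \<open>'k poly poly\<close>: the outer
  indeterminate is \<open>y\<close>, the inner one is \<open>x\<close>. Polynomial maps are pairs of formal polynomials
  and not functions on \<open>K\<^sup>2\<close>; this matters when \<open>K\<close> is finite.
\<close>

definition varX :: "'k::field poly poly" where
  "varX = [:[:0, 1:]:]"

definition varY :: "'k::field poly poly" where
  "varY = [:0, 1:]"

definition eval2 :: "'k::field poly poly \<Rightarrow> 'k \<Rightarrow> 'k \<Rightarrow> 'k" where
  "eval2 p a b = poly (poly p [:b:]) a"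

type_synonym 'k plane_map = "'k poly poly \<times> 'k poly poly"

text \<open>\<open>subst2 p (f, g)\<close> is \<open>p(f, g)\<close>.\<close>

definition subst2 :: "'k::field poly poly \<Rightarrow> 'k plane_map \<Rightarrow> 'k poly poly" where
  "subst2 p \<phi> =
     poly (map_poly (\<lambda>q. poly (map_poly (\<lambda>c. [:[:c:]:]) q) (fst \<phi>)) p) (snd \<phi>)"

definition End_plane :: "'k::field plane_map monoid" where
  "End_plane =
     \<lparr>carrier = UNIV,
      mult = (\<lambda>\<phi> \<psi>. (subst2 (fst \<phi>) \<psi>, subst2 (snd \<phi>) \<psi>)),
      one = (varX, varY)\<rparr>"

definition Aut_plane :: "'k::field plane_map monoid" where
  "Aut_plane = units_of End_plane"

text \<open>The derivative \<open>d\<phi>\<close>, with rows \<open>(f\<^sub>x, f\<^sub>y)\<close> and \<open>(g\<^sub>x, g\<^sub>y)\<close>.\<close>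

definition jacobian_mat :: "'k::field plane_map \<Rightarrow> 'k poly poly mat" where
  "jacobian_mat \<phi> = mat_of_rows_list 2
     [[map_poly pderiv (fst \<phi>), pderiv (fst \<phi>)],
      [map_poly pderiv (snd \<phi>), pderiv (snd \<phi>)]]"

definition Jac :: "'k::field plane_map \<Rightarrow> 'k poly poly" where
  "Jac \<phi> = det (jacobian_mat \<phi>)"

definition diff_at_0 :: "'k::field plane_map \<Rightarrow> 'k mat" where
  "diff_at_0 \<phi> = map_mat (\<lambda>p. eval2 p 0 0) (jacobian_mat \<phi>)"

definition Aut0_plane :: "'k::field plane_map monoid" where
  "Aut0_plane = Aut_plane
     \<lparr>carrier := {\<phi> \<in> carrier Aut_plane. eval2 (fst \<phi>) 0 0 = 0 \<and> eval2 (snd \<phi>) 0 0 = 0}\<rparr>"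

definition SAut0_plane :: "'k::field plane_map monoid" where
  "SAut0_plane = Aut0_plane \<lparr>carrier := {\<phi> \<in> carrier Aut0_plane. Jac \<phi> = 1}\<rparr>"

definition Aut_plane_with :: "'k::field mat set \<Rightarrow> 'k plane_map monoid" where
  "Aut_plane_with S = Aut0_plane \<lparr>carrier := {\<phi> \<in> carrier Aut0_plane. diff_at_0 \<phi> \<in> S}\<rparr>"

text \<open>
  Linear maps are identified with matrices acting on column vectors, so that
  \<open>(x, y) \<mapsto> (x, y + a x)\<close> is lower triangular.
\<close>

definition U_mats :: "'k::field mat set" where
  "U_mats = {mat_of_rows_list 2 [[1, 0], [a, 1]] | a. True}"


section \<open>Linear groups\<close>

text \<open>
  The sort \<open>{comm_ring, comm_monoid_mult}\<close> consists of all commutative unital rings, the zero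
  ring included; \<open>comm_ring_1\<close>, and with it the library's \<open>ring_mat\<close>, would require
  \<open>0 \<noteq> 1\<close>.
\<close>

definition GL :: "nat \<Rightarrow> 'r::{comm_ring, comm_monoid_mult} mat monoid" where
  "GL n = units_of \<lparr>carrier = carrier_mat n n, mult = (*), one = 1\<^sub>m n\<rparr>"

definition SL :: "nat \<Rightarrow> 'r::comm_ring_1 mat monoid" where
  "SL n = GL n \<lparr>carrier := {A \<in> carrier (GL n). det A = 1}\<rparr>"

end

theory Submission
  imports Defs "Jordan_Normal_Form.Char_Poly" "HOL-Computational_Algebra.Formal_Laurent_Series"
begin

text \<open>
  For (A.2), \<open>Aut\<^sub>U\<close> is the free product of the groups of maps \<open>(x, y + P(x))\<close> with \<open>P(0) = 0\<close> and
  \<open>(x + Q(y), y)\<close> with \<open>Q(0) = Q'(0) = 0\<close>, by the theorem of Jung and van der Kulk. Mapping them to the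
  unipotent matrices with entry \<open>P(t)\<close> below and \<open>Q(t)\<close> above the diagonal is injective because
  nonconstant entries make degrees grow strictly along a reduced word. The theorem of Jung and van der
  Kulk holds since a component \<open>f\<close> of an automorphism is invariant under a nontrivial action of the additive
  group, hence so is a suitable leading form of \<open>f\<close>; this forces the leading form to have a factor
  \<open>x - c y\<^sup>a\<close> or \<open>y - c x\<^sup>b\<close>, and an elementary map lowers the degree.

  For (A.1), the maps \<open>e\<^sub>i(c) = (x, y + c x\<^bsup>M i\<^esup>)\<close> are normalised by the torus \<open>(x / s, s y)\<close>, with pairwise
  different characters. As \<open>n \<times> n\<close> matrices carry at most \<open>n\<^sup>2\<close> characters, every product of entries of
  \<open>\<rho>(e\<^sub>i(c\<^sub>i)) - 1\<close> for more than \<open>n\<^sup>2\<close> indices \<open>i\<close> vanishes. Therefore an iterated commutator of that many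
  conjugates of the \<open>e\<^sub>i(c\<^sub>i)\<close> lies in the kernel of \<open>\<rho>\<close>, although it is nontrivial by the free product structure.
\<close>

section \<open>The theorem of Cayley and Hamilton\<close>

text \<open>The map c |-> rho (e_i c) is merely a homomorphism on the additive group of K, and R is
  unrelated to K and may have zero divisors: neither eigenvectors nor Zariski closures nor
  polynomial dependence on c are at hand. Characters are therefore compared on functions from K^m to
  R, where a torus element rescales one argument; two exponents count as different if no nonzero
  biadditive form balances them. In characteristic p this rules out exponents whose quotient is a
  power of p, whence the exponents p^i + 1.

  The entries of z(c) = rho (e_i c) - 1 are not additive in c, as z(a + b) = z(a) + z(b) + z(a)
  z(b). Cayley-Hamilton for a torus element shows that products of n such factors with the same i
  vanish; multiplying by a longest product that does not kill everything makes the entries additive.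

  The e_i commute with one another, so all but e_0 are conjugated by the rotation (y, -x) before
  commutators are formed.

  For Jung and van der Kulk, derivations lose too much in positive characteristic. The additive
  action itself, polynomial in its time T, replaces them.\<close>

lemma mat_mult_entry:
  assumes "A \<in> carrier_mat n m" "B \<in> carrier_mat m p" "i < n" "j < p"
  shows "(A * B) $$ (i, j) = (\<Sum>t<m. A $$ (i, t) * B $$ (t, j))"
  using assms by (simp add: scalar_prod_def atLeast0LessThan)

text \<open>Comparing coefficients of X^k in (X - A) adj(X - A) = \<chi> gives
  \<open>B (k - 1) - A * B k\<close> = \<chi>_k times the identity; multiplied by A^k from the left,
  these relations telescope. The entrywise form avoids sums of matrices.\<close>

lemma cayley_hamilton_entries:
  fixes A :: "'r::comm_ring_1 mat"
  assumes A: "A \<in> carrier_mat n n" and i: "i < n" and j: "j < n"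
  shows "(\<Sum>k\<le>n. coeff (char_poly A) k * (A ^\<^sub>m k) $$ (i, j)) = 0"
proof -
  define M where "M = char_poly_matrix A"
  define B where "B = (\<lambda>k. map_mat (\<lambda>p. coeff p k) (adj_mat M))"
  define \<chi> where "\<chi> = char_poly A"
  have M: "M \<in> carrier_mat n n" using A by (simp add: M_def char_poly_matrix_def)
  have adj: "adj_mat M \<in> carrier_mat n n" "M * adj_mat M = det M \<cdot>\<^sub>m 1\<^sub>m n"
    using adj_mat[OF M] by auto
  have B: "B k \<in> carrier_mat n n" for k using adj(1) by (simp add: B_def)
  have Ment: "M $$ (r, t) = (if r = t then [:- (A $$ (r,t)), 1:] else [:- (A $$ (r,t)):])"
    if "r < n" "t < n" for r t
    using that A by (simp add: M_def char_poly_matrix_def)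
  have rec: "(if k = 0 then 0 else B (k - 1) $$ (r, s)) - (A * B k) $$ (r, s)
      = (if r = s then coeff \<chi> k else 0)" if r: "r < n" and s: "s < n" for k r s
  proof -
    have "coeff ((M * adj_mat M) $$ (r, s)) k = (if r = s then coeff \<chi> k else 0)"
      using r s adj M by (simp add: \<chi>_def char_poly_def M_def)
    moreover have "(M * adj_mat M) $$ (r, s) = (\<Sum>t<n. M $$ (r,t) * adj_mat M $$ (t, s))"
      by (rule mat_mult_entry[OF M adj(1) r s])
    moreover have "(\<Sum>t<n. M $$ (r,t) * adj_mat M $$ (t, s)) =
       (\<Sum>t<n. (if r = t then [:0,1:] * adj_mat M $$ (r, s) else 0) + Polynomial.smult (- (A $$ (r,t))) (adj_mat M $$ (t, s)))"
      using r by (intro sum.cong refl) (auto simp: Ment algebra_simps)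
    moreover have "\<dots> = [:0,1:] * adj_mat M $$ (r, s) + (\<Sum>t<n. Polynomial.smult (- (A $$ (r,t))) (adj_mat M $$ (t, s)))"
      using r by (simp only: sum.distrib, simp)
    moreover have "coeff \<dots> k = (if k = 0 then 0 else B (k - 1) $$ (r, s)) - (A * B k) $$ (r, s)"
      using r s A adj(1) mat_mult_entry[OF A B r s] by (cases k) (simp_all add: B_def coeff_sum sum_negf)
    ultimately show ?thesis by simp
  qed
  \<comment> \<open>\<open>K\<close> bounds the degrees of the adjugate and of \<chi>, so extending
    the sum to \<open>Suc K\<close> adds nothing and the telescoped remainder contains the factor
    \<open>B (Suc K)\<close>, which is zero.\<close>
  define K where "K = n + Max ((\<lambda>(r,s). degree (adj_mat M $$ (r,s))) ` ({..<n} \<times> {..<n}))"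
  have fin: "finite ((\<lambda>(r,s). degree (adj_mat M $$ (r,s))) ` ({..<n} \<times> {..<n}))" by simp
  have BK: "B k $$ (r,s) = 0" if "k > K" "r < n" "s < n" for k r s
  proof -
    have "degree (adj_mat M $$ (r,s)) \<le> K"
      unfolding K_def using that by (intro trans_le_add2 Max_ge[OF fin]) auto
    then show ?thesis using that adj(1) by (simp add: B_def coeff_eq_0)
  qed
  have tele: "(\<Sum>k\<le>m. coeff \<chi> k * (A ^\<^sub>m k) $$ (i, j)) = - (A ^\<^sub>m (Suc m) * B m) $$ (i, j)" for m
  proof (induction m)
    have step: "coeff \<chi> k * (A ^\<^sub>m k) $$ (i, j) =
        (if k = 0 then 0 else (A ^\<^sub>m k * B (k - 1)) $$ (i, j)) - (A ^\<^sub>m (Suc k) * B k) $$ (i, j)" for k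
    proof -
      have Ak: "A ^\<^sub>m k \<in> carrier_mat n n" using A by simp
      have "coeff \<chi> k * (A ^\<^sub>m k) $$ (i, j) = (\<Sum>t<n. (A ^\<^sub>m k) $$ (i, t) * (if t = j then coeff \<chi> k else 0))"
        using j by (simp add: if_distrib[of "\<lambda>x. _ * x"] mult.commute cong: if_cong)
      also have "\<dots> = (\<Sum>t<n. (A ^\<^sub>m k) $$ (i, t) * ((if k = 0 then 0 else B (k - 1) $$ (t, j)) - (A * B k) $$ (t, j)))"
        using j by (intro sum.cong refl) (simp add: rec)
      also have "\<dots> = (if k = 0 then 0 else (A ^\<^sub>m k * B (k - 1)) $$ (i, j)) - (A ^\<^sub>m k * (A * B k)) $$ (i, j)"
        using mat_mult_entry[OF Ak B i j] mat_mult_entry[OF Ak mult_carrier_mat[OF A B] i j]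
        by (simp add: right_diff_distrib sum_subtractf)
      also have "A ^\<^sub>m k * (A * B k) = A ^\<^sub>m (Suc k) * B k"
        using assoc_mult_mat[OF Ak A B] by simp
      finally show ?thesis .
    qed
    case 0 show ?case using step[of 0] by simp
    case (Suc m) then show ?case using step[of "Suc m"] by simp
  qed
  have "(\<Sum>k\<le>n. coeff \<chi> k * (A ^\<^sub>m k) $$ (i, j)) = (\<Sum>k\<le>Suc K. coeff \<chi> k * (A ^\<^sub>m k) $$ (i, j))"
  proof (rule sum.mono_neutral_left)
    show "\<forall>k\<in>{..Suc K} - {..n}. coeff \<chi> k * (A ^\<^sub>m k) $$ (i, j) = 0"
      using degree_monic_char_poly[OF A] by (auto simp: \<chi>_def coeff_eq_0)
  qed (auto simp: K_def)
  also have "\<dots> = - (A ^\<^sub>m (Suc (Suc K)) * B (Suc K)) $$ (i, j)" by (rule tele)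
  also have "(A ^\<^sub>m (Suc (Suc K)) * B (Suc K)) $$ (i, j) = (\<Sum>t<n. (A ^\<^sub>m (Suc (Suc K))) $$ (i,t) * B (Suc K) $$ (t,j))"
    by (rule mat_mult_entry[OF pow_carrier_mat[OF A] B i j])
  also have "\<dots> = 0" using j by (intro sum.neutral) (simp add: BK)
  finally show ?thesis by (simp add: \<chi>_def)
qed

section \<open>Weights of commuting shifts\<close>

text \<open>A torus element \<open>x\<close> acting on the \<open>i\<close>-th argument alone,
  through the character of exponent \<open>d i\<close>.\<close>

definition shift :: "(nat \<Rightarrow> nat) \<Rightarrow> nat \<Rightarrow> 'k::field \<Rightarrow> ((nat \<Rightarrow> 'k) \<Rightarrow> 'r) \<Rightarrow> (nat \<Rightarrow> 'k) \<Rightarrow> 'r" where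
  "shift d i x F = (\<lambda>c. F (c(i := x ^ d i * c i)))"

definition shift_diff :: "(nat \<Rightarrow> nat) \<Rightarrow> nat \<Rightarrow> nat \<Rightarrow> 'k::field \<Rightarrow> ((nat \<Rightarrow> 'k) \<Rightarrow> 'r::comm_ring_1) \<Rightarrow> (nat \<Rightarrow> 'k) \<Rightarrow> 'r" where
  "shift_diff d i j x F = (\<lambda>c. shift d i x F c - shift d j x F c)"

fun shift_diffs :: "(nat \<Rightarrow> nat) \<Rightarrow> nat \<Rightarrow> nat list \<Rightarrow> (nat \<Rightarrow> 'k::field) \<Rightarrow> ((nat \<Rightarrow> 'k) \<Rightarrow> 'r::comm_ring_1) \<Rightarrow> (nat \<Rightarrow> 'k) \<Rightarrow> 'r" where
  "shift_diffs d i [] x F = F"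
| "shift_diffs d i (j # js) x F = shift_diffs d i js x (shift_diff d i j (x j) F)"

text \<open>All shifts commute, so this is a product over pairs i < j of differences of two actions,
  in the role of the eigenvalue differences in a Vandermonde determinant. It annihilates what lives
  in too few dimensions (\<open>weight_op_prod_eq_0\<close>), yet for a suitable \<open>X\<close> it
  spares a given nonzero multiadditive function (\<open>exists_weight_op_nonzero\<close>).\<close>

fun weight_op :: "(nat \<Rightarrow> nat) \<Rightarrow> nat \<Rightarrow> (nat \<Rightarrow> nat \<Rightarrow> 'k::field) \<Rightarrow> nat \<Rightarrow> ((nat \<Rightarrow> 'k) \<Rightarrow> 'r::comm_ring_1) \<Rightarrow> (nat \<Rightarrow> 'k) \<Rightarrow> 'r" where
  "weight_op d m X 0 F = F"
| "weight_op d m X (Suc k) F = weight_op d m X k (shift_diffs d k [Suc k..<m] (X k) F)"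

lemma shift_commute: "shift d i x (shift d j y F) = shift d j y (shift d i x F)"
  by (cases "i = j") (auto simp: shift_def fun_upd_twist mult.left_commute)

lemma shift_linear:
  "shift d i x (\<lambda>c. F c + G c) = (\<lambda>c. shift d i x F c + shift d i x G c)"
  "shift d i x (\<lambda>c. r * F c) = (\<lambda>c. r * shift d i x F c)"
  by (auto simp: shift_def)

lemma shift_diff_linear:
  "shift_diff d i j x (\<lambda>c. F c + G c) = (\<lambda>c. shift_diff d i j x F c + shift_diff d i j x G c)"
  "shift_diff d i j x (\<lambda>c. r * F c) = (\<lambda>c. r * shift_diff d i j x F c)"
  "shift_diff d i j x (shift d l y F) = shift d l y (shift_diff d i j x F)"
  by (auto simp: shift_diff_def shift_linear algebra_simps shift_commute[of d _ _ l])
     (auto simp: shift_def)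

lemma shift_diffs_linear:
  "shift_diffs d i js x (\<lambda>c. F c + G c) = (\<lambda>c. shift_diffs d i js x F c + shift_diffs d i js x G c)"
  "shift_diffs d i js x (\<lambda>c. r * F c) = (\<lambda>c. r * shift_diffs d i js x F c)"
  "shift_diffs d i js x (shift d l y F) = shift d l y (shift_diffs d i js x F)"
  by (induction js arbitrary: F G) (simp_all add: shift_diff_linear)

lemma weight_op_linear:
  "weight_op d m X k (\<lambda>c. F c + G c) = (\<lambda>c. weight_op d m X k F c + weight_op d m X k G c)"
  "weight_op d m X k (\<lambda>c. r * F c) = (\<lambda>c. r * weight_op d m X k F c)"
  "weight_op d m X k (shift d l y F) = shift d l y (weight_op d m X k F)"
  by (induction k arbitrary: F G) (simp_all add: shift_diffs_linear)

lemma weight_op_cong: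
  "(\<And>i. i < k \<Longrightarrow> X i = Y i) \<Longrightarrow> weight_op d m X k F = weight_op d m Y k F"
  by (induction k arbitrary: F) auto

text \<open>The closure properties of the kernel of \<open>weight_op\<close> on which the
  elimination below relies.\<close>

definition shift_module :: "(nat \<Rightarrow> nat) \<Rightarrow> ((nat \<Rightarrow> 'k::field) \<Rightarrow> 'r::comm_ring_1) set \<Rightarrow> bool" where
  "shift_module d S \<longleftrightarrow> (\<lambda>c. 0) \<in> S \<and> (\<forall>F\<in>S. \<forall>G\<in>S. (\<lambda>c. F c + G c) \<in> S)
     \<and> (\<forall>F\<in>S. \<forall>r. (\<lambda>c. r * F c) \<in> S) \<and> (\<forall>F\<in>S. \<forall>l y. shift d l y F \<in> S)"

lemma shift_module_kernel: "shift_module d {F. weight_op d m X k F = (\<lambda>c. 0)}"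
proof -
  have z: "weight_op d m X k (\<lambda>c. 0) = (\<lambda>c. 0)"
    using weight_op_linear(2)[of d m X k 0 "\<lambda>c. 0"] by simp
  show ?thesis unfolding shift_module_def
    by (auto simp: weight_op_linear z) (simp add: shift_def)
qed

lemma shift_module_sum:
  assumes "shift_module d S" "\<And>i. i \<in> I \<Longrightarrow> F i \<in> S"
  shows "(\<lambda>c. \<Sum>i\<in>I. a i * F i c) \<in> S"
  using assms(2)
proof (induction I rule: infinite_finite_induct)
  case (insert i I)
  then have "F i \<in> S" "(\<lambda>c. \<Sum>i\<in>I. a i * F i c) \<in> S" by auto
  with assms(1) have "(\<lambda>c. a i * F i c + (\<Sum>i\<in>I. a i * F i c)) \<in> S"
    unfolding shift_module_def by simp
  then show ?case using insert by simp
qed (use assms(1) in \<open>auto simp: shift_module_def\<close>)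

text \<open>The families \<open>T i\<close> behave like eigenvectors, with pairwise different eigenvalues, of the
  operators with matrices \<open>A x\<close>: a dependence between them is reduced by eliminating one
  eigenvalue after the other.\<close>

lemma shift_diffs_eliminate:
  fixes A :: "'k::field \<Rightarrow> 'q \<Rightarrow> 'q \<Rightarrow> 'r::comm_ring_1"
  assumes S: "shift_module d S"
    and "distinct (k # js)"
    and "\<And>i x q. i \<in> set (k # js) \<Longrightarrow> q \<in> Q \<Longrightarrow> x \<noteq> 0 \<Longrightarrow>
           shift d i x (T i q) = (\<lambda>c. \<Sum>q'\<in>Q. A x q q' * T i q' c)"
    and "\<And>q. q \<in> Q \<Longrightarrow> (\<lambda>c. \<Sum>i\<in>set (k # js). T i q c) \<in> S"
    and "\<And>j. j \<in> set js \<Longrightarrow> x j \<noteq> 0"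
    and "q \<in> Q"
  shows "shift_diffs d k js x (T k q) \<in> S"
  using assms(2-)
proof (induction js arbitrary: T q)
  case Nil
  then show ?case by simp
next
  case (Cons j js)
  let ?x = "x j"
  \<comment> \<open>\<open>T' j\<close> vanishes, so the index \<open>j\<close> drops out. The sum
    of the \<open>T'\<close> stays in \<open>S\<close>: applying \<open>A\<close> to the summed
    families moves each \<open>T i\<close> by its own shift, and from this the \<open>j\<close>-th
    shift of the sum is subtracted.\<close>
  define T' where "T' = (\<lambda>i q. shift_diff d i j ?x (T i q))"
  have x0: "?x \<noteq> 0" using Cons.prems by simp
  have kj: "k \<noteq> j" "k \<notin> set js" "j \<notin> set js" "distinct js" using Cons.prems by auto
  have "shift_diffs d k js x (T' k q) \<in> S"
  proof (rule Cons.IH)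
    show "distinct (k # js)" using kj by simp
    fix i y q assume i: "i \<in> set (k # js)" and q: "q \<in> Q" and y: "y \<noteq> (0::'k)"
    have eq: "shift d i y (T i q) = (\<lambda>c. \<Sum>q'\<in>Q. A y q q' * T i q' c)"
      using i q y by (intro Cons.prems) auto
    have "shift d i y (T' i q) = shift_diff d i j ?x (shift d i y (T i q))"
      by (simp add: T'_def shift_diff_linear)
    also have "\<dots> = (\<lambda>c. \<Sum>q'\<in>Q. A y q q' * T' i q' c)"
      unfolding eq by (simp add: T'_def shift_diff_def shift_def sum_subtractf algebra_simps)
    finally show "shift d i y (T' i q) = (\<lambda>c. \<Sum>q'\<in>Q. A y q q' * T' i q' c)" .
  next
    fix q assume q: "q \<in> Q"
    let ?I = "set (k # j # js)"
    have sumS: "\<And>q. q \<in> Q \<Longrightarrow> (\<lambda>c. \<Sum>i\<in>?I. T i q c) \<in> S" by (rule Cons.prems)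
    have "(\<lambda>c. \<Sum>q'\<in>Q. A ?x q q' * (\<Sum>i\<in>?I. T i q' c)) \<in> S"
      by (rule shift_module_sum[OF S]) (rule sumS)
    also have "(\<lambda>c. \<Sum>q'\<in>Q. A ?x q q' * (\<Sum>i\<in>?I. T i q' c)) = (\<lambda>c. \<Sum>i\<in>?I. shift d i ?x (T i q) c)"
    proof
      fix c
      have "(\<Sum>q'\<in>Q. A ?x q q' * (\<Sum>i\<in>?I. T i q' c)) = (\<Sum>i\<in>?I. \<Sum>q'\<in>Q. A ?x q q' * T i q' c)"
        unfolding sum_distrib_left by (rule sum.swap)
      also have "\<dots> = (\<Sum>i\<in>?I. shift d i ?x (T i q) c)"
        using q x0 Cons.prems(2) by (intro sum.cong refl) simp
      finally show "(\<Sum>q'\<in>Q. A ?x q q' * (\<Sum>i\<in>?I. T i q' c)) = (\<Sum>i\<in>?I. shift d i ?x (T i q) c)" .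
    qed
    finally have 1: "(\<lambda>c. \<Sum>i\<in>?I. shift d i ?x (T i q) c) \<in> S" .
    have add: "(\<lambda>c. F c + G c) \<in> S" if "F \<in> S" "G \<in> S" for F G
      using S that unfolding shift_module_def by blast
    have 2: "shift d j ?x (\<lambda>c. \<Sum>i\<in>?I. T i q c) \<in> S"
      using S sumS[OF q] unfolding shift_module_def by blast
    have "(\<lambda>c. (-1) * shift d j ?x (\<lambda>c. \<Sum>i\<in>?I. T i q c) c) \<in> S"
      using S 2 unfolding shift_module_def by blast
    then have "(\<lambda>c. (\<Sum>i\<in>?I. shift d i ?x (T i q) c) + (-1) * shift d j ?x (\<lambda>c. \<Sum>i\<in>?I. T i q c) c) \<in> S"
      by (rule add[OF 1])
    also have "(\<lambda>c. (\<Sum>i\<in>?I. shift d i ?x (T i q) c) + (-1) * shift d j ?x (\<lambda>c. \<Sum>i\<in>?I. T i q c) c)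
        = (\<lambda>c. \<Sum>i\<in>set (k # js). T' i q c)"
      using kj by (simp add: T'_def shift_diff_def shift_def sum_subtractf algebra_simps)
    finally show "(\<lambda>c. \<Sum>i\<in>set (k # js). T' i q c) \<in> S" .
  qed (use Cons.prems in auto)
  then show ?case by (simp add: T'_def)
qed

text \<open>Among m coordinates chosen from fewer than m, two agree, so the determinant of the
  values \<open>w j (c j) (q i)\<close> has a repeated row. Expanding along the first remaining row
  and eliminating all weights but one isolates the diagonal term; after m rounds the determinant has
  become the product of its diagonal entries.\<close>

lemma weight_op_prod_eq_0:
  fixes A :: "'k::field \<Rightarrow> 'q \<Rightarrow> 'q \<Rightarrow> 'r::comm_ring_1" and w :: "nat \<Rightarrow> 'k \<Rightarrow> 'q \<Rightarrow> 'r"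
  assumes fin: "finite Q" and card: "card Q < m"
    and equi: "\<And>i x q c. i < m \<Longrightarrow> q \<in> Q \<Longrightarrow> x \<noteq> 0 \<Longrightarrow> w i (x ^ d i * c) q = (\<Sum>q'\<in>Q. A x q q' * w i c q')"
    and X: "\<And>i j. i < j \<Longrightarrow> j < m \<Longrightarrow> X i j \<noteq> 0"
    and q: "\<And>i. i < m \<Longrightarrow> q i \<in> Q"
  shows "weight_op d m X m (\<lambda>c. \<Prod>i<m. w i (c i) (q i)) = (\<lambda>c. 0)"
proof -
  \<comment> \<open>The block of rows and columns from \<open>k\<close> on: rows belong to the
    coordinates \<open>q i\<close>, columns to the vectors \<open>w j (c j)\<close>.\<close>
  define D where "D = (\<lambda>k q c. mat (m - k) (m - k) (\<lambda>(a, b). w (k + b) (c (k + b)) (q (k + a))))"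
  have main: "weight_op d m X k (\<lambda>c. (\<Prod>i<k. w i (c i) (q i)) * det (D k q c)) = (\<lambda>c. 0)"
    if "k \<le> m" "\<And>i. i < m \<Longrightarrow> q i \<in> Q" for k q
    using that
  proof (induction k arbitrary: q)
    case 0
    have "\<not> inj_on q {..<m}"
    proof
      assume "inj_on q {..<m}"
      then have "m \<le> card Q" using card_inj_on_le[of q "{..<m}" Q] 0 fin by auto
      then show False using card by simp
    qed
    then obtain a b where ab: "a < m" "b < m" "a \<noteq> b" "q a = q b" by (auto simp: inj_on_def)
    have "det (D 0 q c) = 0" for c
      by (rule det_identical_rows[of _ m a b])
         (use ab in \<open>auto simp: D_def intro!: eq_vecI\<close>)
    then show ?case by simp
  next
    case (Suc k)
    then have km: "k < m" by simp
    \<comment> \<open>The \<open>i\<close>-th term of the expansion along row \<open>k\<close>, with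
      that row moved to the coordinate \<open>p\<close>. The cofactor omits row \<open>k\<close> and
      column \<open>i\<close>, so it depends neither on \<open>p\<close> nor on \<open>c i\<close>,
      and the shift in \<open>c i\<close> acts through \<open>A\<close> alone.\<close>
    define T where "T = (\<lambda>i p c. (\<Prod>l<k. w l (c l) (q l)) *
        (w i (c i) p * cofactor (D k q c) 0 (i - k)))"
    have Dc: "D k q c \<in> carrier_mat (m - k) (m - k)" for k q c by (simp add: D_def)
    have cof_upd: "cofactor (D k (q(k := p)) c) 0 b = cofactor (D k q c) 0 b" for p b c
      unfolding cofactor_def
      by (intro arg_cong2[of _ _ _ _ "(*)"] arg_cong[of _ _ det] refl eq_matI)
         (auto simp: mat_delete_def D_def)
    have expand: "(\<Prod>l<k. w l (c l) (q l)) * det (D k (q(k := p)) c) = (\<Sum>i\<in>set (k # [Suc k..<m]). T i p c)" for p c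
    proof -
      have "det (D k (q(k := p)) c) = (\<Sum>b<m - k. D k (q(k := p)) c $$ (0, b) * cofactor (D k (q(k:=p)) c) 0 b)"
        by (rule laplace_expansion_row[OF Dc]) (use km in simp)
      also have "\<dots> = (\<Sum>b<m - k. w (k + b) (c (k + b)) p * cofactor (D k q c) 0 b)"
        unfolding cof_upd using km by (intro sum.cong refl) (simp add: D_def)
      also have "\<dots> = (\<Sum>i\<in>set (k # [Suc k..<m]). w i (c i) p * cofactor (D k q c) 0 (i - k))"
        by (rule sum.reindex_bij_witness[of _ "\<lambda>i. i - k" "\<lambda>b. k + b"]) (use km in auto)
      finally show ?thesis by (simp add: T_def sum_distrib_left del: list.set set_simps)
    qed
    have cof_shift: "cofactor (D k q (c(i := y))) 0 (i - k) = cofactor (D k q c) 0 (i - k)"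
      if "k \<le> i" for i c y
      unfolding cofactor_def
      by (intro arg_cong2[of _ _ _ _ "(*)"] arg_cong[of _ _ det] refl eq_matI)
         (use that in \<open>auto simp: mat_delete_def D_def\<close>)
    have "shift_diffs d k [Suc k..<m] (X k) (T k (q k)) \<in> {F. weight_op d m X k F = (\<lambda>c. 0)}"
    proof (rule shift_diffs_eliminate[OF shift_module_kernel, where Q = Q and A = A])
      fix i x p assume i: "i \<in> set (k # [Suc k..<m])" and p: "p \<in> Q" and x: "x \<noteq> (0::'k)"
      then have ki: "k \<le> i" "i < m" using km by auto
      show "shift d i x (T i p) = (\<lambda>c. \<Sum>q'\<in>Q. A x p q' * T i q' c)"
      proof
        fix c
        have pr: "(\<Prod>l<k. w l ((c(i := y)) l) (q l)) = (\<Prod>l<k. w l (c l) (q l))" for y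
          using ki by (intro prod.cong) auto
        show "shift d i x (T i p) c = (\<Sum>q'\<in>Q. A x p q' * T i q' c)"
          unfolding shift_def T_def pr cof_shift[OF ki(1)]
          by (simp only: fun_upd_same equi[OF ki(2) p x])
             (simp add: sum_distrib_left sum_distrib_right algebra_simps)
      qed
    next
      fix p assume p: "p \<in> Q"
      have "weight_op d m X k (\<lambda>c. (\<Prod>l<k. w l (c l) ((q(k := p)) l)) * det (D k (q(k := p)) c)) = (\<lambda>c. 0)"
        by (rule Suc.IH) (use Suc.prems p in auto)
      moreover have "(\<Prod>l<k. w l (c l) ((q(k := p)) l)) = (\<Prod>l<k. w l (c l) (q l))" for c
        by (intro prod.cong) auto
      ultimately show "(\<lambda>c. \<Sum>i\<in>set (k # [Suc k..<m]). T i p c) \<in> {F. weight_op d m X k F = (\<lambda>c. 0)}"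
        unfolding expand[symmetric] by simp
    qed (use X km Suc.prems in auto)
    moreover have "T k (q k) = (\<lambda>c. (\<Prod>i<Suc k. w i (c i) (q i)) * det (D (Suc k) q c))"
    proof
      fix c
      have "cofactor (D k q c) 0 0 = det (D (Suc k) q c)"
        unfolding cofactor_def
        by (simp, intro arg_cong[of _ _ det] eq_matI) (use km in \<open>auto simp: mat_delete_def D_def\<close>)
      then show "T k (q k) c = (\<Prod>i<Suc k. w i (c i) (q i)) * det (D (Suc k) q c)"
        by (simp add: T_def mult.assoc)
    qed
    ultimately show ?case by simp
  qed
  show ?thesis using main[of m q] q by (simp add: D_def)
qed

section \<open>Multiadditive functions and separated weights\<close>

definition multiadditive :: "nat \<Rightarrow> ((nat \<Rightarrow> 'k::field) \<Rightarrow> 'r::comm_ring_1) \<Rightarrow> bool" where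
  "multiadditive m F \<longleftrightarrow> (\<forall>i<m. \<forall>c a b. F (c(i := a + b)) = F (c(i := a)) + F (c(i := b)))"

text \<open>Since R carries no action of K, the characters x^d and x^d' are not elements of R that
  could be compared; the absence of balanced biadditive forms is the substitute. The
  \<open>itself\<close> arguments fix K and R, which occur only inside the quantifier.\<close>

definition weights_separated :: "'k::field itself \<Rightarrow> 'r::comm_ring_1 itself \<Rightarrow> nat \<Rightarrow> nat \<Rightarrow> bool" where
  "weights_separated _ _ d d' \<longleftrightarrow> (\<forall>\<beta> :: 'k \<Rightarrow> 'k \<Rightarrow> 'r.
     (\<forall>a a' b. \<beta> (a + a') b = \<beta> a b + \<beta> a' b) \<longrightarrow>
     (\<forall>a b b'. \<beta> a (b + b') = \<beta> a b + \<beta> a b') \<longrightarrow>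
     (\<forall>x a b. x \<noteq> 0 \<longrightarrow> \<beta> (x ^ d * a) b = \<beta> a (x ^ d' * b)) \<longrightarrow> (\<forall>a b. \<beta> a b = 0))"

lemma multiadditive_shift_diff:
  assumes "multiadditive m F"
  shows "multiadditive m (shift_diff d i j x F)"
proof -
  have s: "shift d i x F (c(l := a + b)) = shift d i x F (c(l := a)) + shift d i x F (c(l := b))"
    if "l < m" for c l a b i
    using assms that
    by (cases "i = l") (auto simp: shift_def multiadditive_def distrib_left fun_upd_twist[of l i])
  show ?thesis unfolding multiadditive_def shift_diff_def by (simp add: s)
qed

text \<open>With all arguments but \<open>i\<close> and \<open>j\<close> frozen, \<open>F\<close> is
  a biadditive form, and the vanishing of every \<open>shift_diff\<close> is the balance condition
  in \<open>weights_separated\<close>.\<close>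

lemma exists_shift_diff_nonzero:
  fixes F :: "(nat \<Rightarrow> 'k::field) \<Rightarrow> 'r::comm_ring_1"
  assumes F: "multiadditive m F" "F \<noteq> (\<lambda>c. 0)" and ij: "i < j" "j < m"
    and sep: "weights_separated TYPE('k) TYPE('r) (d i) (d j)"
  shows "\<exists>x. x \<noteq> 0 \<and> shift_diff d i j x F \<noteq> (\<lambda>c. 0)"
proof (rule ccontr)
  assume "\<not> ?thesis"
  then have z: "shift_diff d i j x F c = 0" if "x \<noteq> 0" for x c using that by metis
  obtain c where c: "F c \<noteq> 0" using F(2) by auto
  define \<beta> where "\<beta> = (\<lambda>a b. F (c(i := a, j := b)))"
  have "\<beta> (a + a') b = \<beta> a b + \<beta> a' b" for a a' b
    using F(1) ij unfolding multiadditive_def \<beta>_def by (simp add: fun_upd_twist[of i j])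
  moreover have "\<beta> a (b + b') = \<beta> a b + \<beta> a b'" for a b b'
    using F(1) ij unfolding multiadditive_def \<beta>_def by simp
  moreover have "\<beta> (x ^ d i * a) b = \<beta> a (x ^ d j * b)" if "x \<noteq> 0" for x a b
  proof -
    have "shift d i x F (c(i := a, j := b)) = shift d j x F (c(i := a, j := b))"
      using z[OF that, of "c(i := a, j := b)"] by (simp add: shift_diff_def)
    moreover have "shift d i x F (c(i := a, j := b)) = \<beta> (x ^ d i * a) b"
      using ij unfolding shift_def \<beta>_def by (intro arg_cong[of _ _ F]) auto
    moreover have "shift d j x F (c(i := a, j := b)) = \<beta> a (x ^ d j * b)"
      using ij unfolding shift_def \<beta>_def by (intro arg_cong[of _ _ F]) auto
    ultimately show ?thesis by simp
  qed
  ultimately have "\<beta> (c i) (c j) = 0" using sep unfolding weights_separated_def by blast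
  then show False using c by (simp add: \<beta>_def)
qed

lemma exists_shift_diffs_nonzero:
  fixes F :: "(nat \<Rightarrow> 'k::field) \<Rightarrow> 'r::comm_ring_1"
  assumes "multiadditive m F" "F \<noteq> (\<lambda>c. 0)" "distinct js" "\<And>j. j \<in> set js \<Longrightarrow> i < j \<and> j < m"
    and "\<And>i j. i < j \<Longrightarrow> j < m \<Longrightarrow> weights_separated TYPE('k) TYPE('r) (d i) (d j)"
  shows "\<exists>x. (\<forall>j. x j \<noteq> 0) \<and> multiadditive m (shift_diffs d i js x F) \<and> shift_diffs d i js x F \<noteq> (\<lambda>c. 0)"
  using assms
proof (induction js arbitrary: F)
  case Nil
  then show ?case by (intro exI[of _ "\<lambda>_. 1"]) simp
next
  case (Cons j js)
  obtain x where x: "x \<noteq> 0" "shift_diff d i j x F \<noteq> (\<lambda>c. 0)"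
    using exists_shift_diff_nonzero[of m F i j d] Cons.prems by auto
  obtain xs where xs: "\<forall>l. xs l \<noteq> 0" "multiadditive m (shift_diffs d i js xs (shift_diff d i j x F))"
      "shift_diffs d i js xs (shift_diff d i j x F) \<noteq> (\<lambda>c. 0)"
    using Cons.IH[OF multiadditive_shift_diff[OF Cons.prems(1)] x(2)] Cons.prems by auto
  have cong: "shift_diffs d i js (xs(j := x)) G = shift_diffs d i js xs G" for G :: "(nat \<Rightarrow> 'k) \<Rightarrow> 'r"
  proof -
    have "shift_diffs d i ls (xs(j := x)) G = shift_diffs d i ls xs G" if "j \<notin> set ls" for ls and G :: "(nat \<Rightarrow> 'k) \<Rightarrow> 'r"
      using that by (induction ls arbitrary: G) auto
    then show ?thesis using Cons.prems(3) by simp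
  qed
  show ?case
    by (rule exI[of _ "xs(j := x)"]) (use xs x cong in \<open>simp del: fun_upd_apply; simp\<close>)
qed

lemma exists_weight_op_nonzero:
  fixes F :: "(nat \<Rightarrow> 'k::field) \<Rightarrow> 'r::comm_ring_1"
  assumes "multiadditive m F" "F \<noteq> (\<lambda>c. 0)" "k \<le> m"
    and sep: "\<And>i j. i < j \<Longrightarrow> j < m \<Longrightarrow> weights_separated TYPE('k) TYPE('r) (d i) (d j)"
  shows "\<exists>X. (\<forall>i j. X i j \<noteq> 0) \<and> weight_op d m X k F \<noteq> (\<lambda>c. 0)"
  using assms(1-3)
proof (induction k arbitrary: F)
  case 0
  then show ?case by (intro exI[of _ "\<lambda>_ _. 1"]) simp
next
  case (Suc k)
  obtain x where x: "\<forall>j. x j \<noteq> 0" "multiadditive m (shift_diffs d k [Suc k..<m] x F)"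
      "shift_diffs d k [Suc k..<m] x F \<noteq> (\<lambda>c. 0)"
    using exists_shift_diffs_nonzero[OF Suc.prems(1,2), of "[Suc k..<m]" k d] sep by auto
  obtain X where X: "\<forall>i j. X i j \<noteq> 0" "weight_op d m X k (shift_diffs d k [Suc k..<m] x F) \<noteq> (\<lambda>c. 0)"
    using Suc.IH[OF x(2,3)] Suc.prems by auto
  have "weight_op d m (X(k := x)) k G = weight_op d m X k G" for G :: "(nat \<Rightarrow> 'k) \<Rightarrow> 'r"
    by (rule weight_op_cong) auto
  then show ?case using x X by (intro exI[of _ "X(k := x)"]) (simp del: fun_upd_apply; simp)
qed

section \<open>Nilpotency of one-parameter unipotent families\<close>

primrec unip_prod :: "nat \<Rightarrow> ('k \<Rightarrow> 'r::comm_ring_1 mat) \<Rightarrow> 'k list \<Rightarrow> 'r mat" where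
  "unip_prod n e [] = 1\<^sub>m n"
| "unip_prod n e (a # as) = (e a - 1\<^sub>m n) * unip_prod n e as"

lemma unip_prod_carrier [simp]:
  "(\<And>a. e a \<in> carrier_mat n n) \<Longrightarrow> unip_prod n e as \<in> carrier_mat n n"
  by (induction as) (auto intro: mult_carrier_mat)

text \<open>By Cayley-Hamilton \<open>\<Sum>\<^sub>k r\<^sub>k e (y\<^sup>k c) H\<^sup>k = 0\<close> for all \<open>c\<close>, with \<open>r\<^sub>n = 1\<close>.
  Replacing \<open>c\<close> by \<open>c + g\<close> and subtracting \<open>e (y\<^sup>l g)\<close> times the relation eliminates the \<open>l\<close>-th term.\<close>

lemma unip_prod_eq_0:
  fixes e :: "'k::field \<Rightarrow> 'r::comm_ring_1 mat"
  assumes e: "\<And>a. e a \<in> carrier_mat n n" "e 0 = 1\<^sub>m n" "\<And>a b. e (a + b) = e a * e b"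
    and H: "H \<in> carrier_mat n n" "Hi \<in> carrier_mat n n" "H * Hi = 1\<^sub>m n"
    and He: "\<And>c. H * e c = e (y * c) * H"
    and y: "\<And>l. l < n \<Longrightarrow> y ^ n \<noteq> y ^ l"
    and len: "n \<le> length as"
  shows "unip_prod n e as = 0\<^sub>m n n"
proof -
  have comm: "e a * e b = e b * e a" for a b using e(3)[of a b] e(3)[of b a] by (simp add: add.commute)
  note [simp] = mult_carrier_mat[of _ n n _ n] minus_carrier_mat[of _ n n] e(1) H(1,2) e(2)
  note assoc = assoc_mult_mat[of _ n n _ n _ n]
  note ldist = mult_minus_distrib_mat[of _ n n _ n] and rdist = minus_mult_distrib_mat[of _ n n _ _ n]
  have one [simp]: "A * 1\<^sub>m n = A" "1\<^sub>m n * A = A" "A * 0\<^sub>m n n = 0\<^sub>m n n" "0\<^sub>m n n * A = 0\<^sub>m n n"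
    if "A \<in> carrier_mat n n" for A :: "'r mat"
    using that by auto
  \<comment> \<open>\<open>P g l k\<close> is the factor that the k-th term of the relation has
    collected after \<open>l\<close> eliminations. It is a product of \<open>l\<close> differences,
    and the one with index \<open>k\<close> is zero.\<close>
  define P where "P = (\<lambda>g. rec_nat (\<lambda>k::nat. 1\<^sub>m n) (\<lambda>l Pl k. (e (y ^ k * g l) - e (y ^ l * g l)) * Pl k))"
  have P0: "P g 0 k = 1\<^sub>m n" and PS: "P g (Suc l) k = (e (y ^ k * g l) - e (y ^ l * g l)) * P g l k" for g l k
    by (simp_all add: P_def)
  have Pc [simp]: "P g l k \<in> carrier_mat n n" for g l k
    by (induction l) (auto simp: P0 PS)
  have Pz: "k < l \<Longrightarrow> P g l k = 0\<^sub>m n n" for g l k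
  proof (induction l)
    case (Suc l)
    have [simp]: "e a - e a = 0\<^sub>m n n" for a
      by (rule minus_r_inv_mat) (rule e(1))
    from Suc show ?case by (cases "k = l") (simp_all add: PS)
  qed simp
  have Hk [simp]: "H ^\<^sub>m k \<in> carrier_mat n n" for k using H by simp
  have H0: "H ^\<^sub>m 0 = 1\<^sub>m n" using carrier_matD(1)[OF H(1)] by simp
  have Hke: "H ^\<^sub>m k * e c = e (y ^ k * c) * H ^\<^sub>m k" for k c
  proof (induction k arbitrary: c)
    case (Suc k)
    have "H ^\<^sub>m Suc k * e c = H ^\<^sub>m k * (H * e c)" by (simp add: assoc)
    also have "\<dots> = (H ^\<^sub>m k * e (y * c)) * H" unfolding He by (simp add: assoc)
    also have "\<dots> = e (y ^ Suc k * c) * H ^\<^sub>m Suc k"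
      unfolding Suc by (simp add: assoc mult.assoc mult.left_commute)
    finally show ?case .
  qed (simp add: H0 del: pow_mat.simps)
  define r where "r = coeff (char_poly H)"
  have rn: "r n = 1" using degree_monic_char_poly[OF H(1)] by (simp add: r_def)
  have entry: "(A * B) $$ (i, j) = (\<Sum>t<n. A $$ (i, t) * B $$ (t, j))"
    if "A \<in> carrier_mat n n" "B \<in> carrier_mat n n" "i < n" "j < n" for A B :: "'r mat" and i j
    using that by (rule mat_mult_entry)
  \<comment> \<open>\<open>c\<close> has to be general, because an elimination combines the
    relations for \<open>c\<close> and for \<open>c + g l\<close>.\<close>
  have main: "(\<Sum>k\<le>n. r k * (e (y ^ k * c) * (P g l k * H ^\<^sub>m k)) $$ (i, j)) = 0"
    if ij: "i < n" "j < n" for g l c i j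
    using ij
  proof (induction l arbitrary: c i j)
    case 0
    have "(\<Sum>k\<le>n. r k * (e (y ^ k * c) * (P g 0 k * H ^\<^sub>m k)) $$ (i, j)) =
        (\<Sum>k\<le>n. r k * (\<Sum>t<n. (H ^\<^sub>m k) $$ (i, t) * e c $$ (t, j)))"
      using 0 by (simp add: P0 Hke[symmetric] entry)
    also have "\<dots> = (\<Sum>t<n. (\<Sum>k\<le>n. r k * (H ^\<^sub>m k) $$ (i, t)) * e c $$ (t, j))"
      unfolding sum_distrib_left sum_distrib_right by (subst sum.swap) (simp add: mult.assoc)
    also have "\<dots> = 0"
      using cayley_hamilton_entries[OF H(1) 0(1)] by (intro sum.neutral) (simp add: r_def)
    finally show ?case .
  next
    case (Suc l)
    let ?Q = "\<lambda>k. P g l k * H ^\<^sub>m k"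
    let ?b' = "e (y ^ l * g l)"
    have split: "e (y ^ k * c) * (P g (Suc l) k * H ^\<^sub>m k) =
        e (y ^ k * (c + g l)) * ?Q k - ?b' * (e (y ^ k * c) * ?Q k)" for k
    proof -
      let ?a = "e (y ^ k * c)" and ?b = "e (y ^ k * g l)"
      have "?a * (P g (Suc l) k * H ^\<^sub>m k) = ?a * (?b * ?Q k) - ?a * (?b' * ?Q k)"
        by (simp add: PS assoc ldist rdist)
      also have "?a * (?b * ?Q k) = e (y ^ k * (c + g l)) * ?Q k"
        by (simp add: distrib_left e(3) assoc)
      also have "?a * (?b' * ?Q k) = ?a * ?b' * ?Q k" by (simp add: assoc)
      also have "?a * ?b' * ?Q k = ?b' * (?a * ?Q k)" unfolding comm[of "y ^ k * c"] by (simp add: assoc)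
      finally show ?thesis .
    qed
    have minus: "(A - B) $$ (i, j) = A $$ (i, j) - B $$ (i, j)" if "B \<in> carrier_mat n n" for A B :: "'r mat"
      using that Suc.prems by auto
    have "(\<Sum>k\<le>n. r k * (e (y ^ k * c) * (P g (Suc l) k * H ^\<^sub>m k)) $$ (i, j)) =
       (\<Sum>k\<le>n. r k * (e (y ^ k * (c + g l)) * ?Q k) $$ (i, j)) -
       (\<Sum>k\<le>n. r k * (?b' * (e (y ^ k * c) * ?Q k)) $$ (i, j))"
      unfolding split by (subst minus) (simp_all add: right_diff_distrib sum_subtractf)
    also have "(\<Sum>k\<le>n. r k * (e (y ^ k * (c + g l)) * ?Q k) $$ (i, j)) = 0" by (rule Suc.IH[OF Suc.prems])
    also have "(\<Sum>k\<le>n. r k * (?b' * (e (y ^ k * c) * ?Q k)) $$ (i, j)) =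
       (\<Sum>k\<le>n. \<Sum>t<n. r k * (?b' $$ (i, t) * (e (y ^ k * c) * ?Q k) $$ (t, j)))"
      using Suc.prems by (subst entry) (simp_all add: sum_distrib_left)
    also have "\<dots> = (\<Sum>t<n. ?b' $$ (i, t) * (\<Sum>k\<le>n. r k * (e (y ^ k * c) * ?Q k) $$ (t, j)))"
      by (subst sum.swap) (simp add: sum_distrib_left mult.left_commute)
    also have "\<dots> = 0" using Suc by simp
    finally show ?case by simp
  qed
  have cancelH: "M = 0\<^sub>m n n" if "M \<in> carrier_mat n n" "M * H ^\<^sub>m k = 0\<^sub>m n n" for M k
    using that
  proof (induction k)
    case (Suc k)
    note [simp] = Suc.prems(1)
    have "M * H ^\<^sub>m k = M * H ^\<^sub>m k * (H * Hi)" using H by simp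
    also have "\<dots> = M * H ^\<^sub>m Suc k * Hi" by (simp add: assoc)
    also have "\<dots> = 0\<^sub>m n n" using Suc.prems by simp
    finally show ?case using Suc by blast
  qed (simp add: H0 del: pow_mat.simps)
  \<comment> \<open>After \<open>n\<close> eliminations only the term k = n is left, with
    coefficient \<open>r n = 1\<close>; the power of \<open>H\<close> is cancelled by means of its
    right inverse.\<close>
  have Pnn: "P g n n = 0\<^sub>m n n" for g
  proof (rule cancelH[OF Pc])
    show "P g n n * H ^\<^sub>m n = 0\<^sub>m n n"
    proof (rule eq_matI)
      fix i j assume "i < dim_row (0\<^sub>m n n :: 'r mat)" "j < dim_col (0\<^sub>m n n :: 'r mat)"
      then have ij: "i < n" "j < n" by simp_all
      have z: "(P g n k * H ^\<^sub>m k) $$ (i, j) = 0" if "k < n" for k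
        using Pz[OF that] ij by simp
      have "0 = (\<Sum>k\<le>n. r k * (P g n k * H ^\<^sub>m k) $$ (i, j))"
        using main[OF ij, of 0 g n] by simp
      also have "\<dots> = (\<Sum>k\<in>{n}. r k * (P g n k * H ^\<^sub>m k) $$ (i, j))"
        by (rule sum.mono_neutral_right) (auto simp: z)
      finally show "(P g n n * H ^\<^sub>m n) $$ (i, j) = 0\<^sub>m n n $$ (i, j)" using ij by (simp add: rn)
    qed (use carrier_matD[OF mult_carrier_mat[OF Pc Hk, of g n n n]] in auto)
  qed
  have exact: "unip_prod n e as = 0\<^sub>m n n" if len: "length as = n" for as
  proof -
    define h where "h = (\<lambda>l. rev as ! l)"
    \<comment> \<open>Chosen so that y^n g(l) - y^l g(l) = h(l): the l-th elimination factor becomes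
      a unit times \<open>e (h l) - 1\<close>. The list is reversed in \<open>h\<close> because each
      new factor is put in front.\<close>
    define g where "g = (\<lambda>l. h l / (y ^ n - y ^ l))"
    define U where "U = (\<lambda>l. unip_prod n e (rev (map h [0..<l])))"
    have Uc [simp]: "U l \<in> carrier_mat n n" for l by (simp add: U_def)
    have Pl: "P g l n = e (\<Sum>i<l. y ^ i * g i) * U l" if "l \<le> n" for l
      using that
    proof (induction l)
      case (Suc l)
      let ?b = "e (y ^ l * g l)" and ?B = "e (\<Sum>i<l. y ^ i * g i)"
      have "y ^ n * g l = y ^ l * g l + h l"
        using y[of l] Suc.prems by (simp add: g_def field_simps)
      then have "e (y ^ n * g l) - ?b = ?b * (e (h l) - 1\<^sub>m n)"
        by (simp add: e(3) ldist)
      then have "P g (Suc l) n = ?b * (e (h l) - 1\<^sub>m n) * (?B * U l)" using Suc by (simp add: PS)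
      also have "\<dots> = ?b * (((e (h l) - 1\<^sub>m n) * ?B) * U l)" by (simp add: assoc)
      also have "(e (h l) - 1\<^sub>m n) * ?B = ?B * (e (h l) - 1\<^sub>m n)"
        by (simp add: ldist rdist comm)
      also have "?b * (?B * (e (h l) - 1\<^sub>m n) * U l) = ?b * ?B * U (Suc l)" by (simp add: U_def assoc)
      also have "?b * ?B = e (\<Sum>i<Suc l. y ^ i * g i)" by (simp add: e(3)[symmetric] add.commute)
      finally show ?case .
    qed (simp add: P0 U_def)
    have z: "e (\<Sum>i<n. y ^ i * g i) * U n = 0\<^sub>m n n" using Pl[of n] Pnn[of g] by simp
    let ?B = "\<Sum>i<n. y ^ i * g i"
    have "U n = (e (- ?B) * e ?B) * U n" by (simp add: e(3)[symmetric])
    also have "\<dots> = e (- ?B) * (e ?B * U n)" by (simp add: assoc)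
    also have "\<dots> = 0\<^sub>m n n" unfolding z by simp
    finally have "U n = 0\<^sub>m n n" .
    moreover have "rev (map h [0..<n]) = as"
    proof -
      have "map h [0..<n] = rev as" unfolding h_def using len map_nth[of "rev as"] by simp
      then show ?thesis by simp
    qed
    ultimately show ?thesis by (simp add: U_def)
  qed
  show ?thesis using len
  proof (induction as)
    case (Cons a as)
    show ?case
    proof (cases "n = length (a # as)")
      case True
      show ?thesis by (rule exact) (rule True[symmetric])
    next
      case False
      then show ?thesis using Cons by simp
    qed
  qed (use exact in simp)
qed

lemma mat_mult3_entry:
  fixes A B C :: "'r::comm_ring_1 mat"
  assumes "A \<in> carrier_mat n n" "B \<in> carrier_mat n n" "C \<in> carrier_mat n n" "i < n" "j < n"
  shows "(A * B * C) $$ (i, j) = (\<Sum>(s, t)\<in>{..<n} \<times> {..<n}. A $$ (i, s) * C $$ (t, j) * B $$ (s, t))"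
proof -
  have "(A * B * C) $$ (i, j) = (\<Sum>t<n. \<Sum>s<n. A $$ (i, s) * C $$ (t, j) * B $$ (s, t))"
    using mat_mult_entry[OF mult_carrier_mat[OF assms(1,2)] assms(3-5)] mat_mult_entry[OF assms(1,2,4)]
    by (simp add: sum_distrib_right sum_distrib_left mult_ac)
  then show ?thesis by (subst (asm) sum.swap) (simp add: sum.cartesian_product)
qed

lemma exists_distinct_powers:
  assumes "infinite (UNIV :: 'k::field set)" "0 < d"
  shows "\<exists>x::'k. x \<noteq> 0 \<and> (\<forall>l<n. (x ^ d) ^ n \<noteq> (x ^ d) ^ l)"
proof -
  define p where "p = [:0, 1:] * (\<Prod>l<n. monom (1::'k) (d * n) - monom 1 (d * l))"
  have "monom (1::'k) (d * n) - monom 1 (d * l) \<noteq> 0" if "l < n" for l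
    using that assms(2) by (auto simp: monom_eq_iff')
  then have "p \<noteq> 0" by (auto simp: p_def)
  then have "finite {x. poly p x = 0}" by (rule poly_roots_finite)
  then obtain x where "poly p x \<noteq> 0" using assms(1) ex_new_if_finite[of "{x. poly p x = 0}"] by auto
  then show ?thesis
    by (intro exI[of _ x]) (auto simp: p_def poly_prod poly_monom power_mult)
qed

text \<open>A product of entries, one for each of more than \<open>n\<^sup>2\<close> weights, would be a nonzero eigenvector
  for more than \<open>n\<^sup>2\<close> characters of the torus acting by conjugation on \<open>n \<times> n\<close> matrices.\<close>

theorem prod_unipotent_entries_eq_0:
  fixes e :: "nat \<Rightarrow> 'k::field \<Rightarrow> 'r::comm_ring_1 mat"
  assumes inf: "infinite (UNIV :: 'k set)" and m: "n * n < m"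
    and e: "\<And>i a. i < m \<Longrightarrow> e i a \<in> carrier_mat n n" "\<And>i. i < m \<Longrightarrow> e i 0 = 1\<^sub>m n"
      "\<And>i a b. i < m \<Longrightarrow> e i (a + b) = e i a * e i b"
    and H: "\<And>x. x \<noteq> 0 \<Longrightarrow> H x \<in> carrier_mat n n" "\<And>x. x \<noteq> 0 \<Longrightarrow> Hi x \<in> carrier_mat n n"
      "\<And>x. x \<noteq> 0 \<Longrightarrow> H x * Hi x = 1\<^sub>m n"
    and He: "\<And>i x c. i < m \<Longrightarrow> x \<noteq> 0 \<Longrightarrow> H x * e i c = e i (x ^ d i * c) * H x"
    and d: "\<And>i. i < m \<Longrightarrow> 0 < d i"
    and sep: "\<And>i j. i < j \<Longrightarrow> j < m \<Longrightarrow> weights_separated TYPE('k) TYPE('r) (d i) (d j)"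
    and q: "\<And>i. i < m \<Longrightarrow> q i \<in> {..<n} \<times> {..<n}"
  shows "(\<Prod>i<m. (e i (c i) - 1\<^sub>m n) $$ q i) = 0"
proof (rule ccontr)
  assume nz: "\<not> ?thesis"
  let ?Q = "{..<n} \<times> {..<n}"
  define z where "z = (\<lambda>i a. e i a - 1\<^sub>m n)"
  have zc: "z i a \<in> carrier_mat n n" for i a by (simp add: z_def minus_carrier_mat)
  have Uc: "unip_prod n (e i) as \<in> carrier_mat n n" if "i < m" for i as
    using that e(1) by simp
  \<comment> \<open>Each \<open>z i (c i)\<close> is multiplied by further factors of its own kind,
    listed in \<open>L i\<close>. Lists of greatest total length for which the product can still be
    nonzero will make \<open>F\<close> additive in every argument.\<close>
  define F where "F = (\<lambda>q (L :: nat \<Rightarrow> 'k list) c. \<Prod>i<m. (z i (c i) * unip_prod n (e i) (L i)) $$ q i)"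
  define good where "good = (\<lambda>L. \<exists>q c. (\<forall>i<m. q i \<in> ?Q) \<and> F q L c \<noteq> 0)"
  have unip0: "unip_prod n (e i) as = 0\<^sub>m n n" if i: "i < m" and "n \<le> length as" for i as
  proof -
    obtain x :: 'k where "x \<noteq> 0" "\<forall>l<n. (x ^ d i) ^ n \<noteq> (x ^ d i) ^ l"
      using exists_distinct_powers[OF inf d[OF i]] by blast
    then show ?thesis
      using unip_prod_eq_0[of "e i" n "H x" "Hi x" "x ^ d i" as] e[OF i] H He[OF i] that by auto
  qed
  have "good (\<lambda>_. [])"
    unfolding good_def F_def
  proof (intro exI conjI)
    show "(\<Prod>i<m. (z i (c i) * unip_prod n (e i) []) $$ q i) \<noteq> 0"
      using nz right_mult_one_mat[OF zc] by (simp add: z_def)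
  qed (use q in simp)
  \<comment> \<open>Nilpotency (\<open>unip0\<close>) bounds the lists, so a maximal choice
    exists.\<close>
  moreover have bound: "(\<Sum>i<m. length (L i)) < Suc (m * n)" if "good L" for L
  proof -
    have "length (L i) \<le> n" if i: "i < m" for i
    proof (rule ccontr)
      assume "\<not> length (L i) \<le> n"
      then have "z i a * unip_prod n (e i) (L i) = 0\<^sub>m n n" for a using unip0[OF i] zc[of i a] by simp
      then have "F q L c = 0" if "\<forall>i<m. q i \<in> ?Q" for q c
        unfolding F_def using i that by (intro prod_zero) (auto intro!: bexI[of _ i])
      then show False using \<open>good L\<close> by (auto simp: good_def)
    qed
    then have "(\<Sum>i<m. length (L i)) \<le> (\<Sum>i<m. n)" by (intro sum_mono) simp
    then show ?thesis by simp
  qed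
  ultimately obtain L where L: "good L" "\<And>L'. good L' \<Longrightarrow> (\<Sum>i<m. length (L' i)) \<le> (\<Sum>i<m. length (L i))"
    using ex_has_greatest_nat[of good "\<lambda>_. []" "\<lambda>L. \<Sum>i<m. length (L i)" "Suc (m * n)"] by (meson less_imp_le)
  obtain q c where q: "\<forall>i<m. q i \<in> ?Q" and c: "F q L c \<noteq> 0" using L(1) by (auto simp: good_def)
  let ?U = "\<lambda>i. unip_prod n (e i) (L i)"
  have "multiadditive m (F q L)"
    unfolding multiadditive_def
  proof (intro allI impI)
    fix l c a b assume l: "l < m"
    have split: "F q L' (c(l := a)) = (z l a * unip_prod n (e l) (L' l)) $$ q l * (\<Prod>i\<in>{..<m}-{l}. (z i (c i) * ?U i) $$ q i)"
      if "\<forall>i. i \<noteq> l \<longrightarrow> L' i = L i" for a L'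
      unfolding F_def using l that by (subst prod.remove[of _ l]) (auto intro!: arg_cong2[of _ _ _ _ "(*)"] prod.cong)
    \<comment> \<open>In z(a + b) = z(a) + z(b) + z(a) z(b) the last summand contributes a value of
      \<open>F\<close> for the longer list \<open>b # L l\<close>, which is zero by
      maximality.\<close>
    let ?L = "L(l := b # L l)"
    have len: "(\<Sum>i<m. length (?L i)) = Suc (\<Sum>i<m. length (L i))"
    proof -
      have "(\<Sum>i\<in>{..<m}-{l}. length (?L i)) = (\<Sum>i\<in>{..<m}-{l}. length (L i))" by (intro sum.cong) auto
      then show ?thesis using l by (simp add: sum.remove[of _ l])
    qed
    then have "\<not> good ?L" using L(2)[of ?L] by auto
    then have long: "F q ?L (c(l := a)) = 0" using q by (auto simp: good_def)
    have ent: "(A + B) $$ q l = A $$ q l + B $$ q l" if "B \<in> carrier_mat n n" for A B :: "'r mat"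
      using that q l by (cases "q l") (auto simp: mem_Times_iff)
    note cs = zc[of l] Uc[OF l] e(1)[OF l]
    have "z l (a + b) = (z l a + z l b) + z l a * z l b"
    proof -
      have "z l b = e l b - 1\<^sub>m n" by (simp add: z_def)
      then have "z l a * z l b = z l a * (e l b - 1\<^sub>m n)" by simp
      also have "\<dots> = z l a * e l b - z l a * 1\<^sub>m n"
        by (intro mult_minus_distrib_mat[of _ n n _ n] zc) (use cs in auto)
      also have "z l a * e l b = e l a * e l b - 1\<^sub>m n * e l b"
        unfolding z_def by (intro minus_mult_distrib_mat[of _ n n _ _ n]) (use cs in auto)
      finally have "z l a * z l b = e l (a + b) - e l b - (e l a - 1\<^sub>m n)"
        using left_mult_one_mat[OF e(1)[OF l]] right_mult_one_mat[OF zc, of l a] e(3)[OF l] by (simp add: z_def)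
      then show ?thesis
        using cs by (intro eq_matI) (auto simp: z_def carrier_matD[OF e(1)[OF l]])
    qed
    then have "z l (a + b) * ?U l = (z l a * ?U l + z l b * ?U l) + z l a * (z l b * ?U l)"
      using cs by (simp add: add_mult_distrib_mat[of _ n n _ _ n] assoc_mult_mat[of _ n n _ n _ n] mult_carrier_mat[of _ n n _ n])
    then have "(z l (a + b) * ?U l) $$ q l = (z l a * ?U l) $$ q l + (z l b * ?U l) $$ q l + (z l a * (z l b * ?U l)) $$ q l"
      using cs by (simp add: ent mult_carrier_mat[of _ n n _ n])
    moreover have "(z l a * (z l b * ?U l)) $$ q l * (\<Prod>i\<in>{..<m}-{l}. (z i (c i) * ?U i) $$ q i) = 0"
      using long split[of ?L a] by (simp add: z_def)
    ultimately show "F q L (c(l := a + b)) = F q L (c(l := a)) + F q L (c(l := b))"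
      by (simp add: split[of L] algebra_simps)
  qed
  moreover have "F q L \<noteq> (\<lambda>c. 0)" using c by auto
  ultimately obtain X :: "nat \<Rightarrow> nat \<Rightarrow> 'k" where X: "\<forall>i j. X i j \<noteq> 0" "weight_op d m X m (F q L) \<noteq> (\<lambda>c. 0)"
    using exists_weight_op_nonzero[of m "F q L" m d] sep by blast
  define S where "S = {G. weight_op d m X m G = (\<lambda>c. 0 :: 'r)}"
  have zx: "z i (x ^ d i * a) = H x * z i a * Hi x" if "i < m" "x \<noteq> 0" for i x a
  proof -
    note cs = e(1)[OF that(1)] H[OF that(2)]
    have "H x * z i a = H x * e i a - H x * 1\<^sub>m n"
      unfolding z_def by (intro mult_minus_distrib_mat[of _ n n _ n]) (use cs in auto)
    also have "\<dots> = e i (x ^ d i * a) * H x - 1\<^sub>m n * H x" using He[OF that] cs by simp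
    also have "\<dots> = z i (x ^ d i * a) * H x"
      unfolding z_def by (intro minus_mult_distrib_mat[of _ n n _ _ n, symmetric]) (use cs in auto)
    finally have "H x * z i a * Hi x = z i (x ^ d i * a) * (H x * Hi x)"
      using cs zc by (simp add: assoc_mult_mat[of _ n n _ n _ n])
    then show ?thesis using cs(4) right_mult_one_mat[OF zc] by simp
  qed
  \<comment> \<open>The entries of \<open>z i a\<close> are n * n < m coordinates on which the torus
    acts by conjugation, by the same matrices for every \<open>i\<close>; only the exponent
    \<open>d i\<close> differs.\<close>
  have basis: "(\<lambda>c. \<Prod>i<m. z i (c i) $$ p i) \<in> S" if p: "\<And>i. i < m \<Longrightarrow> p i \<in> ?Q" for p
  proof -
    have "weight_op d m X m (\<lambda>c. \<Prod>i<m. z i (c i) $$ p i) = (\<lambda>c. 0)"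
    proof (rule weight_op_prod_eq_0[where Q = ?Q and w = "\<lambda>i a q. z i a $$ q"
          and A = "\<lambda>x q q'. H x $$ (fst q, fst q') * Hi x $$ (snd q', snd q)"])
      fix i q a and x :: 'k assume "i < m" "q \<in> ?Q" "x \<noteq> 0"
      then show "z i (x ^ d i * a) $$ q = (\<Sum>q'\<in>?Q. H x $$ (fst q, fst q') * Hi x $$ (snd q', snd q) * z i a $$ q')"
        using mat_mult3_entry[OF H(1)[of x] zc[of i a] H(2)[of x], where i = "fst q" and j = "snd q"] zx[of i x a]
        by (simp add: case_prod_unfold mem_Times_iff)
    qed (use m X p in auto)
    then show ?thesis by (simp add: S_def)
  qed
  \<comment> \<open>The matrices \<open>?U i\<close> do not depend on \<open>c\<close> and merely
    form R-linear combinations of the products in \<open>basis\<close>. So \<open>weight_op\<close>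
    annihilates \<open>F\<close> too, against the choice of \<open>X\<close>.\<close>
  have "F q L = (\<lambda>c. \<Sum>t\<in>{..<m} \<rightarrow>\<^sub>E {..<n}. (\<Prod>i<m. ?U i $$ (t i, snd (q i))) * (\<Prod>i<m. z i (c i) $$ (fst (q i), t i)))"
  proof
    fix c
    have "F q L c = (\<Prod>i<m. \<Sum>t<n. ?U i $$ (t, snd (q i)) * z i (c i) $$ (fst (q i), t))"
      unfolding F_def
    proof (intro prod.cong refl)
      fix i assume "i \<in> {..<m}"
      then have i: "i < m" "fst (q i) < n" "snd (q i) < n" using q by (auto simp: mem_Times_iff)
      show "(z i (c i) * ?U i) $$ q i = (\<Sum>t<n. ?U i $$ (t, snd (q i)) * z i (c i) $$ (fst (q i), t))"
        using mat_mult_entry[OF zc Uc[OF i(1)] i(2,3)] by (simp add: mult.commute)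
    qed
    also have "\<dots> = (\<Sum>t\<in>{..<m} \<rightarrow>\<^sub>E {..<n}. \<Prod>i<m. ?U i $$ (t i, snd (q i)) * z i (c i) $$ (fst (q i), t i))"
      by (rule prod_sum_PiE) auto
    finally show "F q L c = (\<Sum>t\<in>{..<m} \<rightarrow>\<^sub>E {..<n}. (\<Prod>i<m. ?U i $$ (t i, snd (q i))) * (\<Prod>i<m. z i (c i) $$ (fst (q i), t i)))"
      by (simp add: prod.distrib)
  qed
  also have "\<dots> \<in> S"
  proof (rule shift_module_sum)
    show "shift_module d S" unfolding S_def by (rule shift_module_kernel)
    fix t assume "t \<in> {..<m} \<rightarrow>\<^sub>E {..<n}"
    then show "(\<lambda>c. \<Prod>i<m. z i (c i) $$ (fst (q i), t i)) \<in> S"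
      using q by (intro basis) (auto simp: mem_Times_iff PiE_iff)
  qed
  finally show False using X(2) by (simp add: S_def)
qed

text \<open>The pairs \<open>(r, r')\<close> with \<open>\<beta> (r a) b = \<beta> a (r' b)\<close> form a ring. If \<open>r = 0\<close> and \<open>r' \<noteq> 0\<close> occurs
  or vice versa, then \<open>\<beta> = 0\<close>.\<close>

lemma weights_separatedI:
  assumes "\<And>\<Gamma> :: ('k::field \<times> 'k) set. (\<And>x. x \<noteq> 0 \<Longrightarrow> (x ^ d, x ^ d') \<in> \<Gamma>) \<Longrightarrow> (1, 1) \<in> \<Gamma> \<Longrightarrow>
      (\<And>r r' s s'. (r, r') \<in> \<Gamma> \<Longrightarrow> (s, s') \<in> \<Gamma> \<Longrightarrow> (r + s, r' + s') \<in> \<Gamma>) \<Longrightarrow>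
      (\<And>r r' s s'. (r, r') \<in> \<Gamma> \<Longrightarrow> (s, s') \<in> \<Gamma> \<Longrightarrow> (r - s, r' - s') \<in> \<Gamma>) \<Longrightarrow>
      \<exists>r. r \<noteq> 0 \<and> ((r, 0) \<in> \<Gamma> \<or> (0, r) \<in> \<Gamma>)"
  shows "weights_separated TYPE('k) TYPE('r::comm_ring_1) d d'"
  unfolding weights_separated_def
proof (intro allI impI)
  fix \<beta> :: "'k \<Rightarrow> 'k \<Rightarrow> 'r" and a b
  assume add: "\<forall>a a' b. \<beta> (a + a') b = \<beta> a b + \<beta> a' b" "\<forall>a b b'. \<beta> a (b + b') = \<beta> a b + \<beta> a b'"
    and x: "\<forall>x a b. x \<noteq> 0 \<longrightarrow> \<beta> (x ^ d * a) b = \<beta> a (x ^ d' * b)"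
  define \<Gamma> where "\<Gamma> = {(r, r'). \<forall>a b. \<beta> (r * a) b = \<beta> a (r' * b)}"
  have z: "\<beta> 0 b = 0" "\<beta> a 0 = 0" for a b
    using add(1)[rule_format, of 0 0 b] add(2)[rule_format, of a 0 0] by simp_all
  have diff: "\<beta> (a - a') b = \<beta> a b - \<beta> a' b" "\<beta> b (a - a') = \<beta> b a - \<beta> b a'" for a a' b
    using add(1)[rule_format, of "a - a'" a' b] add(2)[rule_format, of b "a - a'" a'] by simp_all
  obtain r where r: "r \<noteq> 0" "(r, 0) \<in> \<Gamma> \<or> (0, r) \<in> \<Gamma>"
    using assms[of \<Gamma>] add x by (auto simp: \<Gamma>_def distrib_right left_diff_distrib diff)
  have "(\<forall>a b. \<beta> (r * a) b = 0) \<or> (\<forall>a b. \<beta> a (r * b) = 0)"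
    using r(2) z by (auto simp: \<Gamma>_def)
  then have "\<beta> (r * (a / r)) b = 0 \<or> \<beta> a (r * (b / r)) = 0" by blast
  then show "\<beta> a b = 0" using r(1) by simp
qed

text \<open>Take x = 2 and subtract the pair (2^d, 2^d), which lies in the ring because it is a
  multiple of (1, 1).\<close>

lemma weights_separated_char_0:
  assumes "CHAR('k::field) = 0" "d < d'"
  shows "weights_separated TYPE('k) TYPE('r::comm_ring_1) d d'"
proof (rule weights_separatedI)
  fix \<Gamma> :: "('k \<times> 'k) set"
  assume G: "\<And>x. x \<noteq> 0 \<Longrightarrow> (x ^ d, x ^ d') \<in> \<Gamma>" "(1, 1) \<in> \<Gamma>"
    "\<And>r r' s s'. (r, r') \<in> \<Gamma> \<Longrightarrow> (s, s') \<in> \<Gamma> \<Longrightarrow> (r + s, r' + s') \<in> \<Gamma>"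
    "\<And>r r' s s'. (r, r') \<in> \<Gamma> \<Longrightarrow> (s, s') \<in> \<Gamma> \<Longrightarrow> (r - s, r' - s') \<in> \<Gamma>"
  have inj: "of_nat a = (of_nat b :: 'k) \<longleftrightarrow> a = b" for a b
  proof -
    have "of_nat k \<noteq> (0::'k)" if "k > 0" for k using assms(1) that by (auto simp: of_nat_eq_0_iff_char_dvd)
    then have "of_nat b - of_nat a \<noteq> (0::'k)" if "a < b" for a b
      using that by (metis of_nat_diff less_imp_le zero_less_diff)
    then show ?thesis by (metis diff_self linorder_neqE_nat)
  qed
  have "(of_nat k, of_nat k) \<in> \<Gamma>" if "k > 0" for k
    using that G(2,3) by (induction k rule: nat_induct_non_zero) (auto simp: add.commute)
  moreover have "(2 ^ d, 2 ^ d') \<in> \<Gamma>" using G(1)[of 2] inj[of 2 0] by simp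
  moreover have "of_nat (2 ^ d) = (2 ^ d :: 'k)" by simp
  ultimately have "(2 ^ d - 2 ^ d, 2 ^ d' - 2 ^ d) \<in> \<Gamma>"
    by (metis G(4) zero_less_numeral zero_less_power)
  moreover have "2 ^ d' \<noteq> (2 ^ d :: 'k)" using inj[of "2 ^ d'" "2 ^ d"] assms(2) by simp
  ultimately show "\<exists>r. r \<noteq> 0 \<and> ((r, 0) \<in> \<Gamma> \<or> (0, r) \<in> \<Gamma>)" by (intro exI[of _ "2 ^ d' - 2 ^ d"]) simp
qed

text \<open>Polarising x^(1 + q) gives the pairs in \<open>G2\<close>; inserting x^(1 + q) itself
  there cancels the first component and leaves a nonzero polynomial in x as the second. Exponents d
  and p d would fail: for R = K the form \<open>\<beta> a b = a ^ p * b\<close> balances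
  them.\<close>

lemma weights_separated_char_p:
  assumes p: "prime p" "CHAR('k::field) = p" and inf: "infinite (UNIV :: 'k set)"
    and i: "0 < i" "i < j"
  shows "weights_separated TYPE('k) TYPE('r::comm_ring_1) (Suc (p ^ i)) (Suc (p ^ j))"
proof (rule weights_separatedI)
  fix \<Gamma> :: "('k \<times> 'k) set"
  define q q' where "q = p ^ i" and "q' = p ^ j"
  assume G0: "\<And>x. x \<noteq> 0 \<Longrightarrow> (x ^ Suc (p ^ i), x ^ Suc (p ^ j)) \<in> \<Gamma>" "(1, 1) \<in> \<Gamma>"
    "\<And>r r' s s'. (r, r') \<in> \<Gamma> \<Longrightarrow> (s, s') \<in> \<Gamma> \<Longrightarrow> (r + s, r' + s') \<in> \<Gamma>"
    "\<And>r r' s s'. (r, r') \<in> \<Gamma> \<Longrightarrow> (s, s') \<in> \<Gamma> \<Longrightarrow> (r - s, r' - s') \<in> \<Gamma>"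
  have "(0, 0) \<in> \<Gamma>" using G0(4)[OF G0(2,2)] by simp
  then have G1: "(x * x ^ q, x * x ^ q') \<in> \<Gamma>" for x using G0(1)[of x] by (cases "x = 0") (auto simp: q_def q'_def)
  have fr: "(x + y) ^ q = x ^ q + y ^ q" "(x + y) ^ q' = x ^ q' + y ^ q'" for x y :: 'k
    using p by (auto simp: q_def q'_def intro!: freshmans_dream')
  \<comment> \<open>The value at x + 1 minus those at x and at 1; Frobenius makes the q-th power
    additive.\<close>
  have G2: "(x ^ q + x, x ^ q' + x) \<in> \<Gamma>" for x
  proof -
    have "((x + 1) * (x + 1) ^ q - x * x ^ q - 1 * 1 ^ q, (x + 1) * (x + 1) ^ q' - x * x ^ q' - 1 * 1 ^ q') \<in> \<Gamma>"
      by (intro G0(4) G1)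
    then show ?thesis by (simp add: fr algebra_simps)
  qed
  \<comment> \<open>\<open>G2\<close> at x^(1 + q), minus \<open>G1\<close> at x and at x^q.\<close>
  have G3: "(0, (x * x ^ q) ^ q' + x * x ^ q - x * x ^ q' - x ^ q * (x ^ q) ^ q') \<in> \<Gamma>" for x
  proof -
    have "((x * x ^ q) ^ q + x * x ^ q - x * x ^ q - x ^ q * (x ^ q) ^ q,
        (x * x ^ q) ^ q' + x * x ^ q - x * x ^ q' - x ^ q * (x ^ q) ^ q') \<in> \<Gamma>"
      by (intro G0(4) G1 G2)
    then show ?thesis by (simp add: power_mult_distrib)
  qed
  have pp: "2 \<le> p" using p by (simp add: prime_ge_2_nat)
  have q: "2 \<le> q" "q < q'"
    using pp i power_increasing[of 1 i p] power_strict_increasing[of i j p] by (auto simp: q_def q'_def)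
  \<comment> \<open>The second component of \<open>G3\<close> as a polynomial in x; its term of
    degree 1 + q meets no other term.\<close>
  define P where "P = monom (1::'k) (Suc q * q') + monom 1 (Suc q) - monom 1 (Suc q') - monom 1 (q + q * q')"
  have "coeff P (Suc q) = 1"
  proof -
    have "q' \<le> q * q'" using q by simp
    moreover have "Suc q * q' = q * q' + q'" by simp
    ultimately have "Suc q * q' \<noteq> Suc q" "Suc q' \<noteq> Suc q" "q + q * q' \<noteq> Suc q" using q by linarith+
    then show ?thesis by (simp add: P_def del: mult_Suc)
  qed
  then have "P \<noteq> 0" by auto
  then have "finite {x. poly P x = 0}" by (rule poly_roots_finite)
  then obtain x where x: "poly P x \<noteq> 0" using inf ex_new_if_finite[of "{x. poly P x = 0}"] by auto
  have "poly P x = (x * x ^ q) ^ q' + x * x ^ q - x * x ^ q' - x ^ q * (x ^ q) ^ q'"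
    by (simp add: P_def poly_monom power_add power_mult power_mult_distrib)
  then show "\<exists>r. r \<noteq> 0 \<and> ((r, 0) \<in> \<Gamma> \<or> (0, r) \<in> \<Gamma>)" using G3[of x] x by metis
qed

section \<open>Evaluation of polynomials in two variables\<close>

abbreviation const2 :: "'k::field \<Rightarrow> 'k poly poly" where
  "const2 c \<equiv> [:[:c:]:]"

text \<open>One evaluation for all targets: composition of maps, values at a point, flows over
  K[x,y][T] and Laurent series differ only in the coefficient map \<open>h\<close>.\<close>

definition ev2 :: "('k::field \<Rightarrow> 'b::comm_ring_1) \<Rightarrow> 'k poly poly \<Rightarrow> 'b \<Rightarrow> 'b \<Rightarrow> 'b" where
  "ev2 h p u v = poly (map_poly (\<lambda>q. poly (map_poly h q) u) p) v"

lemma subst2_ev2: "subst2 p \<phi> = ev2 const2 p (fst \<phi>) (snd \<phi>)"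
  by (simp add: subst2_def ev2_def)

lemma comm_ring_homI:
  fixes f :: "'a::comm_ring_1 \<Rightarrow> 'b::comm_ring_1"
  assumes "\<And>x y. f (x + y) = f x + f y" "\<And>x y. f (x * y) = f x * f y" "f 1 = 1"
  shows "comm_ring_hom f"
proof -
  have "f 0 = 0" using assms(1)[of 0 0] by simp
  then show ?thesis by unfold_locales (use assms in auto)
qed

lemma comm_ring_hom_const [simp]:
  "comm_ring_hom (\<lambda>c::'a::comm_ring_1. [:c:])" "comm_ring_hom (\<lambda>c::'k::field. const2 c)"
  "comm_ring_hom (\<lambda>c::'k::field. [:const2 c:])"
  by (auto intro!: comm_ring_homI simp: one_pCons)

lemma comm_ring_hom_poly_map:
  assumes "comm_ring_hom h"
  shows "comm_ring_hom (\<lambda>q. poly (map_poly h q) u)"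
proof -
  interpret comm_ring_hom h by fact
  interpret m: map_poly_comm_ring_hom h ..
  show ?thesis by (rule comm_ring_homI) (simp_all add: m.hom_add m.hom_mult)
qed

lemma comm_ring_hom_ev2:
  assumes "comm_ring_hom h"
  shows "comm_ring_hom (\<lambda>p. ev2 h p u v)"
  unfolding ev2_def by (rule comm_ring_hom_poly_map[OF comm_ring_hom_poly_map[OF assms]])

lemma map_poly_pCons_0: "f 0 = 0 \<Longrightarrow> map_poly f (pCons c p) = pCons (f c) (map_poly f p)"
  by (intro poly_eqI) (simp add: coeff_map_poly coeff_pCons split: nat.split)

lemma poly_map_sum:
  assumes "comm_ring_hom h" "\<And>k. coeff q k \<noteq> 0 \<Longrightarrow> k \<in> S" "finite S"
  shows "poly (map_poly h q) u = (\<Sum>k\<in>S. h (coeff q k) * u ^ k)"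
proof -
  interpret comm_ring_hom h by fact
  interpret m: map_poly_comm_ring_hom h ..
  have z: "h (coeff q k) * u ^ k = 0" if "coeff q k = 0" for k using that by simp
  have "poly (map_poly h q) u = (\<Sum>k\<le>degree (map_poly h q). h (coeff q k) * u ^ k)"
    unfolding poly_altdef by simp
  also have "\<dots> = (\<Sum>k\<in>S \<union> {..degree (map_poly h q)}. h (coeff q k) * u ^ k)"
  proof (rule sum.mono_neutral_left)
    show "\<forall>k\<in>S \<union> {..degree (map_poly h q)} - {..degree (map_poly h q)}. h (coeff q k) * u ^ k = 0"
      using coeff_eq_0[of "map_poly h q"] by (auto simp del: le_degree)
  qed (use assms in auto)
  also have "\<dots> = (\<Sum>k\<in>S. h (coeff q k) * u ^ k)"
    by (rule sum.mono_neutral_right) (use assms z in blast)+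
  finally show ?thesis .
qed

section \<open>Supports of polynomials in two variables\<close>

abbreviation cf :: "'k::field poly poly \<Rightarrow> nat \<Rightarrow> nat \<Rightarrow> 'k" where
  "cf p k l \<equiv> coeff (coeff p l) k"

definition supp2 :: "'k::field poly poly \<Rightarrow> (nat \<times> nat) set" where
  "supp2 p = {(k, l). cf p k l \<noteq> 0}"

lemma finite_supp2 [simp]: "finite (supp2 p)"
proof -
  have "supp2 p \<subseteq> (\<Union>l\<le>degree p. {..degree (coeff p l)} \<times> {l})"
    by (auto simp: supp2_def intro!: bexI le_degree)
  then show ?thesis by (rule finite_subset) auto
qed

lemma supp2_eq_empty_iff [simp]: "supp2 p = {} \<longleftrightarrow> p = 0"
  by (auto simp: supp2_def poly_eq_iff)

lemma ev2_sum:
  assumes h: "comm_ring_hom h" and S: "supp2 p \<subseteq> S" "finite S"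
  shows "ev2 h p u v = (\<Sum>(k, l)\<in>S. h (cf p k l) * u ^ k * v ^ l)"
proof -
  interpret comm_ring_hom h by fact
  have fin: "finite (fst ` S)" "finite (snd ` S)" using S by auto
  have "ev2 h p u v = (\<Sum>l\<in>snd ` S. poly (map_poly h (coeff p l)) u * v ^ l)"
    unfolding ev2_def
  proof (rule poly_map_sum[OF comm_ring_hom_poly_map[OF h] _ fin(2)])
    fix l assume "coeff p l \<noteq> 0"
    then obtain k where "cf p k l \<noteq> 0" by (auto simp: poly_eq_iff)
    then have "(k, l) \<in> S" using S by (auto simp: supp2_def)
    then show "l \<in> snd ` S" by force
  qed
  also have "\<dots> = (\<Sum>l\<in>snd ` S. (\<Sum>k\<in>fst ` S. h (cf p k l) * u ^ k) * v ^ l)"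
  proof (intro sum.cong refl arg_cong2[of _ _ _ _ "(*)"] poly_map_sum[OF h] fin)
    fix l k assume "cf p k l \<noteq> 0"
    then have "(k, l) \<in> S" using S by (auto simp: supp2_def)
    then show "k \<in> fst ` S" by force
  qed
  also have "\<dots> = (\<Sum>(k, l)\<in>fst ` S \<times> snd ` S. h (cf p k l) * u ^ k * v ^ l)"
    unfolding sum_distrib_right by (subst sum.swap) (rule sum.cartesian_product)
  also have "\<dots> = (\<Sum>(k, l)\<in>S. h (cf p k l) * u ^ k * v ^ l)"
  proof (rule sum.mono_neutral_right)
    show "S \<subseteq> fst ` S \<times> snd ` S" by force
    show "\<forall>i\<in>fst ` S \<times> snd ` S - S. (case i of (k, l) \<Rightarrow> h (cf p k l) * u ^ k * v ^ l) = 0"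
    proof
      fix i assume i: "i \<in> fst ` S \<times> snd ` S - S"
      obtain k l where kl: "i = (k, l)" by (cases i)
      then have "(k, l) \<notin> supp2 p" using i S by auto
      then show "(case i of (k, l) \<Rightarrow> h (cf p k l) * u ^ k * v ^ l) = 0" by (simp add: kl supp2_def)
    qed
  qed (use fin in simp)
  finally show ?thesis .
qed

lemma ev2_hom:
  assumes "comm_ring_hom h" "comm_ring_hom f"
  shows "f (ev2 h p u v) = ev2 (\<lambda>c. f (h c)) p (f u) (f v)"
proof -
  interpret h: comm_ring_hom h by fact
  interpret f: comm_ring_hom f by fact
  have "comm_ring_hom (\<lambda>c. f (h c))"
    by (rule comm_ring_homI) (simp_all add: h.hom_add h.hom_mult f.hom_add f.hom_mult)
  from ev2_sum[OF this subset_refl] show ?thesis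
    by (simp add: ev2_sum[OF assms(1) subset_refl] f.hom_sum f.hom_mult f.hom_power case_prod_unfold)
qed

lemma ev2_pCons: "comm_ring_hom h \<Longrightarrow> ev2 h (pCons a p) u v = poly (map_poly h a) u + v * ev2 h p u v"
proof -
  assume h: "comm_ring_hom h"
  then interpret comm_ring_hom h .
  interpret p: comm_ring_hom "\<lambda>q. poly (map_poly h q) u" by (rule comm_ring_hom_poly_map[OF h])
  show ?thesis by (simp add: ev2_def map_poly_pCons_0)
qed

lemma ev2_simps [simp]:
  assumes "comm_ring_hom h"
  shows "ev2 h 0 u v = 0" "ev2 h (const2 c) u v = h c" "ev2 h varX u v = u" "ev2 h varY u v = v"
proof -
  interpret comm_ring_hom h by fact
  show 0: "ev2 h 0 u v = 0" by (simp add: ev2_def)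
  show "ev2 h (const2 c) u v = h c" "ev2 h varX u v = u" "ev2 h varY u v = v"
    by (simp_all add: varX_def varY_def ev2_pCons[OF assms] 0 map_poly_pCons_0 one_pCons)
qed

lemma monom2: "const2 c * varX ^ k * varY ^ l = monom (monom c k) l"
proof -
  have "varX ^ k = [:monom (1::'a) k:]"
    by (induction k) (auto simp: varX_def one_pCons monom_Suc)
  moreover have "varY ^ l = (monom 1 l :: 'a poly poly)"
  proof (induction l)
    case 0
    show ?case by (simp add: monom_0 one_pCons)
  qed (simp add: varY_def monom_Suc)
  ultimately show ?thesis by (simp add: smult_monom)
qed

lemma ev2_self: "ev2 const2 p varX varY = p"
proof -
  have "ev2 const2 p varX varY = (\<Sum>(k, l)\<in>supp2 p. monom (monom (cf p k l) k) l)"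
    by (subst ev2_sum[OF _ subset_refl]) (simp_all add: monom2[symmetric])
  also have "\<dots> = p"
  proof (intro poly_eqI)
    fix l k
    have "cf (\<Sum>(k, l)\<in>supp2 p. monom (monom (cf p k l) k) l) k l =
        (\<Sum>x\<in>supp2 p. if x = (k, l) then cf p k l else 0)"
      unfolding coeff_sum by (intro sum.cong refl) (auto split: if_splits)
    also have "\<dots> = (if (k, l) \<in> supp2 p then cf p k l else 0)"
      by (rule sum.delta[OF finite_supp2])
    also have "\<dots> = cf p k l" by (auto simp: supp2_def)
    finally show "cf (\<Sum>(k, l)\<in>supp2 p. monom (monom (cf p k l) k) l) k l = cf p k l" .
  qed
  finally show ?thesis .
qed

lemma ev2_subst2:
  assumes "comm_ring_hom h"
  shows "ev2 h (subst2 p \<phi>) u v = ev2 h p (ev2 h (fst \<phi>) u v) (ev2 h (snd \<phi>) u v)"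
  unfolding subst2_ev2
  by (subst ev2_hom[OF _ comm_ring_hom_ev2[OF assms]]) (simp_all add: assms)

section \<open>Composition and the automorphism groups\<close>

definition comp2 :: "'k::field plane_map \<Rightarrow> 'k plane_map \<Rightarrow> 'k plane_map" where
  "comp2 \<phi> \<psi> = (subst2 (fst \<phi>) \<psi>, subst2 (snd \<phi>) \<psi>)"

lemma comp2_sel [simp]: "fst (comp2 \<phi> \<psi>) = subst2 (fst \<phi>) \<psi>" "snd (comp2 \<phi> \<psi>) = subst2 (snd \<phi>) \<psi>"
  by (simp_all add: comp2_def)

lemma subst2_comp2: "subst2 p (comp2 \<phi> \<psi>) = subst2 (subst2 p \<phi>) \<psi>"
  by (simp add: subst2_ev2[of _ \<psi>] ev2_subst2) (simp add: comp2_def subst2_ev2)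

lemma comp2_assoc: "comp2 (comp2 \<phi> \<psi>) \<chi> = comp2 \<phi> (comp2 \<psi> \<chi>)"
  by (rule prod_eqI) (simp_all add: subst2_comp2)

lemma comp2_id [simp]: "comp2 (varX, varY) \<phi> = \<phi>" "comp2 \<phi> (varX, varY) = \<phi>"
  by (simp_all add: comp2_def subst2_ev2 ev2_self)

lemma End_plane_simps [simp]:
  "carrier End_plane = UNIV" "mult End_plane = comp2" "one End_plane = (varX, varY)"
  by (auto simp: End_plane_def comp2_def fun_eq_iff)

lemma monoid_End_plane: "Group.monoid End_plane"
  by unfold_locales (simp_all add: comp2_assoc)

lemma Aut_plane_simps [simp]:
  "mult Aut_plane = comp2" "one Aut_plane = (varX, varY)"
  "mult Aut0_plane = comp2" "one Aut0_plane = (varX, varY)"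
  "mult SAut0_plane = comp2" "mult (Aut_plane_with S) = comp2"
  by (simp_all add: Aut_plane_def units_of_def Aut0_plane_def SAut0_plane_def Aut_plane_with_def)

lemma carrier_Aut_plane:
  "\<phi> \<in> carrier Aut_plane \<longleftrightarrow> (\<exists>\<psi>. comp2 \<psi> \<phi> = (varX, varY) \<and> comp2 \<phi> \<psi> = (varX, varY))"
  by (auto simp: Aut_plane_def units_of_def Units_def)

lemma eval2_0: "eval2 p 0 0 = cf p 0 0"
  by (simp add: eval2_def poly_0_coeff_0)

lemma carrier_Aut0_plane:
  "\<phi> \<in> carrier Aut0_plane \<longleftrightarrow> \<phi> \<in> carrier Aut_plane \<and> cf (fst \<phi>) 0 0 = 0 \<and> cf (snd \<phi>) 0 0 = 0"
  by (auto simp: Aut0_plane_def eval2_0)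

lemma comp2_in_Aut_plane:
  assumes "\<phi> \<in> carrier Aut_plane" "\<psi> \<in> carrier Aut_plane"
  shows "comp2 \<phi> \<psi> \<in> carrier Aut_plane"
  using assms Group.monoid.Units_m_closed[OF monoid_End_plane, of \<phi> \<psi>]
  by (simp add: Aut_plane_def units_of_def)

lemma cf_0_ev2: "cf p 0 0 = ev2 (\<lambda>c. c) p 0 0"
  by (simp add: ev2_def poly_0_coeff_0 coeff_map_poly)

lemma comm_ring_hom_id: "comm_ring_hom (\<lambda>c. c)" by (rule comm_ring_homI) auto

lemma comp2_in_Aut0_plane:
  assumes "\<phi> \<in> carrier Aut0_plane" "\<psi> \<in> carrier Aut0_plane"
  shows "comp2 \<phi> \<psi> \<in> carrier Aut0_plane"
  using assms comp2_in_Aut_plane[of \<phi> \<psi>]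
  by (simp add: carrier_Aut0_plane comp2_def cf_0_ev2 ev2_subst2[OF comm_ring_hom_id])

subsection \<open>The chain rule\<close>

abbreviation dX :: "'k::field poly poly \<Rightarrow> 'k poly poly" where "dX \<equiv> map_poly pderiv"
abbreviation dY :: "'k::field poly poly \<Rightarrow> 'k poly poly" where "dY \<equiv> pderiv"

lemma poly_map_derivation:
  assumes "comm_ring_hom h"
    and D: "\<And>a b. D (a + b) = D a + D b" "\<And>a b. D (a * b) = D a * b + a * D b" "\<And>c. D (h c) = 0"
  shows "D (poly (map_poly h q) u) = poly (map_poly h (pderiv q)) u * D u"
proof -
  interpret comm_ring_hom h by fact
  interpret m: map_poly_comm_ring_hom h ..
  have D0: "D 0 = 0" using D(1)[of 0 0] by simp
  show ?thesis
    by (induction q) (simp_all add: D D0 map_poly_pCons_hom pderiv_pCons m.hom_add algebra_simps)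
qed

text \<open>For an arbitrary derivation that kills the coefficients, so that both partial
  derivatives of a composition are instances.\<close>

lemma ev2_derivation:
  assumes h: "comm_ring_hom h"
    and D: "\<And>a b. D (a + b) = D a + D b" "\<And>a b. D (a * b) = D a * b + a * D b" "\<And>c. D (h c) = 0"
  shows "D (ev2 h p u v) = ev2 h (dX p) u v * D u + ev2 h (dY p) u v * D v"
proof -
  interpret e: comm_ring_hom "\<lambda>p. ev2 h p u v" by (rule comm_ring_hom_ev2[OF h])
  have D0: "D 0 = 0" using D(1)[of 0 0] by simp
  show ?thesis
  proof (induction p)
    case 0
    then show ?case by (simp add: D0)
  next
    case (pCons a p)
    have "dX (pCons a p) = pCons (pderiv a) (dX p)" by (simp add: map_poly_pCons_0)
    then show ?case
      by (simp add: ev2_pCons[OF h] D poly_map_derivation[OF h D] pCons pderiv_pCons e.hom_add algebra_simps)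
  qed
qed

lemma map_poly_derivation:
  fixes D :: "'a::comm_ring_1 \<Rightarrow> 'a"
  assumes D: "\<And>a b. D (a + b) = D a + D b" "\<And>a b. D (a * b) = D a * b + a * D b"
  shows "map_poly D (p + q) = map_poly D p + map_poly D q"
    and "map_poly D (p * q) = map_poly D p * q + p * map_poly D q"
proof -
  have D0: "D 0 = 0" using D(1)[of 0 0] by simp
  show add: "map_poly D (p + q) = map_poly D p + map_poly D q" for p q
    by (rule map_poly_add) (simp_all add: D D0)
  have sm: "map_poly D (Polynomial.smult c b) = Polynomial.smult (D c) b + Polynomial.smult c (map_poly D b)" for c b
    by (intro poly_eqI) (simp add: coeff_map_poly D D0)
  show "map_poly D (p * q) = map_poly D p * q + p * map_poly D q"
    by (induction p) (simp_all add: add sm map_poly_pCons_0 D0 algebra_simps)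
qed

lemma dX_derivation: "dX (a + b) = dX a + dX b" "dX (a * b) = dX a * b + a * dX b" "dX (const2 c) = 0"
  by (rule map_poly_derivation; simp add: pderiv_add pderiv_mult algebra_simps)+
     (simp add: map_poly_pCons_0 pderiv_pCons)

lemma dY_derivation: "dY (a + b) = dY a + dY b" "dY (a * b) = dY a * b + a * dY b" "dY (const2 c) = 0"
  by (simp_all add: pderiv_add pderiv_mult pderiv_pCons algebra_simps)

lemma dX_subst2: "dX (subst2 p \<phi>) = subst2 (dX p) \<phi> * dX (fst \<phi>) + subst2 (dY p) \<phi> * dX (snd \<phi>)"
  unfolding subst2_ev2 by (rule ev2_derivation) (simp_all add: dX_derivation)

lemma dY_subst2: "dY (subst2 p \<phi>) = subst2 (dX p) \<phi> * dY (fst \<phi>) + subst2 (dY p) \<phi> * dY (snd \<phi>)"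
  unfolding subst2_ev2 by (rule ev2_derivation) (simp_all add: dY_derivation)

lemma jacobian_mat_entries [simp]:
  "jacobian_mat \<phi> \<in> carrier_mat 2 2"
  "jacobian_mat \<phi> $$ (0, 0) = dX (fst \<phi>)" "jacobian_mat \<phi> $$ (0, Suc 0) = dY (fst \<phi>)"
  "jacobian_mat \<phi> $$ (Suc 0, 0) = dX (snd \<phi>)" "jacobian_mat \<phi> $$ (Suc 0, Suc 0) = dY (snd \<phi>)"
  by (auto simp: jacobian_mat_def mat_of_rows_list_def)

lemma det_2x2:
  fixes A :: "'r::comm_ring_1 mat"
  assumes "A \<in> carrier_mat 2 2"
  shows "det A = A $$ (0, 0) * A $$ (Suc 0, Suc 0) - A $$ (0, Suc 0) * A $$ (Suc 0, 0)"
proof -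
  have "det A = (\<Sum>j<2. A $$ (0, j) * cofactor A 0 j)"
    by (rule laplace_expansion_row[OF assms]) simp
  moreover have "mat_delete A 0 0 = mat 1 1 (\<lambda>_. A $$ (1, 1))" "mat_delete A 0 1 = mat 1 1 (\<lambda>_. A $$ (1, 0))"
    using assms by (auto simp: mat_delete_def)
  moreover have "det (mat 1 1 (\<lambda>_. x)) = x" for x :: 'r
    by (subst det_single) auto
  ultimately show ?thesis by (simp add: cofactor_def numeral_2_eq_2)
qed

lemma Jac_eq: "Jac \<phi> = dX (fst \<phi>) * dY (snd \<phi>) - dY (fst \<phi>) * dX (snd \<phi>)"
  unfolding Jac_def by (simp add: det_2x2)

section \<open>Binary forms\<close>

lemma ex_maximal_value:
  fixes f :: "'a \<Rightarrow> nat"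
  assumes "finite S" "S \<noteq> {}"
  obtains s where "s \<in> S" "\<And>t. t \<in> S \<Longrightarrow> f t \<le> f s"
proof -
  have "Max (f ` S) \<in> f ` S" using assms by (intro Max_in) auto
  then obtain s where "s \<in> S" "f s = Max (f ` S)" by auto
  then show thesis using that[of s] assms by simp
qed

text \<open>The form v^n g(u / v) written without division; n may exceed the degree of g.\<close>

definition hform :: "('k::field \<Rightarrow> 'b::comm_ring_1) \<Rightarrow> 'k poly \<Rightarrow> nat \<Rightarrow> 'b \<Rightarrow> 'b \<Rightarrow> 'b" where
  "hform h g n u v = (\<Sum>k\<le>n. h (coeff g k) * u ^ k * v ^ (n - k))"

lemma hform_add: "comm_ring_hom h \<Longrightarrow> hform h (f + g) n u v = hform h f n u v + hform h g n u v"
proof -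
  assume "comm_ring_hom h"
  then interpret comm_ring_hom h .
  show ?thesis by (simp add: hform_def hom_add distrib_right sum.distrib)
qed

lemma hform_const: "comm_ring_hom h \<Longrightarrow> hform h [:a:] n u v = h a * v ^ n"
proof -
  assume "comm_ring_hom h"
  then interpret comm_ring_hom h .
  have "hform h [:a:] n u v = (\<Sum>k\<in>{0}. h (coeff [:a:] k) * u ^ k * v ^ (n - k))"
    unfolding hform_def by (rule sum.mono_neutral_right) (auto simp: coeff_pCons split: nat.splits)
  then show ?thesis by simp
qed

lemma hform_pCons:
  "comm_ring_hom h \<Longrightarrow> hform h (pCons a g) (Suc n) u v = h a * v ^ Suc n + u * hform h g n u v"
  by (simp add: hform_def sum.atMost_Suc_shift sum_distrib_left algebra_simps del: sum.atMost_Suc)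

lemma hform_smult: "comm_ring_hom h \<Longrightarrow> hform h (Polynomial.smult a g) n u v = h a * hform h g n u v"
proof -
  assume "comm_ring_hom h"
  then interpret comm_ring_hom h .
  show ?thesis by (simp add: hform_def hom_mult sum_distrib_left mult.assoc)
qed

lemma hform_Suc:
  assumes h: "comm_ring_hom h" and "degree g \<le> n"
  shows "hform h g (Suc n) u v = v * hform h g n u v"
proof -
  interpret comm_ring_hom h by fact
  have "hform h g (Suc n) u v = (\<Sum>k\<le>n. h (coeff g k) * u ^ k * v ^ (Suc n - k))"
    using assms(2) by (simp add: hform_def coeff_eq_0)
  then show ?thesis by (simp add: hform_def sum_distrib_left Suc_diff_le algebra_simps)
qed

lemma hform_linear_mult:
  assumes h: "comm_ring_hom h" and "degree g \<le> n"
  shows "hform h ([:c, 1:] * g) (Suc n) u v = (u + h c * v) * hform h g n u v"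
proof -
  interpret comm_ring_hom h by fact
  show ?thesis
    by (simp add: hform_add[OF h] hform_smult[OF h] hform_Suc[OF assms] hform_pCons[OF h] algebra_simps)
qed

lemma hform_shift:
  assumes h: "comm_ring_hom h" and "degree g \<le> n"
  shows "hform h g n (u + h c * v) v = hform h (g \<circ>\<^sub>p [:c, 1:]) n u v"
  using assms(2)
proof (induction n arbitrary: g)
  case 0
  then obtain a where "g = [:a:]" by (metis degree_eq_zeroE le_zero_eq)
  then show ?case by (simp add: hform_const[OF h])
next
  case (Suc n)
  obtain a g' where g: "g = pCons a g'" by (cases g)
  then have deg: "degree g' \<le> n" using Suc.prems by (cases "g' = 0") auto
  have "degree (g' \<circ>\<^sub>p [:c, 1:]) \<le> n" using deg degree_pcompose_le[of g' "[:c, 1:]"] by simp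
  then show ?case
    unfolding g pcompose_pCons hform_pCons[OF h] Suc.IH[OF deg]
    by (simp only: hform_add[OF h] hform_const[OF h] hform_linear_mult[OF h])
qed

lemma hform_collinear:
  assumes h: "comm_ring_hom h" and deg: "degree g \<le> n"
  shows "hform h g n (h c * v) v = h (poly g c) * v ^ n"
proof -
  interpret comm_ring_hom h by fact
  have "poly g c = (\<Sum>k\<le>n. coeff g k * c ^ k)"
    unfolding poly_altdef by (rule sum.mono_neutral_left) (use deg in \<open>auto intro: coeff_eq_0\<close>)
  then show ?thesis
    by (simp add: hform_def hom_sum hom_mult hom_power sum_distrib_right power_mult_distrib mult.assoc
        flip: power_add)
qed

lemma coeff_power_mult_degree:
  fixes u v :: "'a::idom poly"
  assumes "u \<noteq> 0" "v \<noteq> 0"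
  shows "coeff (u ^ k * v ^ l) (k * degree u + l * degree v) = lead_coeff u ^ k * lead_coeff v ^ l"
proof -
  have "degree (u ^ k * v ^ l) = k * degree u + l * degree v"
    using assms by (simp add: degree_mult_eq degree_power_eq)
  moreover have "lead_coeff (u ^ k * v ^ l) = lead_coeff u ^ k * lead_coeff v ^ l"
    by (simp add: lead_coeff_mult lead_coeff_power)
  ultimately show ?thesis by simp
qed

text \<open>If \<open>u\<close> and \<open>v\<close> have different degrees, then no two terms of the form have the same degree.\<close>

lemma hform_degree:
  fixes u v :: "'a::idom poly"
  assumes h: "comm_ring_hom h" "\<And>c. h c = 0 \<Longrightarrow> c = 0"
    and uv: "u \<noteq> 0" "v \<noteq> 0" "degree u \<noteq> degree v" and k: "coeff g k \<noteq> 0" "k \<le> n"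
  shows "\<exists>m \<ge> k * degree u + (n - k) * degree v. coeff (hform (\<lambda>c. [:h c:]) g n u v) m \<noteq> 0"
proof -
  interpret comm_ring_hom h by fact
  define w where "w = (\<lambda>k. k * degree u + (n - k) * degree v)"
  have w_inj: "k = l" if "w k = w l" "k \<le> n" "l \<le> n" for k l
  proof -
    have w_int: "int (w k) = int k * int (degree u) + (int n - int k) * int (degree v)" if "k \<le> n" for k
      using that by (simp add: w_def of_nat_diff)
    have "(int k - int l) * (int (degree u) - int (degree v)) = 0"
      using arg_cong[OF that(1), of int] unfolding w_int[OF that(2)] w_int[OF that(3)] by (simp add: algebra_simps)
    then show ?thesis using uv by simp
  qed
  let ?K = "{k. k \<le> n \<and> coeff g k \<noteq> 0}"
  have fin: "finite ?K" by simp
  obtain l where l: "l \<in> ?K" "\<And>k. k \<in> ?K \<Longrightarrow> w k \<le> w l"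
    using ex_maximal_value[OF fin, of w] k by blast
  have summand: "coeff ([:h (coeff g k):] * u ^ k * v ^ (n - k)) (w l) = (if k = l then h (coeff g l) * lead_coeff u ^ l * lead_coeff v ^ (n - l) else 0)"
    if "k \<le> n" for k
  proof (cases "k = l")
    case True
    have "coeff (u ^ l * v ^ (n - l)) (w l) = lead_coeff u ^ l * lead_coeff v ^ (n - l)"
      unfolding w_def by (rule coeff_power_mult_degree[OF uv(1,2)])
    then show ?thesis using True by (simp add: mult.assoc)
  next
    case False
    have "degree (u ^ k * v ^ (n - k)) = w k" using uv by (simp add: w_def degree_mult_eq degree_power_eq)
    moreover have "w k < w l" if "coeff g k \<noteq> 0"
      using l(2)[of k] w_inj[of k l] that \<open>k \<le> n\<close> False l(1) by fastforce
    ultimately show ?thesis using False by (cases "coeff g k = 0") (auto simp: mult.assoc coeff_eq_0)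
  qed
  have "coeff (hform (\<lambda>c. [:h c:]) g n u v) (w l) = h (coeff g l) * lead_coeff u ^ l * lead_coeff v ^ (n - l)"
  proof -
    have "coeff (hform (\<lambda>c. [:h c:]) g n u v) (w l) =
        (\<Sum>k\<le>n. if k = l then h (coeff g l) * lead_coeff u ^ l * lead_coeff v ^ (n - l) else 0)"
      unfolding hform_def coeff_sum by (intro sum.cong refl summand) simp
    then show ?thesis using l(1) by simp
  qed
  then have "coeff (hform (\<lambda>c. [:h c:]) g n u v) (w l) \<noteq> 0" using l(1) h uv by auto
  then show ?thesis using l(2)[of k] k by (auto simp: w_def)
qed

lemma hform_lead_coeff:
  fixes u v :: "'a::idom poly"
  assumes "u \<noteq> 0" "v \<noteq> 0" "degree u = degree v"
  shows "coeff (hform (\<lambda>c. [:h c:]) g n u v) (n * degree v) = hform h g n (lead_coeff u) (lead_coeff v)"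
proof -
  have "coeff ([:h (coeff g k):] * u ^ k * v ^ (n - k)) (n * degree v) =
      h (coeff g k) * lead_coeff u ^ k * lead_coeff v ^ (n - k)" if "k \<le> n" for k
  proof -
    have "k * degree u + (n - k) * degree v = n * degree v"
      using assms(3) that by (simp flip: add_mult_distrib)
    then show ?thesis using coeff_power_mult_degree[OF assms(1,2), of k "n - k"] by (simp add: mult.assoc)
  qed
  then show ?thesis unfolding hform_def coeff_sum by (intro sum.cong) auto
qed

text \<open>\<open>K\<close> is algebraically closed in the fraction field of the domain.\<close>

definition relatively_closed :: "('k::field \<Rightarrow> 'b::idom) \<Rightarrow> bool" where
  "relatively_closed h \<longleftrightarrow> comm_ring_hom h \<and> (\<forall>c. h c = 0 \<longrightarrow> c = 0) \<and>
    (\<forall>g n p q. q \<noteq> 0 \<longrightarrow> g \<noteq> 0 \<longrightarrow> degree g \<le> n \<longrightarrow> hform h g n p q = 0 \<longrightarrow>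
      (\<exists>c. p = h c * q \<and> poly g c = 0))"

lemma relatively_closed_id: "relatively_closed (\<lambda>c. c :: 'k::field)"
  unfolding relatively_closed_def
proof (intro conjI allI impI)
  fix g :: "'k poly" and n p q
  assume "q \<noteq> 0" "degree g \<le> n" "hform (\<lambda>c. c) g n p q = 0"
  then have "poly g (p / q) * q ^ n = 0"
    using hform_collinear[OF comm_ring_hom_id, of g n "p / q" q] by simp
  then show "\<exists>c. p = c * q \<and> poly g c = 0" using \<open>q \<noteq> 0\<close> by (intro exI[of _ "p / q"]) auto
qed (auto simp: comm_ring_hom_id)

text \<open>If g(p / q) = 0 with p nonzero, then p and q have equal degrees, and their leading
  coefficients provide c. Were r = p - c q nonzero, its degree would differ from that of q, while a
  shift of the form still vanishes at (r, q); \<open>hform_degree\<close> excludes this.\<close>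

lemma relatively_closed_poly:
  fixes h :: "'k::field \<Rightarrow> 'b::idom"
  assumes "relatively_closed h"
  shows "relatively_closed (\<lambda>c. [:h c:])"
proof -
  have h: "comm_ring_hom h" "\<And>c. h c = 0 \<Longrightarrow> c = 0"
    and alg: "\<And>g n p q. q \<noteq> 0 \<Longrightarrow> g \<noteq> 0 \<Longrightarrow> degree g \<le> n \<Longrightarrow> hform h g n p q = 0 \<Longrightarrow> \<exists>c. p = h c * q \<and> poly g c = 0"
    using assms unfolding relatively_closed_def by blast+
  interpret comm_ring_hom h by fact
  let ?h = "\<lambda>c. [:h c:]"
  have h': "comm_ring_hom ?h" by (rule comm_ring_homI) (auto simp: hom_add hom_mult one_pCons)
  have "\<exists>c. p = [:h c:] * q \<and> poly g c = 0"
    if q: "q \<noteq> 0" and g: "g \<noteq> 0" and deg: "degree g \<le> n" and z: "hform ?h g n p q = 0" for g n p q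
  proof -
    have ex: "\<exists>c. p = [:h c:] * q"
    proof (cases "p = 0")
      case True
      then show ?thesis by (intro exI[of _ 0]) simp
    next
      case p: False
      have k: "coeff g (degree g) \<noteq> 0" using g by simp
      have dd: "degree p = degree q"
        using hform_degree[OF h p q _ k deg] z by force
      have "hform h g n (lead_coeff p) (lead_coeff q) = 0"
        using hform_lead_coeff[OF p q dd, of h g n] z by simp
      then obtain c where c: "lead_coeff p = h c * lead_coeff q"
        using alg[of "lead_coeff q" g n "lead_coeff p"] q g deg by auto
      define r where "r = p - [:h c:] * q"
      define g' where "g' = g \<circ>\<^sub>p [:c, 1:]"
      have "r = 0"
      proof (rule ccontr)
        assume r: "r \<noteq> 0"
        have "coeff r (degree q) = 0" using c dd by (simp add: r_def)
        moreover have "degree r \<le> degree q" unfolding r_def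
          by (rule degree_diff_le) (use dd in \<open>auto intro: order_trans[OF degree_smult_le]\<close>)
        ultimately have rd: "degree r \<noteq> degree q" using r by (metis leading_coeff_0_iff)
        have g': "g' \<noteq> 0" "degree g' \<le> n"
          using g deg pcompose_eq_0[of g "[:c, 1:]"] degree_pcompose_le[of g "[:c, 1:]"] by (auto simp: g'_def)
        have "hform ?h g n (r + [:h c:] * q) q = hform ?h g' n r q"
          unfolding g'_def by (rule hform_shift[OF h' deg])
        then have "hform ?h g' n r q = 0" using z by (simp add: r_def)
        then show False using hform_degree[OF h r q rd, of g' "degree g'" n] g' by auto
      qed
      then show ?thesis by (auto simp: r_def)
    qed
    then obtain c where c: "p = [:h c:] * q" by blast
    have "[:h (poly g c):] * q ^ n = 0" using z hform_collinear[OF h' deg, of c q] c by simp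
    then have "poly g c = 0" using q h(2) by auto
    then show ?thesis using c by blast
  qed
  then show ?thesis unfolding relatively_closed_def using h' h by auto
qed

section \<open>Quasihomogeneous invariants of additive group actions\<close>

text \<open>\<open>P\<close> and \<open>Q\<close> are the images of \<open>x\<close> and \<open>y\<close> under the action, a polynomial in the time \<open>T\<close>, and
  \<open>f\<close> is invariant.\<close>

abbreviation const3 :: "'k::field \<Rightarrow> 'k poly poly poly" where
  "const3 c \<equiv> [:const2 c:]"

definition invariant_flow :: "'k::field poly poly \<Rightarrow> 'k poly poly poly \<Rightarrow> 'k poly poly poly \<Rightarrow> bool" where
  "invariant_flow f P Q \<longleftrightarrow> poly P 0 = varX \<and> poly Q 0 = varY \<and> (0 < degree P \<or> 0 < degree Q) \<and>
     ev2 const3 f P Q = [:f:]"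

lemma varXY_nz [simp]: "varX \<noteq> 0" "varY \<noteq> 0" by (auto simp: varX_def varY_def)

lemma invariant_flow_nz: "invariant_flow f P Q \<Longrightarrow> P \<noteq> 0 \<and> Q \<noteq> 0"
  by (auto simp: invariant_flow_def)

lemma degree_0_const: "degree p = 0 \<Longrightarrow> p = [:poly p 0:]"
  by (metis degree_eq_zeroE mult_zero_left poly_0 poly_pCons add.right_neutral)

text \<open>If no term is free of \<open>P\<close>, then \<open>P\<close> divides a nonzero
  polynomial constant in T and is itself constant in T. Then \<open>Q\<close> is not, and the term
  with the largest l, unique because l determines k, dominates in T unless l = 0.\<close>

lemma line_divisible_or_pure:
  fixes P Q :: "'a::idom poly"
  assumes S: "finite S" "\<And>k l k' l'. (k, l) \<in> S \<Longrightarrow> (k', l') \<in> S \<Longrightarrow> l = l' \<Longrightarrow> k = k'"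
    and a: "\<And>k l. (k, l) \<in> S \<Longrightarrow> a k l \<noteq> 0"
    and PQ: "P \<noteq> 0" "Q \<noteq> 0" "0 < degree P \<or> 0 < degree Q"
    and deg: "degree (\<Sum>(k, l)\<in>S. [:a k l:] * P ^ k * Q ^ l) = 0" "(\<Sum>(k, l)\<in>S. [:a k l:] * P ^ k * Q ^ l) \<noteq> 0"
  shows "(\<exists>l. (0, l) \<in> S) \<or> (\<forall>(k, l)\<in>S. l = 0)"
proof (rule disjCI)
  assume pure: "\<not> (\<forall>(k, l)\<in>S. l = 0)"
  show "\<exists>l. (0, l) \<in> S"
  proof (rule ccontr)
    assume no: "\<nexists>l. (0, l) \<in> S"
    have "(\<Sum>(k, l)\<in>S. [:a k l:] * P ^ k * Q ^ l) = P * (\<Sum>(k, l)\<in>S. [:a k l:] * P ^ (k - 1) * Q ^ l)"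
      unfolding sum_distrib_left
    proof (intro sum.cong refl)
      fix s assume "s \<in> S"
      moreover obtain k l where s: "s = (k, l)" by (cases s)
      ultimately have "k > 0" using no by (cases k) auto
      then have "P ^ k = P * P ^ (k - 1)" by (cases k) simp_all
      then show "(case s of (k, l) \<Rightarrow> [:a k l:] * P ^ k * Q ^ l) = P * (case s of (k, l) \<Rightarrow> [:a k l:] * P ^ (k - 1) * Q ^ l)"
        by (simp only: s prod.case) (simp only: mult_ac)
    qed
    then obtain R where R: "(\<Sum>(k, l)\<in>S. [:a k l:] * P ^ k * Q ^ l) = P * R" by blast
    then have "R \<noteq> 0" using deg(2) by auto
    then have P: "degree P = 0" using deg(1) PQ(1) unfolding R by (simp add: degree_mult_eq)
    then have Q: "0 < degree Q" using PQ by simp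
    obtain s where s: "s \<in> S" "\<And>t. t \<in> S \<Longrightarrow> snd t \<le> snd s"
      by (rule ex_maximal_value[OF S(1), of snd]) (use pure in auto)
    obtain k l where kl: "s = (k, l)" by (cases s)
    have l: "l > 0"
    proof (rule ccontr)
      assume "\<not> l > 0"
      then have "\<forall>(k, l)\<in>S. l = 0" using s(2) kl by auto
      then show False using pure by blast
    qed
    have co: "coeff (case t of (k, l) \<Rightarrow> [:a k l:] * P ^ k * Q ^ l) (l * degree Q) =
        (if t = s then a k l * lead_coeff P ^ k * lead_coeff Q ^ l else 0)" if t: "t \<in> S" for t
    proof -
      obtain k' l' where t': "t = (k', l')" by (cases t)
      show ?thesis
      proof (cases "t = s")
        case True
        then show ?thesis using coeff_power_mult_degree[OF PQ(1,2), of k l] P by (simp add: t' kl mult.assoc)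
      next
        case False
        then have "l' \<noteq> l" using S(2)[of k' l' k l] t s(1) unfolding t' kl by auto
        then have "l' < l" using s(2)[OF t] t' kl by simp
        then have "degree (P ^ k' * Q ^ l') < l * degree Q"
          using PQ(1,2) P Q by (simp add: degree_mult_eq degree_power_eq)
        then show ?thesis using False t' by (simp add: mult.assoc coeff_eq_0)
      qed
    qed
    have e1: "coeff (\<Sum>(k, l)\<in>S. [:a k l:] * P ^ k * Q ^ l) (l * degree Q) = a k l * lead_coeff P ^ k * lead_coeff Q ^ l"
    proof -
      have "coeff (\<Sum>(k, l)\<in>S. [:a k l:] * P ^ k * Q ^ l) (l * degree Q) =
          (\<Sum>t\<in>S. if t = s then a k l * lead_coeff P ^ k * lead_coeff Q ^ l else 0)"
        unfolding coeff_sum by (intro sum.cong refl co)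
      then show ?thesis using s(1) S(1) by (simp only: sum.delta if_True)
    qed
    have e2: "a k l * lead_coeff P ^ k * lead_coeff Q ^ l \<noteq> 0" using a[of k l] s(1) kl PQ(1,2) by simp
    have e3: "coeff (\<Sum>(k, l)\<in>S. [:a k l:] * P ^ k * Q ^ l) (l * degree Q) = 0"
      by (rule coeff_eq_0) (use l Q deg(1) in simp)
    show False using e2 unfolding e1[symmetric] by (rule notE) (rule e3)
  qed
qed

section \<open>Derivations and flows along cusps\<close>

lemma derivation_power:
  fixes D :: "'b::comm_ring_1 \<Rightarrow> 'b"
  assumes "\<And>a b. D (a * b) = D a * b + a * D b"
  shows "D (p ^ n) = of_nat n * p ^ (n - 1) * D p"
proof -
  have D1: "D 1 = 0" using assms[of 1 1] by simp
  show ?thesis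
  proof (induction n)
    case (Suc n)
    then show ?case by (cases n) (simp_all add: assms algebra_simps)
  qed (simp add: D1)
qed

lemma pderiv_eq_0_imp_coeff:
  fixes p :: "'a::idom poly"
  assumes "pderiv p = 0" and m: "\<not> CHAR('a) dvd m"
  shows "coeff p m = 0"
proof -
  obtain m' where m': "m = Suc m'" using m by (cases m) auto
  have "of_nat (Suc m') * coeff p (Suc m') = coeff (pderiv p) m'" by (simp add: coeff_pderiv)
  then have "of_nat m * coeff p m = 0" using assms(1) by (simp add: m')
  moreover have "of_nat m \<noteq> (0 :: 'a)" using m by (simp add: of_nat_eq_0_iff_char_dvd)
  ultimately show ?thesis by simp
qed

text \<open>Only exponents divisible by the characteristic can occur. The coefficients need not be
  c-th powers, so the result is a polynomial in the c-th power of the variable rather than a c-th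
  power.\<close>

lemma pderiv_eq_0_imp_pcompose:
  fixes p :: "'a::idom poly"
  assumes "pderiv p = 0" "CHAR('a) = c" "0 < c"
  shows "\<exists>r. p = r \<circ>\<^sub>p monom 1 c"
proof -
  have z: "coeff p m = 0" if "\<not> c dvd m" for m
    using pderiv_eq_0_imp_coeff[OF assms(1)] that assms(2) by blast
  have mon: "monom a k \<circ>\<^sub>p monom 1 c = monom a (c * k)" for a :: 'a and k
  proof -
    have "monom a k = Polynomial.smult a ([:0, 1:] ^ k)" by (simp add: monom_altdef)
    then show ?thesis by (simp add: pcompose_smult pcompose_hom.hom_power pcompose_pCons monom_power smult_monom)
  qed
  define r where "r = (\<Sum>k\<le>degree p. monom (coeff p (c * k)) k)"
  have "r \<circ>\<^sub>p monom 1 c = (\<Sum>k\<le>degree p. monom (coeff p (c * k)) (c * k))"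
    by (simp add: r_def pcompose_sum mon)
  also have "\<dots> = (\<Sum>m\<in>(\<lambda>k. c * k) ` {..degree p}. monom (coeff p m) m)"
    by (subst sum.reindex) (use assms(3) in \<open>auto simp: inj_on_def\<close>)
  also have "\<dots> = (\<Sum>m\<in>(\<lambda>k. c * k) ` {..degree p} \<union> {..degree p}. monom (coeff p m) m)"
  proof (rule sum.mono_neutral_left)
    show "\<forall>i\<in>(*) c ` {..degree p} \<union> {..degree p} - (*) c ` {..degree p}. monom (coeff p i) i = 0"
    proof
      fix i assume i: "i \<in> (*) c ` {..degree p} \<union> {..degree p} - (*) c ` {..degree p}"
      have "\<not> c dvd i"
      proof
        assume "c dvd i"
        then obtain k where k: "i = c * k" by blast
        then have "k \<le> i" using assms(3) by simp
        moreover have "i \<le> degree p" "i \<notin> (*) c ` {..degree p}" using i by auto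
        ultimately have "k \<in> {..degree p}" by simp
        then show False using k \<open>i \<notin> (*) c ` {..degree p}\<close> by blast
      qed
      then show "monom (coeff p i) i = 0" by (simp add: z)
    qed
  qed auto
  also have "\<dots> = (\<Sum>m\<le>degree p. monom (coeff p m) m)"
    by (rule sum.mono_neutral_right) (auto simp: coeff_eq_0)
  also have "\<dots> = p" by (rule poly_as_sum_of_monoms)
  finally show ?thesis by metis
qed

lemma dX_var: "dX varX = 1" "dX varY = 0" "dY varX = 0" "dY varY = 1"
  by (simp_all add: varX_def varY_def map_poly_pCons_0 pderiv_pCons one_pCons)

lemma derivation_cusp:
  fixes D :: "'b::comm_ring_1 \<Rightarrow> 'b"
  assumes D: "\<And>a b. D (a + b) = D a + D b" "\<And>a b. D (a * b) = D a * b + a * D b" "D c = 0"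
  shows "D (p ^ b - c * q ^ a) = of_nat b * p ^ (b - 1) * D p - c * of_nat a * q ^ (a - 1) * D q"
proof -
  have diff: "D (x - y) = D x - D y" for x y using D(1)[of "x - y" y] by (simp add: algebra_simps)
  show ?thesis
    by (simp only: diff D(2,3) derivation_power[OF D(2)]) (simp add: algebra_simps)
qed

lemma degree_power_mult_eq:
  fixes P :: "'a::idom poly"
  assumes "P ^ n * M = [:x:] * R" "[:x:] * R \<noteq> 0"
  shows "n * degree P \<le> degree R"
proof -
  have "P ^ n * M \<noteq> 0" unfolding assms(1) by (rule assms(2))
  then have "M \<noteq> 0" "P = 0 \<longrightarrow> n = 0" by (auto simp: power_0_left)
  moreover have "x \<noteq> 0" "R \<noteq> 0" using assms(2) by auto
  ultimately have "P \<noteq> 0 \<Longrightarrow> n * degree P + degree M = degree R"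
    using arg_cong[OF assms(1), of degree] by (simp add: degree_mult_eq degree_power_eq mult.commute)
  then show ?thesis using \<open>P = 0 \<longrightarrow> n = 0\<close> by (cases "P = 0") auto
qed

text \<open>The fibres of \<open>x\<^sup>b - c y\<^sup>a\<close> contain no polynomially parametrised curve except lines when \<open>a, b \<ge> 2\<close>.
  In positive characteristic the derivative with respect to \<open>T\<close> alone does not suffice.\<close>

lemma no_flow_on_cusp:
  fixes P Q :: "'k::field poly poly poly"
  assumes c: "c \<noteq> 0" and ab: "coprime a b" "2 \<le> a" "2 \<le> b" and deg: "0 < degree P" "0 < degree Q"
    and eq: "P ^ b - const3 c * Q ^ a = [:varX:] ^ b - const3 c * [:varY:] ^ a"
    and pd: "pderiv P \<noteq> 0 \<or> pderiv Q \<noteq> 0"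
  shows False
proof -
  define B where "B = (of_nat b :: 'k poly poly poly)"
  define C where "C = const3 c * of_nat a"
  have deriv: "B * P ^ (b - 1) * D P - C * Q ^ (a - 1) * D Q = B * [:varX:] ^ (b - 1) * D [:varX:] - C * [:varY:] ^ (a - 1) * D [:varY:]"
    if "\<And>a b. D (a + b) = D a + D b" "\<And>a b. D (a * b) = D a * b + a * D b" "D (const3 c) = 0" for D
    using arg_cong[OF eq, of D] unfolding derivation_cusp[of D, OF that] B_def C_def .
  let ?Dx = "map_poly dX" and ?Dy = "map_poly dY"
  have X: "B * P ^ (b - 1) * ?Dx P - C * Q ^ (a - 1) * ?Dx Q = B * [:varX:] ^ (b - 1)"
    by (subst deriv) (simp_all add: map_poly_derivation dX_derivation map_poly_pCons_0 dX_var)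
  have Y: "B * P ^ (b - 1) * ?Dy P - C * Q ^ (a - 1) * ?Dy Q = - C * [:varY:] ^ (a - 1)"
    by (subst deriv) (simp_all add: map_poly_derivation dY_derivation map_poly_pCons_0 dX_var)
  have T: "B * P ^ (b - 1) * pderiv P = C * Q ^ (a - 1) * pderiv Q"
    using deriv[of pderiv] by (simp add: pderiv_add pderiv_mult pderiv_pCons)
  have B0: "B = 0 \<longleftrightarrow> CHAR('k) dvd b" by (simp add: B_def of_nat_eq_0_iff_char_dvd)
  have C0: "C = 0 \<longleftrightarrow> CHAR('k) dvd a" using c by (simp add: C_def of_nat_eq_0_iff_char_dvd)
  have BC: "B \<noteq> 0 \<or> C \<noteq> 0"
  proof (rule ccontr)
    assume "\<not> (B \<noteq> 0 \<or> C \<noteq> 0)"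
    then have "CHAR('k) dvd gcd a b" unfolding B0 C0 by simp
    then have "CHAR('k) = 1" using ab(1) by simp
    then show False by simp
  qed
  have vnz: "[:varX:] ^ k \<noteq> (0 :: 'k poly poly poly)" "[:varY:] ^ k \<noteq> (0 :: 'k poly poly poly)" for k by auto
  consider "B = 0" "C \<noteq> 0" | "B \<noteq> 0" "C = 0" | "B \<noteq> 0" "C \<noteq> 0" using BC by blast
  then show False
  proof cases
    \<comment> \<open>If b vanishes in K, the y-derivative alone shows that Q^(a - 1) divides y^(a -
      1), which is constant in T.\<close>
    case 1
    have "C * (Q ^ (a - 1) * ?Dy Q) = C * [:varY:] ^ (a - 1)" using Y 1 by (simp add: mult.assoc)
    from mult_left_cancel[OF 1(2), THEN iffD1, OF this]
    have "Q ^ (a - 1) * ?Dy Q = [:varY ^ (a - 1):] * 1" unfolding poly_const_pow by simp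
    then have "(a - 1) * degree Q \<le> degree (1 :: 'k poly poly poly)" by (rule degree_power_mult_eq) simp
    then show False using ab deg by simp
  next
    case 2
    have "B * (P ^ (b - 1) * ?Dx P) = B * [:varX:] ^ (b - 1)" using X 2 by (simp add: mult.assoc)
    from mult_left_cancel[OF 2(1), THEN iffD1, OF this]
    have "P ^ (b - 1) * ?Dx P = [:varX ^ (b - 1):] * 1" unfolding poly_const_pow by simp
    then have "(b - 1) * degree P \<le> degree (1 :: 'k poly poly poly)" by (rule degree_power_mult_eq) simp
    then show False using ab deg by simp
  next
    case 3
    have "P \<noteq> 0" "Q \<noteq> 0" using deg by auto
    then have pq: "pderiv P \<noteq> 0" "pderiv Q \<noteq> 0" using pd T 3 by auto
    \<comment> \<open>Combining the x-derivative with the T-derivative eliminates the terms in Q^(a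
      - 1): P^(b - 1) divides x^(b - 1) times the T-derivative of Q, so deg P < deg Q. The mirror
      image below gives deg Q < deg P.\<close>
    have "B * (P ^ (b - 1) * (?Dx P * pderiv Q - ?Dx Q * pderiv P)) =
        (B * P ^ (b - 1) * ?Dx P - C * Q ^ (a - 1) * ?Dx Q) * pderiv Q
        + ?Dx Q * (C * Q ^ (a - 1) * pderiv Q - B * P ^ (b - 1) * pderiv P)"
      by (simp add: algebra_simps)
    also have "\<dots> = B * ([:varX:] ^ (b - 1) * pderiv Q)" unfolding X T by simp
    finally have "P ^ (b - 1) * (?Dx P * pderiv Q - ?Dx Q * pderiv P) = [:varX:] ^ (b - 1) * pderiv Q"
      by (rule mult_left_cancel[OF 3(1), THEN iffD1])
    then have 1: "(b - 1) * degree P \<le> degree (pderiv Q)"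
      unfolding poly_const_pow by (rule degree_power_mult_eq) (use pq in simp)
    have "C * (Q ^ (a - 1) * (?Dy Q * pderiv P - ?Dy P * pderiv Q)) =
        - ((B * P ^ (b - 1) * ?Dy P - C * Q ^ (a - 1) * ?Dy Q) * pderiv P)
        + ?Dy P * (B * P ^ (b - 1) * pderiv P - C * Q ^ (a - 1) * pderiv Q)"
      by (simp add: algebra_simps)
    also have "\<dots> = C * ([:varY:] ^ (a - 1) * pderiv P)" unfolding Y T by simp
    finally have "Q ^ (a - 1) * (?Dy Q * pderiv P - ?Dy P * pderiv Q) = [:varY:] ^ (a - 1) * pderiv P"
      by (rule mult_left_cancel[OF 3(2), THEN iffD1])
    then have 2: "(a - 1) * degree Q \<le> degree (pderiv P)"
      unfolding poly_const_pow by (rule degree_power_mult_eq) (use pq in simp)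
    have "degree P \<le> (b - 1) * degree P" "degree Q \<le> (a - 1) * degree Q" using ab by auto
    moreover have "degree (pderiv P) \<le> degree P - 1" "degree (pderiv Q) \<le> degree Q - 1"
      by (rule degree_pderiv_le)+
    ultimately show False using 1 2 deg by linarith
  qed
qed

text \<open>Such a flow depends on T only through T^c, where c is the characteristic; writing T for
  T^c divides the degrees by c. Hence a flow of least degree has a nonzero T-derivative.\<close>

lemma invariant_flow_reduce:
  fixes P Q :: "'k::field poly poly poly"
  assumes flow: "invariant_flow f P Q" and pd: "pderiv P = 0" "pderiv Q = 0"
  shows "\<exists>P' Q'. invariant_flow f P' Q' \<and> degree P' + degree Q' < degree P + degree Q"
proof -
  let ?c = "CHAR('k)"
  have c: "0 < ?c"
  proof (rule ccontr)
    assume "\<not> 0 < ?c"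
    then have "degree R = 0" if "pderiv R = 0" for R :: "'k poly poly poly"
      using pderiv_eq_0_imp_coeff[OF that, of "degree R"] leading_coeff_0_iff[of R] by (cases "degree R") auto
    then show False using pd flow by (simp add: invariant_flow_def)
  qed
  have c2: "2 \<le> ?c" using c CHAR_not_1'[where 'a = 'k] by linarith
  let ?m = "monom 1 ?c :: 'k poly poly poly"
  obtain P' Q' where PQ: "P = P' \<circ>\<^sub>p ?m" "Q = Q' \<circ>\<^sub>p ?m"
    using pderiv_eq_0_imp_pcompose[OF pd(1) _ c] pderiv_eq_0_imp_pcompose[OF pd(2) _ c] by auto
  have dm: "degree ?m = ?c" by (simp add: degree_monom_eq)
  have deg: "degree P = degree P' * ?c" "degree Q = degree Q' * ?c"
    unfolding PQ by (simp_all add: dm)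
  have m0: "poly ?m 0 = 0" using c by (simp add: poly_monom)
  have "(ev2 const3 f P' Q' - [:f:]) \<circ>\<^sub>p ?m = ev2 const3 f P Q - [:f:]"
    by (simp add: pcompose_diff PQ)
       (subst ev2_hom[of _ "\<lambda>r. r \<circ>\<^sub>p ?m"], auto intro!: comm_ring_homI simp: pcompose_add pcompose_mult)
  also have "\<dots> = 0" using flow by (simp add: invariant_flow_def)
  finally have "ev2 const3 f P' Q' - [:f:] = 0"
    using pcompose_eq_0[of "ev2 const3 f P' Q' - [:f:]" ?m] c by (simp add: dm)
  moreover have "poly P' 0 = varX" "poly Q' 0 = varY"
    using flow unfolding invariant_flow_def PQ by (simp_all add: poly_pcompose m0)
  ultimately have "invariant_flow f P' Q'"
    using flow unfolding invariant_flow_def deg by auto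
  moreover have "degree P' + degree Q' < degree P + degree Q"
  proof -
    have "degree P' + degree Q' > 0" using flow unfolding invariant_flow_def deg by auto
    moreover have "degree P + degree Q = (degree P' + degree Q') * ?c" by (simp add: deg distrib_right)
    ultimately show ?thesis using c2 by simp
  qed
  ultimately show ?thesis by blast
qed

lemma ev2_binomial_hform:
  assumes h: "comm_ring_hom h" and ab: "0 < a" "0 < b"
    and supp: "\<And>k l. (k, l) \<in> supp2 f \<Longrightarrow> \<exists>m\<le>n. k = b * m \<and> l = a * (n - m)"
  shows "ev2 h f u v = hform h (\<Sum>m\<le>n. monom (cf f (b * m) (a * (n - m))) m) n (u ^ b) (v ^ a)"
proof -
  interpret comm_ring_hom h by fact
  let ?F = "\<lambda>m. (b * m, a * (n - m))"
  have "ev2 h f u v = (\<Sum>(k, l)\<in>?F ` {..n}. h (cf f k l) * u ^ k * v ^ l)"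
    by (rule ev2_sum[OF h]) (use supp in auto)
  also have "\<dots> = (\<Sum>m\<le>n. h (cf f (b * m) (a * (n - m))) * (u ^ b) ^ m * (v ^ a) ^ (n - m))"
    by (subst sum.reindex) (use ab in \<open>auto simp: inj_on_def power_mult\<close>)
  also have "\<dots> = hform h (\<Sum>m\<le>n. monom (cf f (b * m) (a * (n - m))) m) n (u ^ b) (v ^ a)"
  proof -
    have "coeff (\<Sum>m\<le>n. monom (cf f (b * m) (a * (n - m))) m) k = cf f (b * k) (a * (n - k))" if "k \<le> n" for k
      using that by (simp add: coeff_sum if_distrib cong: if_cong)
    then show ?thesis by (simp add: hform_def)
  qed
  finally show ?thesis .
qed

text \<open>A support point that lies on a coordinate axis and inside the box bounds
  \<open>W\<close> by i j, and \<open>line_divisible_or_pure\<close> supplies one.\<close>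

lemma invariant_flow_support:
  fixes f :: "'k::field poly poly"
  assumes flow: "invariant_flow f P Q" and f: "f \<noteq> 0" and ij: "0 < i" "0 < j" and W: "i * j \<le> W"
    and line: "\<And>k l. (k, l) \<in> supp2 f \<Longrightarrow> j * k + i * l = W \<and> k \<le> i \<and> l \<le> j"
    and ends: "W = i * j \<Longrightarrow> (i, 0) \<in> supp2 f \<and> (0, j) \<in> supp2 f"
  shows "W = i * j"
proof -
  note PQ = invariant_flow_nz[OF flow]
  have degPQ: "0 < degree P \<or> 0 < degree Q" using flow by (simp add: invariant_flow_def)
  have h: "comm_ring_hom const3" by simp
  have sum: "(\<Sum>(k, l)\<in>supp2 f. const3 (cf f k l) * P ^ k * Q ^ l) = [:f:]"
    using flow ev2_sum[OF h subset_refl, of f P Q] by (simp add: invariant_flow_def)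
  have "(\<exists>l. (0, l) \<in> supp2 f) \<or> (\<forall>(k, l)\<in>supp2 f. l = 0)"
  proof (rule line_divisible_or_pure[where a = "\<lambda>k l. const2 (cf f k l)" and P = P and Q = Q])
    fix k l k' l' assume kl: "(k, l) \<in> supp2 f" "(k', l') \<in> supp2 f" "l = l'"
    then have "j * k = j * k'" using line[OF kl(1)] line[OF kl(2)] by (metis add_right_cancel)
    then show "k = k'" using ij by simp
  next
    fix k l assume "(k, l) \<in> supp2 f"
    then show "const2 (cf f k l) \<noteq> 0" by (simp add: supp2_def)
  qed (use PQ degPQ f sum in simp_all)
  then show ?thesis
  proof
    assume "\<exists>l. (0, l) \<in> supp2 f"
    then obtain l where "(0, l) \<in> supp2 f" by blast
    then have "W = i * l" "l \<le> j" using line[of 0 l] by auto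
    then show ?thesis using W ij by simp
  next
    assume pure: "\<forall>(k, l)\<in>supp2 f. l = 0"
    obtain k l where "(k, l) \<in> supp2 f" using f supp2_eq_empty_iff[of f] by fastforce
    then have "W = j * k" "k \<le> i" using line[of k l] pure by auto
    then show ?thesis using W ij by (simp add: mult.commute)
  qed
qed

text \<open>The root \<open>c\<close> of the binary form belonging to \<open>f\<close> comes from the leading coefficients in \<open>T\<close>
  of \<open>P\<^sup>b\<close> and \<open>Q\<^sup>a\<close>.\<close>

theorem invariant_quasihomogeneous:
  fixes f :: "'k::field poly poly"
  assumes flow: "\<exists>P Q. invariant_flow f P Q" and f: "f \<noteq> 0" and ij: "0 < i" "0 < j" and W: "i * j \<le> W"
    and line: "\<And>k l. (k, l) \<in> supp2 f \<Longrightarrow> j * k + i * l = W \<and> k \<le> i \<and> l \<le> j"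
    and ends: "W = i * j \<Longrightarrow> (i, 0) \<in> supp2 f \<and> (0, j) \<in> supp2 f"
  shows "\<exists>a b n c. i = b * n \<and> j = a * n \<and> (a = 1 \<or> b = 1) \<and> c \<noteq> 0 \<and> W = i * j \<and>
    (\<Sum>m\<le>n. cf f (b * m) (a * (n - m)) * c ^ m) = 0"
proof -
  \<comment> \<open>Minimality rules out \<open>invariant_flow_reduce\<close>, so one of the
    T-derivatives is nonzero, as \<open>no_flow_on_cusp\<close> requires.\<close>
  obtain P Q where flow: "invariant_flow f P Q"
    and min: "\<And>P' Q'. invariant_flow f P' Q' \<Longrightarrow> degree P + degree Q \<le> degree P' + degree Q'"
  proof -
    define m where "m = (LEAST m. \<exists>P Q. invariant_flow f P Q \<and> m = degree P + degree Q)"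
    have ex: "\<exists>P Q. invariant_flow f P Q \<and> m = degree P + degree Q"
      unfolding m_def by (rule LeastI_ex) (use flow in blast)
    have "m \<le> degree P' + degree Q'" if "invariant_flow f P' Q'" for P' Q'
      unfolding m_def by (rule Least_le) (use that in blast)
    then show thesis using ex that by blast
  qed
  have Wij: "W = i * j" by (rule invariant_flow_support[OF flow f ij W line ends])
  define n where "n = gcd i j"
  have n: "0 < n" using ij by (simp add: n_def)
  then obtain b a where "i = b * n" "j = a * n" "coprime b a"
    using gcd_coprime_exists[of i j] unfolding n_def by auto
  then have ab: "i = b * n" "j = a * n" "coprime a b" by (simp_all add: coprime_commute)
  have ab0: "0 < a" "0 < b" using ab ij by auto
  have supp: "\<exists>m\<le>n. k = b * m \<and> l = a * (n - m)" if "(k, l) \<in> supp2 f" for k l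
  proof -
    have e: "a * k + b * l = a * b * n"
    proof -
      have "n * (a * k + b * l) = n * (a * b * n)"
        using line[OF that] unfolding Wij ab(1,2) by (simp add: algebra_simps)
      then show ?thesis using n by simp
    qed
    have "b dvd a * k + b * l" unfolding e by simp
    then have "b dvd a * k" by (simp add: dvd_add_left_iff)
    then have "b dvd k" using ab(3) by (simp add: coprime_commute coprime_dvd_mult_right_iff)
    then obtain m where m: "k = b * m" by blast
    have "b * (a * m + l) = b * (a * n)" using e by (simp add: m algebra_simps)
    then have "a * m + l = a * n" using ab0 by simp
    moreover have "m \<le> n"
    proof -
      have "a * m \<le> a * n" using \<open>a * m + l = a * n\<close> by linarith
      then show ?thesis using ab0 by simp
    qed
    ultimately show ?thesis using m by (auto simp: diff_mult_distrib2)
  qed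
  define g where "g = (\<Sum>m\<le>n. monom (cf f (b * m) (a * (n - m))) m)"
  have cg: "coeff g k = cf f (b * k) (a * (n - k))" if "k \<le> n" for k
    using that by (simp add: g_def coeff_sum if_distrib cong: if_cong)
  have degg: "degree g \<le> n" unfolding g_def by (intro degree_sum_le) (auto intro: order_trans[OF degree_monom_le])
  have g0: "coeff g 0 \<noteq> 0" and gn: "coeff g n \<noteq> 0"
    using ends[OF Wij] cg[of 0] cg[of n] by (auto simp: supp2_def ab)
  then have gnz: "g \<noteq> 0" by auto
  have h3: "comm_ring_hom const3" and h2: "comm_ring_hom const2" by simp_all
  define u v where "u = P ^ b" and "v = Q ^ a"
  note PQ = invariant_flow_nz[OF flow]
  have uv: "u \<noteq> 0" "v \<noteq> 0" using PQ by (auto simp: u_def v_def)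
  have duv: "degree u = b * degree P" "degree v = a * degree Q"
    using PQ by (simp_all add: u_def v_def degree_power_eq)
  have form: "hform const3 g n u v = [:f:]"
  proof -
    have "ev2 const3 f P Q = hform const3 g n u v"
      unfolding g_def u_def v_def by (rule ev2_binomial_hform[OF h3 ab0]) (rule supp)
    then show ?thesis using flow by (simp add: invariant_flow_def)
  qed
  have pos: "0 < degree u \<or> 0 < degree v" using flow ab0 by (auto simp: duv invariant_flow_def)
  \<comment> \<open>The terms u^n and v^n both occur. With different degrees nothing cancels at the
    top, and the form would have T-degree at least n times either degree; but f is free of
    T.\<close>
  have dd: "degree u = degree v"
  proof (rule ccontr)
    assume ne: "degree u \<noteq> degree v"
    have inj: "const2 c = 0 \<Longrightarrow> c = 0" for c :: 'k by simp
    have "\<exists>m \<ge> n * degree u. coeff [:f:] m \<noteq> 0" "\<exists>m \<ge> n * degree v. coeff [:f:] m \<noteq> 0"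
      using hform_degree[OF h2 inj uv ne gn order_refl] hform_degree[OF h2 inj uv ne g0 le0, where n = n]
      by (simp_all add: form)
    moreover have "m = 0" if "coeff [:f:] m \<noteq> 0" for m using that by (cases m) auto
    ultimately have "n * degree u = 0" "n * degree v = 0" by force+
    then show False using pos n by auto
  qed
  then have "0 < degree u" "0 < degree v" using pos by auto
  then have dpos: "0 < degree P" "0 < degree Q" by (simp_all add: duv)
  have "coeff [:f:] (n * degree v) = 0" using pos dd n by (simp add: coeff_pCons split: nat.split)
  then have "hform const2 g n (lead_coeff u) (lead_coeff v) = 0"
    using hform_lead_coeff[OF uv dd, of const2 g n] by (simp add: form)
  moreover have "relatively_closed (const2 :: 'k \<Rightarrow> _)"
    by (rule relatively_closed_poly[OF relatively_closed_poly[OF relatively_closed_id]])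
  moreover have "lead_coeff v \<noteq> 0" using uv by simp
  ultimately have "\<exists>c. lead_coeff u = const2 c * lead_coeff v \<and> poly g c = 0"
    using gnz degg unfolding relatively_closed_def by blast
  then obtain c where c: "poly g c = 0" by blast
  have c0: "c \<noteq> 0" using c g0 by (auto simp: poly_0_coeff_0)
  have "[:- c, 1:] dvd g" using c by (simp add: poly_eq_0_iff_dvd)
  then obtain g' where g': "g = [:- c, 1:] * g'" by (rule dvdE)
  have "g' \<noteq> 0" using g' gnz by auto
  then have "degree g = Suc (degree g')" unfolding g' by (subst degree_mult_eq) auto
  then obtain n' where n': "n = Suc n'" "degree g' \<le> n'" using degg by (cases n) auto
  have "hform const3 g n u v = (u + const3 (- c) * v) * hform const3 g' n' u v"
    unfolding g' n'(1) by (rule hform_linear_mult[OF h3 n'(2)])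
  moreover have "u + const3 (- c) * v = u - const3 c * v"
  proof -
    have "const3 (- c) = - const3 c" by simp
    then show ?thesis by (simp only:) (simp only: mult_minus_left add_uminus_conv_diff)
  qed
  \<comment> \<open>The factor u - c v divides f, which is free of T, so it equals its value at T =
    0.\<close>
  ultimately have prod: "(u - const3 c * v) * hform const3 g' n' u v = [:f:]" by (simp only: form)
  then have "u - const3 c * v \<noteq> 0" "hform const3 g' n' u v \<noteq> 0" using f by auto
  then have "degree (u - const3 c * v) = 0"
    using arg_cong[OF prod, of degree] by (simp add: degree_mult_eq)
  then have "u - const3 c * v = [:poly (u - const3 c * v) 0:]" by (rule degree_0_const)
  also have "poly (u - const3 c * v) 0 = varX ^ b - const2 c * varY ^ a"
    using flow by (simp add: u_def v_def invariant_flow_def)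
  finally have cusp: "P ^ b - const3 c * Q ^ a = [:varX:] ^ b - const3 c * [:varY:] ^ a"
    by (simp add: u_def v_def poly_const_pow)
  have pd: "pderiv P \<noteq> 0 \<or> pderiv Q \<noteq> 0"
    using invariant_flow_reduce[OF flow] min by (force simp: not_less[symmetric])
  have "a = 1 \<or> b = 1"
  proof (rule ccontr)
    assume "\<not> (a = 1 \<or> b = 1)"
    then have "2 \<le> a" "2 \<le> b" using ab0 by auto
    then show False using no_flow_on_cusp[OF c0 ab(3) _ _ dpos cusp pd] by blast
  qed
  moreover have "(\<Sum>m\<le>n. cf f (b * m) (a * (n - m)) * c ^ m) = poly g c"
    by (simp add: g_def poly_sum poly_monom)
  ultimately show ?thesis using ab c c0 Wij
    by (intro exI[of _ a] exI[of _ b] exI[of _ n] exI[of _ c]) simp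
qed

section \<open>Leading forms\<close>

definition supp3 :: "'k::field poly poly poly \<Rightarrow> (nat \<times> nat \<times> nat) set" where
  "supp3 P = (SIGMA j:{..degree P}. supp2 (coeff P j))"

definition mon3 :: "'k::field \<Rightarrow> nat \<Rightarrow> nat \<Rightarrow> nat \<Rightarrow> 'k poly poly poly" where
  "mon3 c j k l = const3 c * [:varX:] ^ k * [:varY:] ^ l * [:0, 1:] ^ j"

lemma finite_supp3 [simp]: "finite (supp3 P)"
  by (simp add: supp3_def)

lemma mon3_eq: "mon3 c j k l = monom (monom (monom c k) l) j"
proof -
  have "mon3 c j k l = [:const2 c * varX ^ k * varY ^ l:] * [:0, 1:] ^ j"
    by (simp add: mon3_def poly_const_pow mult.commute)
  then show ?thesis by (simp only: monom2) (simp add: monom_altdef)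
qed

definition leading_form :: "nat \<Rightarrow> nat \<Rightarrow> nat \<Rightarrow> 'k::field poly poly \<Rightarrow> 'k poly poly" where
  "leading_form \<alpha> \<beta> W f = (\<Sum>(k, l)\<in>supp2 f. if \<alpha> * k + \<beta> * l = W then monom (monom (cf f k l) k) l else 0)"

lemma cf_leading_form: "cf (leading_form \<alpha> \<beta> W f) k l = (if \<alpha> * k + \<beta> * l = W then cf f k l else 0)"
proof -
  have "cf (leading_form \<alpha> \<beta> W f) k l =
      (\<Sum>x\<in>supp2 f. if x = (k, l) then (if \<alpha> * k + \<beta> * l = W then cf f k l else 0) else 0)"
    unfolding leading_form_def coeff_sum by (intro sum.cong refl) (auto split: if_splits)
  also have "\<dots> = (if (k, l) \<in> supp2 f then (if \<alpha> * k + \<beta> * l = W then cf f k l else 0) else 0)"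
    by (rule sum.delta[OF finite_supp2])
  finally show ?thesis by (auto simp: supp2_def)
qed

section \<open>Rescaling by weights\<close>

context
  fixes \<alpha> \<beta> :: nat and \<tau> :: int
begin

text \<open>In the Laurent series below a monomial \<open>x\<^sup>k y\<^sup>l T\<^sup>j\<close> is multiplied by the power of the series variable
  whose exponent is its weight \<open>wt j k l\<close>, so that leading parts become lowest coefficients.\<close>

definition spow :: "int \<Rightarrow> 'k::field poly poly poly fls" where
  "spow n = fls_X_intpow n"

abbreviation wt :: "nat \<Rightarrow> nat \<Rightarrow> nat \<Rightarrow> int" where
  "wt j k l \<equiv> \<tau> * int j - int \<alpha> * int k - int \<beta> * int l"

definition hC :: "'k::field \<Rightarrow> 'k poly poly poly fls" where "hC c = fls_const (const3 c)"

lemma hom_hC: "comm_ring_hom hC"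
  by (rule comm_ring_homI)
     (simp_all add: hC_def one_pCons fls_const_mult_const fls_plus_const mult.commute)

definition scaleXY :: "'k::field poly poly \<Rightarrow> 'k poly poly poly fls" where
  "scaleXY p = ev2 hC p (fls_const [:varX:] * spow (- int \<alpha>)) (fls_const [:varY:] * spow (- int \<beta>))"

definition scale :: "'k::field poly poly poly \<Rightarrow> 'k poly poly poly fls" where
  "scale P = poly (map_poly scaleXY P) (fls_const [:0, 1:] * spow \<tau>)"

lemma hom_scaleXY: "comm_ring_hom scaleXY"
  unfolding scaleXY_def by (rule comm_ring_hom_ev2[OF hom_hC])

lemma hom_scale: "comm_ring_hom scale"
  unfolding scale_def by (rule comm_ring_hom_poly_map[OF hom_scaleXY])

lemma scale_const: "scale [:p:] = scaleXY p"
proof -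
  interpret comm_ring_hom scaleXY by (rule hom_scaleXY)
  show ?thesis by (simp add: scale_def map_poly_pCons_0)
qed

lemma spow_mult: "spow a * spow b = (spow (a + b) :: 'k::field poly poly poly fls)"
  by (simp add: spow_def fls_X_intpow_times_fls_X_intpow)

lemma spow_power: "spow a ^ n = (spow (int n * a) :: 'k::field poly poly poly fls)"
  by (simp add: spow_def fls_X_intpow_power)

lemma spow_0: "spow 0 = (1 :: 'k::field poly poly poly fls)"
  by (simp add: spow_def)

lemma scale_term:
  "hC c * (fls_const x * spow a) ^ k * (fls_const y * spow b) ^ l * (fls_const t * spow d) ^ j =
    fls_const (const3 c * x ^ k * y ^ l * t ^ j) * spow (int k * a + int l * b + int j * d)"
proof -
  have "hC c * (fls_const x * spow a) ^ k * (fls_const y * spow b) ^ l * (fls_const t * spow d) ^ j =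
      (hC c * fls_const x ^ k * fls_const y ^ l * fls_const t ^ j) * (spow a ^ k * spow b ^ l * spow d ^ j)"
    by (simp only: power_mult_distrib mult_ac)
  also have "hC c * fls_const x ^ k * fls_const y ^ l * fls_const t ^ j = fls_const (const3 c * x ^ k * y ^ l * t ^ j)"
    by (simp only: hC_def fls_const_power fls_const_mult_const[symmetric])
  also have "spow a ^ k * spow b ^ l * spow d ^ j = (spow (int k * a + int l * b + int j * d) :: 'a poly poly poly fls)"
    by (simp only: spow_power spow_mult)
  finally show ?thesis .
qed

lemma scale_sum:
  fixes P :: "'k::field poly poly poly"
  shows "scale P = (\<Sum>(j, k, l)\<in>supp3 P. fls_const (mon3 (cf (coeff P j) k l) j k l) * spow (wt j k l))"
proof -
  have trm: "hC c * (fls_const [:varX:] * spow (- int \<alpha>)) ^ k * (fls_const [:varY:] * spow (- int \<beta>)) ^ l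
      * (fls_const [:0, 1:] * spow \<tau>) ^ j = fls_const (mon3 c j k l) * spow (wt j k l)" for c :: 'k and j k l
  proof -
    have "int k * - int \<alpha> + int l * - int \<beta> + int j * \<tau> = wt j k l" by (simp add: algebra_simps)
    then show ?thesis unfolding scale_term mon3_def by (simp only:)
  qed
  have "scale P = (\<Sum>j\<le>degree P. scaleXY (coeff P j) * (fls_const [:0, 1:] * spow \<tau>) ^ j)"
    unfolding scale_def by (rule poly_map_sum[OF hom_scaleXY]) (auto intro: le_degree)
  also have "\<dots> = (\<Sum>j\<le>degree P. \<Sum>(k, l)\<in>supp2 (coeff P j). fls_const (mon3 (cf (coeff P j) k l) j k l) * spow (wt j k l))"
    unfolding scaleXY_def
    by (simp only: ev2_sum[OF hom_hC subset_refl finite_supp2] sum_distrib_right case_prod_unfold trm)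
  also have "\<dots> = (\<Sum>(j, k, l)\<in>supp3 P. fls_const (mon3 (cf (coeff P j) k l) j k l) * spow (wt j k l))"
    unfolding supp3_def by (subst sum.Sigma) (auto simp: case_prod_unfold)
  finally show ?thesis .
qed

text \<open>With s the series variable, this is s^\<epsilon> times \<open>scale P\<close> as a power
  series, as long as no term has weight below -\<epsilon>; \<open>nat\<close> would truncate such
  terms. A power series has a value at s = 0, and taking it respects products.\<close>

definition scaled :: "nat \<Rightarrow> 'k::field poly poly poly \<Rightarrow> 'k poly poly poly fps" where
  "scaled \<epsilon> P = (\<Sum>(j, k, l)\<in>supp3 P. fps_const (mon3 (cf (coeff P j) k l) j k l) * fps_X ^ nat (int \<epsilon> + wt j k l))"

definition flow_part :: "nat \<Rightarrow> 'k::field poly poly poly \<Rightarrow> 'k poly poly poly" where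
  "flow_part \<epsilon> P = (\<Sum>(j, k, l)\<in>supp3 P. if int \<epsilon> + wt j k l = 0 then mon3 (cf (coeff P j) k l) j k l else 0)"

lemma fps_X_to_spow: "0 \<le> n \<Longrightarrow> fps_to_fls (fps_X ^ nat n) = (spow n :: 'k::field poly poly poly fls)"
  by (simp add: spow_def fps_to_fls_power fls_X_power_conv_shift_1)

lemma scaled_scale:
  fixes P :: "'k::field poly poly poly"
  assumes "\<And>j k l. (j, k, l) \<in> supp3 P \<Longrightarrow> 0 \<le> int \<epsilon> + wt j k l"
  shows "fps_to_fls (scaled \<epsilon> P) = spow (int \<epsilon>) * scale P"
proof -
  have hom_sum: "fps_to_fls (sum g A) = (\<Sum>a\<in>A. fps_to_fls (g a :: 'k poly poly poly fps))" for g :: "nat \<times> nat \<times> nat \<Rightarrow> _" and A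
    by (induction A rule: infinite_finite_induct) simp_all
  show ?thesis
    unfolding scaled_def scale_sum hom_sum sum_distrib_left
  proof (intro sum.cong refl)
    fix t assume t: "t \<in> supp3 P"
    obtain j k l where jkl: "t = (j, k, l)" by (cases t)
    have "fps_to_fls (fps_const m * fps_X ^ nat (int \<epsilon> + wt j k l)) =
        spow (int \<epsilon>) * (fls_const m * spow (wt j k l))" for m :: "'k poly poly poly"
      using assms[of j k l] t
      by (simp add: jkl fls_times_fps_to_fls fps_X_to_spow mult.left_commute spow_mult)
    then show "fps_to_fls (case t of (j, k, l) \<Rightarrow> fps_const (mon3 (cf (coeff P j) k l) j k l) * fps_X ^ nat (int \<epsilon> + wt j k l)) =
       spow (int \<epsilon>) * (case t of (j, k, l) \<Rightarrow> fls_const (mon3 (cf (coeff P j) k l) j k l) * spow (wt j k l))"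
      by (simp only: jkl prod.case)
  qed
qed

lemma scaled_nth_0:
  fixes P :: "'k::field poly poly poly"
  assumes "\<And>j k l. (j, k, l) \<in> supp3 P \<Longrightarrow> 0 \<le> int \<epsilon> + wt j k l"
  shows "fps_nth (scaled \<epsilon> P) 0 = flow_part \<epsilon> P"
  unfolding scaled_def flow_part_def fps_sum_nth
proof (intro sum.cong refl)
  fix t assume t: "t \<in> supp3 P"
  obtain j k l where jkl: "t = (j, k, l)" by (cases t)
  have "nat (int \<epsilon> + wt j k l) = 0 \<longleftrightarrow> int \<epsilon> + wt j k l = 0"
    using assms[of j k l] t jkl by auto
  then show "fps_nth (case t of (j, k, l) \<Rightarrow> fps_const (mon3 (cf (coeff P j) k l) j k l) * fps_X ^ nat (int \<epsilon> + wt j k l)) 0 =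
      (case t of (j, k, l) \<Rightarrow> if int \<epsilon> + wt j k l = 0 then mon3 (cf (coeff P j) k l) j k l else 0)"
    by (simp add: jkl fps_X_power_nth)
qed

lemma flow_part_at_0:
  fixes P :: "'k::field poly poly poly"
  assumes "coeff P 0 = monom (monom 1 k0) l0" "\<epsilon> = \<alpha> * k0 + \<beta> * l0"
  shows "poly (flow_part \<epsilon> P) 0 = monom (monom 1 k0) l0"
proof -
  have s0: "supp2 (coeff P 0) = {(k0, l0)}" using assms(1) by (auto simp: supp2_def split: if_splits)
  have "poly (flow_part \<epsilon> P) 0 = (\<Sum>t\<in>supp3 P. if t = (0, k0, l0) then monom (monom 1 k0) l0 else 0)"
    unfolding flow_part_def poly_sum
  proof (intro sum.cong refl)
    fix t assume t: "t \<in> supp3 P"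
    obtain j k l where jkl: "t = (j, k, l)" by (cases t)
    show "poly (case t of (j, k, l) \<Rightarrow> if int \<epsilon> + wt j k l = 0 then mon3 (cf (coeff P j) k l) j k l else 0) 0 =
        (if t = (0, k0, l0) then monom (monom 1 k0) l0 else 0)"
    proof (cases "j = 0")
      case True
      then have "k = k0 \<and> l = l0" using t jkl s0 by (auto simp: supp3_def)
      then show ?thesis using True assms by (simp add: jkl mon3_eq poly_monom)
    next
      case False
      then show ?thesis by (simp add: jkl mon3_eq poly_monom)
    qed
  qed
  also have "\<dots> = (if (0, k0, l0) \<in> supp3 P then monom (monom 1 k0) l0 else 0)"
    by (rule sum.delta[OF finite_supp3])
  finally show ?thesis by (simp add: supp3_def s0)
qed

lemma flow_part_degree:
  fixes P :: "'k::field poly poly poly"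
  assumes "(j, k, l) \<in> supp3 P" "int \<epsilon> + wt j k l = 0"
  shows "j \<le> degree (flow_part \<epsilon> P)"
proof -
  have "cf (coeff (flow_part \<epsilon> P) j) k l = (\<Sum>t\<in>supp3 P. if t = (j, k, l) then cf (coeff P j) k l else 0)"
    unfolding flow_part_def coeff_sum
    by (intro sum.cong refl) (use assms in \<open>auto simp: mon3_eq split: if_splits\<close>)
  also have "\<dots> = cf (coeff P j) k l" using assms by (simp only: sum.delta[OF finite_supp3] if_True)
  also have "\<dots> \<noteq> 0" using assms by (simp add: supp3_def supp2_def)
  finally have "coeff (flow_part \<epsilon> P) j \<noteq> 0" by auto
  then show ?thesis by (rule le_degree)
qed

lemma var_monom: "varX = monom (monom 1 (Suc 0)) 0" "varY = monom (monom 1 0) (Suc 0)"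
  by (simp_all add: varX_def varY_def monom_0 monom_Suc one_pCons)

text \<open>\<open>F U V\<close> is s^W f(s^-\<alpha> U, s^-\<beta> V), where s is the series
  variable. Rescaling f(P, Q) = f shows that \<open>F\<close> has the same value at the rescaled P
  and Q as at x and y, and setting s = 0 gives the invariance of the leading form.
  \<open>att\<close> keeps the new flow from being constant in T.\<close>

lemma invariant_flow_leading_form_weights:
  fixes f :: "'k::field poly poly"
  assumes flow: "invariant_flow f P Q"
    and W: "\<And>k l. (k, l) \<in> supp2 f \<Longrightarrow> \<alpha> * k + \<beta> * l \<le> W"
    and P: "\<And>j k l. (j, k, l) \<in> supp3 P \<Longrightarrow> 0 \<le> int \<alpha> + wt j k l"
    and Q: "\<And>j k l. (j, k, l) \<in> supp3 Q \<Longrightarrow> 0 \<le> int \<beta> + wt j k l"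
    and att: "(j, k, l) \<in> supp3 P \<and> int \<alpha> + wt j k l = 0 \<or> (j, k, l) \<in> supp3 Q \<and> int \<beta> + wt j k l = 0"
    and j: "0 < j"
  shows "invariant_flow (leading_form \<alpha> \<beta> W f) (flow_part \<alpha> P) (flow_part \<beta> Q)"
proof -
  interpret s: comm_ring_hom scale by (rule hom_scale)
  let ?e = "\<lambda>k l. W - (\<alpha> * k + \<beta> * l)"
  let ?P = "scaled \<alpha> P" and ?Q = "scaled \<beta> Q"
  let ?x = "fps_const [:varX:] :: 'k poly poly poly fps" and ?y = "fps_const [:varY:] :: 'k poly poly poly fps"
  have hom_sum: "fps_to_fls (sum g A) = (\<Sum>a\<in>A. fps_to_fls (g a :: 'k poly poly poly fps))" for g :: "nat \<times> nat \<Rightarrow> _" and A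
    by (induction A rule: infinite_finite_induct) simp_all
  have e: "fps_to_fls (fps_X ^ ?e k l) = (spow (int W + wt 0 k l) :: 'k poly poly poly fls)" if "(k, l) \<in> supp2 f" for k l
  proof -
    have "?e k l = nat (int W + wt 0 k l)" "0 \<le> int W + wt 0 k l"
      using W[OF that] by (simp_all add: of_nat_diff nat_diff_distrib flip: of_nat_mult of_nat_add)
    then show ?thesis using fps_X_to_spow by metis
  qed
  define F where "F = (\<lambda>U V :: 'k poly poly poly fps. \<Sum>(k, l)\<in>supp2 f. fps_const (const3 (cf f k l)) * fps_X ^ ?e k l * U ^ k * V ^ l)"
  have F: "fps_to_fls (F U V) = spow (int W) * ev2 hC f (spow (- int \<alpha>) * fps_to_fls U) (spow (- int \<beta>) * fps_to_fls V)" for U V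
    unfolding F_def hom_sum ev2_sum[OF hom_hC subset_refl finite_supp2] sum_distrib_left
  proof (intro sum.cong refl)
    fix t assume t: "t \<in> supp2 f"
    obtain k l where kl: "t = (k, l)" by (cases t)
    have sp: "spow (int W + wt 0 k l) = (spow (int W) * spow (- int \<alpha>) ^ k * spow (- int \<beta>) ^ l :: 'k poly poly poly fls)"
      by (simp only: spow_power spow_mult) (simp add: algebra_simps)
    have "fps_to_fls (fps_const (const3 (cf f k l)) * fps_X ^ ?e k l * U ^ k * V ^ l) =
      spow (int W) * (hC (cf f k l) * (spow (- int \<alpha>) * fps_to_fls U) ^ k * (spow (- int \<beta>) * fps_to_fls V) ^ l)"
      unfolding fls_times_fps_to_fls fps_to_fls_power[of U] fps_to_fls_power[of V] e[OF t[unfolded kl]] fps_const_to_fls hC_def power_mult_distrib sp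
      by (simp only: mult_ac)
    then show "fps_to_fls (case t of (k, l) \<Rightarrow> fps_const (const3 (cf f k l)) * fps_X ^ ?e k l * U ^ k * V ^ l) =
      spow (int W) * (case t of (k, l) \<Rightarrow> hC (cf f k l) * (spow (- int \<alpha>) * fps_to_fls U) ^ k * (spow (- int \<beta>) * fps_to_fls V) ^ l)"
      by (simp only: kl prod.case)
  qed
  have inv: "spow (- n) * (spow n * g) = g" for n and g :: "'k poly poly poly fls"
    unfolding mult.assoc[symmetric] spow_mult by (simp add: spow_0)
  have sP: "fps_to_fls ?P = spow (int \<alpha>) * scale P" by (rule scaled_scale) (rule P)
  have sQ: "fps_to_fls ?Q = spow (int \<beta>) * scale Q" by (rule scaled_scale) (rule Q)
  have "fps_to_fls (F ?P ?Q) = spow (int W) * ev2 hC f (scale P) (scale Q)"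
    unfolding F sP sQ inv ..
  also have "ev2 hC f (scale P) (scale Q) = scale (ev2 const3 f P Q)"
  proof -
    have "scale (const3 c) = hC c" for c :: 'k by (simp add: scale_const scaleXY_def hom_hC)
    then show ?thesis by (subst ev2_hom[OF _ hom_scale]) simp_all
  qed
  also have "\<dots> = scaleXY f" using flow by (simp add: invariant_flow_def scale_const)
  also have "spow (int W) * scaleXY f = fps_to_fls (F ?x ?y)"
    unfolding F scaleXY_def by (simp add: mult.commute)
  finally have "F ?P ?Q = F ?x ?y" by simp
  then have "fps_nth (F ?P ?Q) 0 = fps_nth (F ?x ?y) 0" by simp
  moreover have F0: "fps_nth (F U V) 0 = ev2 const3 (leading_form \<alpha> \<beta> W f) (fps_nth U 0) (fps_nth V 0)" for U V
  proof -
    have "supp2 (leading_form \<alpha> \<beta> W f) \<subseteq> supp2 f" by (auto simp: supp2_def cf_leading_form)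
    then have "ev2 const3 (leading_form \<alpha> \<beta> W f) (fps_nth U 0) (fps_nth V 0) =
        (\<Sum>(k, l)\<in>supp2 f. const3 (cf (leading_form \<alpha> \<beta> W f) k l) * fps_nth U 0 ^ k * fps_nth V 0 ^ l)"
      by (intro ev2_sum) simp_all
    also have "\<dots> = fps_nth (F U V) 0"
      unfolding F_def fps_sum_nth
    proof (intro sum.cong refl)
      fix t assume t: "t \<in> supp2 f"
      obtain k l where kl: "t = (k, l)" by (cases t)
      have le: "\<alpha> * k + \<beta> * l \<le> W" using W[of k l] t kl by auto
      then show "(case t of (k, l) \<Rightarrow> const3 (cf (leading_form \<alpha> \<beta> W f) k l) * fps_nth U 0 ^ k * fps_nth V 0 ^ l) =
          fps_nth (case t of (k, l) \<Rightarrow> fps_const (const3 (cf f k l)) * fps_X ^ ?e k l * U ^ k * V ^ l) 0"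
        using le by (cases "\<alpha> * k + \<beta> * l = W")
          (auto simp: kl cf_leading_form fps_mult_nth_0 fps_power_zeroth fps_X_power_nth)
    qed
    finally show ?thesis ..
  qed
  moreover have "fps_nth ?P 0 = flow_part \<alpha> P" "fps_nth ?Q 0 = flow_part \<beta> Q"
    using scaled_nth_0 P Q by blast+
  ultimately have "ev2 const3 (leading_form \<alpha> \<beta> W f) (flow_part \<alpha> P) (flow_part \<beta> Q) =
      ev2 const3 (leading_form \<alpha> \<beta> W f) [:varX:] [:varY:]" by simp
  also have "\<dots> = [:ev2 const2 (leading_form \<alpha> \<beta> W f) varX varY:]"
    by (rule ev2_hom[symmetric]) simp_all
  finally have "ev2 const3 (leading_form \<alpha> \<beta> W f) (flow_part \<alpha> P) (flow_part \<beta> Q) = [:leading_form \<alpha> \<beta> W f:]"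
    by (simp only: ev2_self)
  moreover have "poly (flow_part \<alpha> P) 0 = varX" "poly (flow_part \<beta> Q) 0 = varY"
    unfolding var_monom
    by (rule flow_part_at_0; use flow in \<open>simp add: invariant_flow_def poly_0_coeff_0 var_monom\<close>)+
  moreover have "0 < degree (flow_part \<alpha> P) \<or> 0 < degree (flow_part \<beta> Q)"
    using att j flow_part_degree[of j k l P \<alpha>] flow_part_degree[of j k l Q \<beta>] by fastforce
  ultimately show ?thesis unfolding invariant_flow_def by blast
qed

end

text \<open>\<open>T\<close> gets the weight for which the leading parts of \<open>P\<close> and \<open>Q\<close> just become nonconstant in \<open>T\<close>. The
  weights are scaled by \<open>j\<close> to make it integral.\<close>

theorem invariant_flow_leading_form:
  fixes f :: "'k::field poly poly"
  assumes flow: "invariant_flow f P Q"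
    and W: "\<And>k l. (k, l) \<in> supp2 f \<Longrightarrow> \<alpha> * k + \<beta> * l \<le> W"
  shows "\<exists>P' Q'. invariant_flow (leading_form \<alpha> \<beta> W f) P' Q'"
proof -
  \<comment> \<open>A term x^k y^l T^i of P keeps a nonnegative order exactly if the weight of T is
    at least the excess \<alpha> k + \<beta> l - \<alpha> divided by i, and similarly for Q. The
    largest of these slopes is taken; it may be negative, hence the integers.\<close>
  define E where "E = (\<lambda>(j, k, l). (int (\<alpha> * k + \<beta> * l) - int \<alpha>, j)) ` {t \<in> supp3 P. 0 < fst t}
      \<union> (\<lambda>(j, k, l). (int (\<alpha> * k + \<beta> * l) - int \<beta>, j)) ` {t \<in> supp3 Q. 0 < fst t}"
  have finE: "finite E" by (simp add: E_def)
  have pos: "0 < snd e" if "e \<in> E" for e using that by (auto simp: E_def)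
  have ne: "{t \<in> supp3 R. 0 < fst t} \<noteq> {}" if R: "0 < degree R" for R :: "'k poly poly poly"
  proof -
    have "coeff R (degree R) \<noteq> 0" using R by auto
    then have "supp2 (coeff R (degree R)) \<noteq> {}" by simp
    then obtain t where "t \<in> supp2 (coeff R (degree R))" by blast
    then have "(degree R, t) \<in> {t \<in> supp3 R. 0 < fst t}" using R by (simp add: supp3_def)
    then show ?thesis by blast
  qed
  have "0 < degree P \<or> 0 < degree Q" using flow by (simp add: invariant_flow_def)
  then have "E \<noteq> {}"
    unfolding E_def Un_empty image_is_empty de_Morgan_conj by (elim disjE) (simp_all only: ne simp_thms not_False_eq_True)
  define slope where "slope = (\<lambda>e. of_int (fst e) / of_nat (snd e) :: rat)" for e :: "int \<times> nat"
  have "Max (slope ` E) \<in> slope ` E" using finE \<open>E \<noteq> {}\<close> by (intro Max_in) auto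
  then obtain e where "e \<in> E" "slope e = Max (slope ` E)" by (metis imageE)
  then obtain n j where nj: "(n, j) \<in> E" "slope (n, j) = Max (slope ` E)" by (cases e) auto
  have j: "0 < j" using pos[OF nj(1)] by simp
  have max: "m * int j \<le> n * int i" if "(m, i) \<in> E" for m i
  proof -
    have "slope (m, i) \<le> slope (n, j)" unfolding nj(2) using finE that by (intro Max_ge) auto
    moreover have "0 < i" using pos[OF that] by simp
    ultimately have "(of_int (m * int j) :: rat) \<le> of_int (n * int i)"
      using j by (simp add: slope_def field_simps)
    then show ?thesis by (simp only: of_int_le_iff)
  qed
  have bP: "0 \<le> int (\<alpha> * j) + (n * int i - int (\<alpha> * j) * int k - int (\<beta> * j) * int l)" if t: "(i, k, l) \<in> supp3 P" for i k l
  proof (cases "i = 0")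
    case True
    then have "(k, l) = (Suc 0, 0)"
      using t flow by (auto simp: supp3_def supp2_def invariant_flow_def poly_0_coeff_0 var_monom split: if_splits)
    then show ?thesis using True by simp
  next
    case False
    then have "(i, k, l) \<in> {t \<in> supp3 P. 0 < fst t}" using t by simp
    then have "(int (\<alpha> * k + \<beta> * l) - int \<alpha>, i) \<in> E" unfolding E_def by (intro UnI1 image_eqI[of _ _ "(i, k, l)"]) auto
    from max[OF this] show ?thesis by (simp add: algebra_simps)
  qed
  have bQ: "0 \<le> int (\<beta> * j) + (n * int i - int (\<alpha> * j) * int k - int (\<beta> * j) * int l)" if t: "(i, k, l) \<in> supp3 Q" for i k l
  proof (cases "i = 0")
    case True
    then have "(k, l) = (0, Suc 0)"
      using t flow by (auto simp: supp3_def supp2_def invariant_flow_def poly_0_coeff_0 var_monom split: if_splits)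
    then show ?thesis using True by simp
  next
    case False
    then have "(i, k, l) \<in> {t \<in> supp3 Q. 0 < fst t}" using t by simp
    then have "(int (\<alpha> * k + \<beta> * l) - int \<beta>, i) \<in> E" unfolding E_def by (intro UnI2 image_eqI[of _ _ "(i, k, l)"]) auto
    from max[OF this] show ?thesis by (simp add: algebra_simps)
  qed
  have eq: "int (\<gamma> * j) + (n * int j - int (\<alpha> * j) * int k - int (\<beta> * j) * int l) =
      int j * (int \<gamma> + n - int (\<alpha> * k + \<beta> * l))" for \<gamma> k l
    by (simp add: algebra_simps)
  obtain k l where "(j, k, l) \<in> supp3 P \<and> n = int (\<alpha> * k + \<beta> * l) - int \<alpha> \<or>
      (j, k, l) \<in> supp3 Q \<and> n = int (\<alpha> * k + \<beta> * l) - int \<beta>"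
    using nj(1) by (auto simp: E_def)
  then have att: "(j, k, l) \<in> supp3 P \<and> int (\<alpha> * j) + (n * int j - int (\<alpha> * j) * int k - int (\<beta> * j) * int l) = 0 \<or>
      (j, k, l) \<in> supp3 Q \<and> int (\<beta> * j) + (n * int j - int (\<alpha> * j) * int k - int (\<beta> * j) * int l) = 0"
    unfolding eq by auto
  have W': "(\<alpha> * j) * k + (\<beta> * j) * l \<le> W * j" if "(k, l) \<in> supp2 f" for k l
    using mult_right_mono[OF W[OF that], of j] by (simp add: algebra_simps)
  have "leading_form (\<alpha> * j) (\<beta> * j) (W * j) f = leading_form \<alpha> \<beta> W f"
  proof -
    have "(\<alpha> * j) * k + (\<beta> * j) * l = W * j \<longleftrightarrow> \<alpha> * k + \<beta> * l = W" for k l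
    proof -
      have "(\<alpha> * j) * k + (\<beta> * j) * l = (\<alpha> * k + \<beta> * l) * j" by (simp add: algebra_simps)
      then show ?thesis using j by simp
    qed
    then show ?thesis by (simp add: leading_form_def)
  qed
  moreover have "invariant_flow (leading_form (\<alpha> * j) (\<beta> * j) (W * j) f) (flow_part (\<alpha> * j) (\<beta> * j) n (\<alpha> * j) P)
      (flow_part (\<alpha> * j) (\<beta> * j) n (\<beta> * j) Q)"
    by (rule invariant_flow_leading_form_weights[OF flow W' bP bQ att j])
  ultimately show ?thesis by auto
qed

section \<open>Elementary automorphisms\<close>

text \<open>P(f) as a substitution into \<open>[:P:]\<close>, a polynomial in x alone, which makes
  the rules for \<open>ev2\<close> and the chain rule available.\<close>

definition papp :: "'k::field poly \<Rightarrow> 'k poly poly \<Rightarrow> 'k poly poly" where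
  "papp P f = ev2 const2 [:P:] f 0"

datatype 'p letter = Lo 'p | Up 'p

text \<open>Letters compose on the left: the polynomial is applied to a component of \<phi>, not to
  a variable.\<close>

fun act :: "'k::field poly letter \<Rightarrow> 'k plane_map \<Rightarrow> 'k plane_map" where
  "act (Lo P) (f, g) = (f, g + papp P f)"
| "act (Up Q) (f, g) = (f + papp Q g, g)"

fun valid :: "'k::field poly letter \<Rightarrow> bool" where
  "valid (Lo P) \<longleftrightarrow> coeff P 0 = 0"
| "valid (Up Q) \<longleftrightarrow> coeff Q 0 = 0 \<and> coeff Q 1 = 0"

definition weval :: "'k::field poly letter list \<Rightarrow> 'k plane_map \<Rightarrow> 'k plane_map" where
  "weval w \<phi> = foldr act w \<phi>"

abbreviation id2 :: "'k::field plane_map" where "id2 \<equiv> (varX, varY)"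

lemma weval_simps [simp]: "weval [] \<phi> = \<phi>" "weval (l # w) \<phi> = act l (weval w \<phi>)"
  by (simp_all add: weval_def)

lemma weval_append: "weval (v @ w) \<phi> = weval v (weval w \<phi>)"
  by (simp add: weval_def)

lemma papp_poly: "papp P f = poly (map_poly const2 P) f"
  by (simp add: papp_def ev2_pCons)

lemma papp_hom:
  assumes "comm_ring_hom F" "\<And>c. F (const2 c) = const2 c"
  shows "F (papp P f) = papp P (F f)"
proof -
  interpret comm_ring_hom F by fact
  show ?thesis unfolding papp_def by (subst ev2_hom[OF _ assms(1)]) (simp_all add: assms(2))
qed

lemma comm_ring_hom_papp: "comm_ring_hom (\<lambda>P. papp P f)"
  unfolding papp_poly by (rule comm_ring_hom_poly_map) simp

lemma papp_simps [simp]: "papp 0 f = 0" "papp (P + Q) f = papp P f + papp Q f" "papp (- P) f = - papp P f"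
proof -
  interpret comm_ring_hom "\<lambda>P. papp P f" by (rule comm_ring_hom_papp)
  show "papp 0 f = 0" "papp (P + Q) f = papp P f + papp Q f" "papp (- P) f = - papp P f"
    by (simp_all add: hom_add hom_uminus)
qed

lemma papp_monom: "papp (monom c a) f = const2 c * f ^ a"
proof -
  interpret comm_ring_hom "const2 :: 'a \<Rightarrow> _" by simp
  show ?thesis unfolding papp_poly by (simp add: poly_monom)
qed

lemma papp_linear: "papp [:0, c:] f = const2 c * f"
  using papp_monom[of c 1 f] by (simp add: monom_altdef)

lemma comm_ring_hom_subst2: "comm_ring_hom (\<lambda>p. subst2 p \<psi>)"
  unfolding subst2_ev2 by (rule comm_ring_hom_ev2) simp

lemma subst2_simps [simp]:
  "subst2 (const2 c) \<psi> = const2 c" "subst2 varX \<psi> = fst \<psi>" "subst2 varY \<psi> = snd \<psi>"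
  "subst2 (p + q) \<psi> = subst2 p \<psi> + subst2 q \<psi>" "subst2 (p * q) \<psi> = subst2 p \<psi> * subst2 q \<psi>"
  "subst2 (p ^ n) \<psi> = subst2 p \<psi> ^ n" "subst2 0 \<psi> = 0" "subst2 1 \<psi> = 1"
  "subst2 (papp P f) \<psi> = papp P (subst2 f \<psi>)"
proof -
  interpret comm_ring_hom "\<lambda>p. subst2 p \<psi>" by (rule comm_ring_hom_subst2)
  show c: "subst2 (const2 c) \<psi> = const2 c" for c by (simp add: subst2_ev2)
  show "subst2 varX \<psi> = fst \<psi>" "subst2 varY \<psi> = snd \<psi>" by (simp_all add: subst2_ev2)
  show "subst2 (p + q) \<psi> = subst2 p \<psi> + subst2 q \<psi>" "subst2 (p * q) \<psi> = subst2 p \<psi> * subst2 q \<psi>"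
    "subst2 (p ^ n) \<psi> = subst2 p \<psi> ^ n" "subst2 0 \<psi> = 0" "subst2 1 \<psi> = 1"
    by (simp_all add: hom_add hom_mult hom_power)
  show "subst2 (papp P f) \<psi> = papp P (subst2 f \<psi>)" by (rule papp_hom[OF comm_ring_hom_subst2 c])
qed

lemma comp2_act: "comp2 (act l \<phi>) \<psi> = act l (comp2 \<phi> \<psi>)"
  by (cases l; cases \<phi>) (simp_all add: comp2_def)

lemma comp2_weval: "comp2 (weval w \<phi>) \<psi> = weval w (comp2 \<phi> \<psi>)"
  by (induction w) (simp_all add: comp2_act)

fun inv_letter :: "'k::field poly letter \<Rightarrow> 'k poly letter" where
  "inv_letter (Lo P) = Lo (- P)"
| "inv_letter (Up P) = Up (- P)"

lemma act_inv_letter [simp]: "act (inv_letter l) (act l \<phi>) = \<phi>" "act l (act (inv_letter l) \<phi>) = \<phi>"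
  by (cases l; cases \<phi>; simp)+

lemma valid_inv_letter [simp]: "valid (inv_letter l) = valid l"
  by (cases l) simp_all

definition inv_word :: "'k::field poly letter list \<Rightarrow> 'k poly letter list" where
  "inv_word w = rev (map inv_letter w)"

lemma weval_inv_word [simp]: "weval (inv_word w) (weval w \<phi>) = \<phi>" "weval w (weval (inv_word w) \<phi>) = \<phi>"
proof -
  show "weval (inv_word w) (weval w \<phi>) = \<phi>"
    by (induction w arbitrary: \<phi>) (simp_all add: inv_word_def weval_append)
  show "weval w (weval (inv_word w) \<phi>) = \<phi>"
    by (induction w arbitrary: \<phi>) (simp_all add: inv_word_def weval_append)
qed

lemma valid_inv_word: "(\<forall>l\<in>set (inv_word w). valid l) \<longleftrightarrow> (\<forall>l\<in>set w. valid l)"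
  by (simp add: inv_word_def)

lemma weval_in_Aut_plane: "weval w id2 \<in> carrier Aut_plane"
  unfolding carrier_Aut_plane
  by (rule exI[of _ "weval (inv_word w) id2"]) (simp add: comp2_weval)

lemma cf_0_papp: "cf (papp P f) 0 0 = poly P (cf f 0 0)"
proof -
  have h: "comm_ring_hom (\<lambda>p :: 'a poly poly. cf p 0 0)"
    unfolding cf_0_ev2 by (rule comm_ring_hom_ev2[OF comm_ring_hom_id])
  have "cf (papp P f) 0 0 = ev2 (\<lambda>c. cf (const2 c) 0 0) [:P:] (cf f 0 0) (cf 0 0 0)"
    unfolding papp_def by (rule ev2_hom[OF _ h]) simp
  then show ?thesis by (simp add: ev2_def map_poly_pCons_0)
qed

lemma act_origin:
  assumes "valid l" "cf (fst \<phi>) 0 0 = 0" "cf (snd \<phi>) 0 0 = 0"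
  shows "cf (fst (act l \<phi>)) 0 0 = 0" "cf (snd (act l \<phi>)) 0 0 = 0"
  using assms by (cases l; cases \<phi>; simp add: cf_0_papp poly_0_coeff_0)+

lemma weval_origin:
  assumes "\<forall>l\<in>set w. valid l" "cf (fst \<phi>) 0 0 = 0" "cf (snd \<phi>) 0 0 = 0"
  shows "cf (fst (weval w \<phi>)) 0 0 = 0" "cf (snd (weval w \<phi>)) 0 0 = 0"
  using assms by (induction w) (simp_all add: act_origin)

lemma cf_var [simp]: "cf varX 0 0 = 0" "cf varY 0 0 = 0"
  by (simp_all add: varX_def varY_def)

lemma weval_in_Aut0_plane: "\<forall>l\<in>set w. valid l \<Longrightarrow> weval w id2 \<in> carrier Aut0_plane"
  by (simp add: carrier_Aut0_plane weval_in_Aut_plane weval_origin)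

section \<open>Linear and tame maps\<close>

definition lin :: "'k::field \<Rightarrow> 'k \<Rightarrow> 'k \<Rightarrow> 'k \<Rightarrow> 'k plane_map" where
  "lin a b c d = (const2 a * varX + const2 b * varY, const2 c * varX + const2 d * varY)"

lemma const2_simps: "const2 (a + b) = const2 a + const2 b" "const2 (a * b) = const2 a * const2 b"
  "const2 (- a) = - const2 a" "const2 (a ^ n) = const2 a ^ n"
  for a b :: "'k::field"
proof -
  interpret comm_ring_hom "const2 :: 'k \<Rightarrow> _" by simp
  show "const2 (a + b) = const2 a + const2 b" "const2 (a * b) = const2 a * const2 b"
    "const2 (- a) = - const2 a" "const2 (a ^ n) = const2 a ^ n"
    by (simp_all only: hom_add hom_mult hom_uminus hom_power)
qed

lemma const2_0_1: "const2 (0 :: 'k::field) = 0" "const2 (1 :: 'k::field) = 1"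
  by (simp_all add: one_pCons)

definition upmap :: "'k::field \<Rightarrow> nat \<Rightarrow> 'k plane_map" where
  "upmap c a = (varX + const2 c * varY ^ a, varY)"

lemma comp2_lin: "comp2 (lin a b c d) (lin a' b' c' d') = lin (a * a' + b * c') (a * b' + b * d') (c * a' + d * c') (c * b' + d * d')"
  by (simp only: lin_def comp2_def fst_conv snd_conv subst2_simps const2_simps prod.inject)
     (simp only: distrib_left distrib_right mult_ac add_ac simp_thms)

text \<open>A normal form rather than membership in a generated group: with all letters to the left
  of a single linear map, the differential at the origin can be read off.\<close>

definition tame :: "'k::field plane_map \<Rightarrow> bool" where
  "tame \<phi> \<longleftrightarrow> (\<exists>w a b c d. (\<forall>l\<in>set w. valid l) \<and> a * d - b * c \<noteq> 0 \<and> \<phi> = weval w (lin a b c d))"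

lemma tame_comp_lin:
  assumes "tame \<phi>" "a' * d' - b' * c' \<noteq> 0"
  shows "tame (comp2 \<phi> (lin a' b' c' d'))"
proof -
  obtain w a b c d where w: "\<forall>l\<in>set w. valid l" "a * d - b * c \<noteq> 0" "\<phi> = weval w (lin a b c d)"
    using assms(1) unfolding tame_def by blast
  have "(a * a' + b * c') * (c * b' + d * d') - (a * b' + b * d') * (c * a' + d * c') = (a * d - b * c) * (a' * d' - b' * c')"
    by (simp add: algebra_simps)
  then have "(a * a' + b * c') * (c * b' + d * d') - (a * b' + b * d') * (c * a' + d * c') \<noteq> 0"
    using w(2) assms(2) by simp
  then show ?thesis
    unfolding tame_def w(3) comp2_weval comp2_lin using w(1) by blast
qed

text \<open>The degree reduction composes with \<open>upmap\<close> on the right, whereas words act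
  on the left. So \<open>upmap\<close> is carried past the linear factor, where it becomes a word of
  one or three letters.\<close>

lemma tame_comp_upmap:
  assumes "tame \<phi>" "1 \<le> a"
  shows "tame (comp2 \<phi> (upmap k a))"
proof (cases "a = 1")
  case True
  then have "upmap k a = lin 1 k 0 1" 
    by (simp only: upmap_def lin_def const2_0_1 power_one_right mult_zero_left add_0 mult_1_left)
  then show ?thesis using tame_comp_lin[OF assms(1), of 1 1 k 0] by simp
next
  case False
  then have a: "2 \<le> a" using assms by simp
  obtain w \<alpha> \<beta> \<gamma> \<delta> where w: "\<forall>l\<in>set w. valid l" "\<alpha> * \<delta> - \<beta> * \<gamma> \<noteq> 0" "\<phi> = weval w (lin \<alpha> \<beta> \<gamma> \<delta>)"
    using assms(1) unfolding tame_def by blast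
  have "\<exists>v. (\<forall>l\<in>set v. valid l) \<and> comp2 (lin \<alpha> \<beta> \<gamma> \<delta>) (upmap k a) = weval v (lin \<alpha> \<beta> \<gamma> \<delta>)"
  proof (cases "\<alpha> = 0")
    case True
    \<comment> \<open>The first component is \<beta> y here, so the additional term \<gamma> k y^a
      of the second is a polynomial in the first: one \<open>Lo\<close> letter.\<close>
    then have \<beta>: "\<beta> \<noteq> 0" using w(2) by auto
    then have "\<gamma> * k = (\<gamma> * k / \<beta> ^ a) * \<beta> ^ a" by simp
    then have q: "const2 \<gamma> * const2 k = const2 (\<gamma> * k / \<beta> ^ a) * const2 \<beta> ^ a" by (metis const2_simps(2,4))
    then have "comp2 (lin \<alpha> \<beta> \<gamma> \<delta>) (upmap k a) = weval [Lo (monom (\<gamma> * k / \<beta> ^ a) a)] (lin \<alpha> \<beta> \<gamma> \<delta>)"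
    proof -
      have "C * (X + K * Z) + D * Y = C * X + D * Y + E * (B * Z)" if "C * K = E * B" for B C D E K X Y Z :: "'a poly poly"
        using that by (simp add: distrib_left flip: mult.assoc)
      then show ?thesis
        using q by (simp only: True lin_def upmap_def comp2_def fst_conv snd_conv subst2_simps weval_simps act.simps
          papp_monom power_mult_distrib const2_0_1 mult_zero_left add_0)
    qed
    then show ?thesis using a by (intro exI[of _ "[Lo (monom (\<gamma> * k / \<beta> ^ a) a)]"]) simp
  next
    case \<alpha>: False
    \<comment> \<open>Subtracting s times the first component reduces the second to D y, where D is
      the determinant divided by \<alpha>. Then an \<open>Up\<close> letter can add k \<alpha> y^a
      to the first component, and the subtraction is undone.\<close>
    define s D where "s = \<gamma> / \<alpha>" and "D = \<delta> - s * \<beta>"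
    have \<gamma>: "\<gamma> = s * \<alpha>" and \<delta>: "\<delta> = D + s * \<beta>" using \<alpha> by (simp_all add: s_def D_def)
    have "\<alpha> * D \<noteq> 0" using w(2) \<alpha> by (simp add: D_def s_def field_simps)
    then have D: "D \<noteq> 0" by simp
    let ?q = "monom (k * \<alpha> / D ^ a) a"
    have "k * \<alpha> = (k * \<alpha> / D ^ a) * D ^ a" using D by simp
    then have q: "const2 (k * \<alpha> / D ^ a) * const2 D ^ a = const2 k * const2 \<alpha>" by (metis const2_simps(2,4))
    have 1: "act (Lo [:0, - s:]) (lin \<alpha> \<beta> \<gamma> \<delta>) = (const2 \<alpha> * varX + const2 \<beta> * varY, const2 D * varY)"
    proof -
      have "S * A * X + (D + S * B) * Y + (- S) * (A * X + B * Y) = D * Y" for A B D S X Y :: "'a poly poly"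
        by (simp add: algebra_simps)
      then show ?thesis unfolding lin_def act.simps papp_linear \<gamma> \<delta> const2_simps by (simp only:)
    qed
    have 2: "act (Up ?q) (const2 \<alpha> * varX + const2 \<beta> * varY, const2 D * varY) =
        (const2 \<alpha> * varX + const2 \<beta> * varY + const2 k * const2 \<alpha> * varY ^ a, const2 D * varY)"
      unfolding act.simps papp_monom power_mult_distrib mult.assoc[symmetric] q ..
    have 3: "act (Lo [:0, s:]) (const2 \<alpha> * varX + const2 \<beta> * varY + const2 k * const2 \<alpha> * varY ^ a, const2 D * varY) =
        comp2 (lin \<alpha> \<beta> \<gamma> \<delta>) (upmap k a)"
    proof -
      have "A * X + B * Y + K * A * Z = A * (X + K * Z) + B * Y"
        "D * Y + S * (A * X + B * Y + K * A * Z) = S * A * (X + K * Z) + (D + S * B) * Y"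
        for A B D K S X Y Z :: "'a poly poly"
        by (simp_all add: algebra_simps)
      then show ?thesis
        unfolding lin_def upmap_def comp2_def act.simps papp_linear fst_conv snd_conv subst2_simps \<gamma> \<delta> const2_simps
        by (simp only:)
    qed
    have "comp2 (lin \<alpha> \<beta> \<gamma> \<delta>) (upmap k a) = weval [Lo [:0, s:], Up ?q, Lo [:0, - s:]] (lin \<alpha> \<beta> \<gamma> \<delta>)"
      by (simp only: weval_simps 1 2 3)
    then show ?thesis using a by (intro exI[of _ "[Lo [:0, s:], Up ?q, Lo [:0, - s:]]"]) simp
  qed
  then obtain v where v: "\<forall>l\<in>set v. valid l" "comp2 (lin \<alpha> \<beta> \<gamma> \<delta>) (upmap k a) = weval v (lin \<alpha> \<beta> \<gamma> \<delta>)" by blast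
  have "comp2 \<phi> (upmap k a) = weval (w @ v) (lin \<alpha> \<beta> \<gamma> \<delta>)"
    unfolding w(3) comp2_weval v(2) weval_append ..
  then show ?thesis unfolding tame_def using w v by (intro exI[of _ "w @ v"]) auto
qed

section \<open>The theorem of Jung and van der Kulk\<close>

text \<open>The translation (u, v) |-> (u, v + T) conjugated by \<phi>, that is \<psi> evaluated at
  (f, g + T). It fixes f and moves g to g + T, so it is not constant in T.\<close>

lemma automorphism_flow:
  assumes inv: "comp2 \<psi> \<phi> = id2" "comp2 \<phi> \<psi> = id2"
  shows "\<exists>P Q. invariant_flow (fst \<phi>) P Q"
proof -
  let ?f = "fst \<phi>" and ?g = "snd \<phi>"
  define P where "P = ev2 const3 (fst \<psi>) [:?f:] [:?g, 1:]"
  define Q where "Q = ev2 const3 (snd \<psi>) [:?f:] [:?g, 1:]"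
  have h: "comm_ring_hom const3" by simp
  have p0: "comm_ring_hom (\<lambda>p :: 'a poly poly poly. poly p 0)" by (rule comm_ring_homI) simp_all
  have at0: "poly (ev2 const3 p [:?f:] [:?g, 1:]) 0 = subst2 p \<phi>" for p
    by (subst ev2_hom[OF h p0]) (simp add: subst2_ev2)
  have "subst2 (fst \<psi>) \<phi> = varX" "subst2 (snd \<psi>) \<phi> = varY"
    using inv(1) by (simp_all add: comp2_def)
  then have 0: "poly P 0 = varX" "poly Q 0 = varY" by (simp_all add: P_def Q_def at0)
  have "subst2 ?f \<psi> = varX" "subst2 ?g \<psi> = varY" using inv(2) by (simp_all add: comp2_def)
  then have f: "ev2 const3 ?f P Q = [:?f:]" and g: "ev2 const3 ?g P Q = [:?g, 1:]"
    unfolding P_def Q_def by (simp_all flip: ev2_subst2[OF h])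
  have "0 < degree P \<or> 0 < degree Q"
  proof (rule ccontr)
    assume "\<not> ?thesis"
    then have "P = [:varX:]" "Q = [:varY:]" using degree_0_const[of P] degree_0_const[of Q] 0 by simp_all
    then have "ev2 const3 ?g P Q = [:ev2 const2 ?g varX varY:]"
      using ev2_hom[of const2 "\<lambda>p. [:p:]" ?g varX varY] by simp
    then show False using g by (simp add: ev2_self)
  qed
  then show ?thesis using 0 f unfolding invariant_flow_def by blast
qed

section \<open>Weight bounds and the reduction step\<close>

lemma cf_mult: "cf (p * q) k l = (\<Sum>j\<le>l. \<Sum>i\<le>k. cf p i j * cf q (k - i) (l - j))"
  by (simp add: coeff_mult coeff_sum)

definition weight_le :: "nat \<Rightarrow> nat \<Rightarrow> 'k::field poly poly \<Rightarrow> bool" where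
  "weight_le a N p \<longleftrightarrow> (\<forall>k l. cf p k l \<noteq> 0 \<longrightarrow> a * k + l \<le> N)"

lemma weight_le_mult:
  assumes "weight_le a M p" "weight_le a N q"
  shows "weight_le a (M + N) (p * q)"
  unfolding weight_le_def
proof (intro allI impI)
  fix k l assume "cf (p * q) k l \<noteq> 0"
  then obtain j where j: "j \<le> l" "(\<Sum>i\<le>k. cf p i j * cf q (k - i) (l - j)) \<noteq> 0"
    unfolding cf_mult by (metis (mono_tags, lifting) atMost_iff sum.neutral)
  then obtain i where i: "i \<le> k" "cf p i j * cf q (k - i) (l - j) \<noteq> 0"
    by (metis (mono_tags, lifting) atMost_iff sum.neutral)
  then have "a * i + j \<le> M" "a * (k - i) + (l - j) \<le> N" using assms by (auto simp: weight_le_def)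
  moreover have "a * k = a * i + a * (k - i)" using i by (simp flip: add_mult_distrib2)
  ultimately show "a * k + l \<le> M + N" using j by linarith
qed

lemma weight_le_power: "weight_le a M p \<Longrightarrow> weight_le a (n * M) (p ^ n)"
proof (induction n)
  case 0
  then show ?case by (auto simp: weight_le_def one_pCons coeff_pCons split: nat.splits)
next
  case (Suc n)
  then show ?case using weight_le_mult[of a M p "n * M" "p ^ n"] by simp
qed

lemma weight_le_sum: "(\<And>i. i \<in> I \<Longrightarrow> weight_le a N (F i)) \<Longrightarrow> weight_le a N (\<Sum>i\<in>I. F i)"
  unfolding weight_le_def coeff_sum by (metis (mono_tags, lifting) sum.neutral)

lemma weight_le_mono: "weight_le a M p \<Longrightarrow> M \<le> N \<Longrightarrow> weight_le a N p"
  unfolding weight_le_def by (meson le_trans)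

text \<open>x and y^a have equal weight, so the substitution respects the weight bound a n. Within
  this bound only y^(a n) reaches y-degree a n, and its coefficient is the sum in
  \<open>root\<close>.\<close>

lemma upmap_reduces:
  fixes f :: "'k::field poly poly"
  assumes a: "0 < a" and n: "0 < n" and wt: "weight_le a (a * n) f"
    and root: "(\<Sum>m\<le>n. cf f m (a * (n - m)) * c ^ m) = 0"
    and kl: "(k, l) \<in> supp2 (subst2 f (upmap c a))"
  shows "k \<le> n \<and> l < a * n"
proof -
  let ?F = "subst2 f (upmap c a)"
  have F: "?F = (\<Sum>(k, l)\<in>supp2 f. const2 (cf f k l) * (varX + const2 c * varY ^ a) ^ k * varY ^ l)"
    unfolding subst2_ev2 upmap_def fst_conv snd_conv by (rule ev2_sum) simp_all
  have "weight_le a (a * n) ?F"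
    unfolding F
  proof (rule weight_le_sum)
    fix t assume t: "t \<in> supp2 f"
    obtain i j where ij: "t = (i, j)" by (cases t)
    have "varX + const2 c * varY ^ a = monom (monom 1 1) 0 + monom (monom c 0) a"
      using monom2[of "1 :: 'k" 1 0] monom2[of c 0 a]
      by (simp only: const2_0_1 power_one_right power_0 mult_1_left mult_1_right)
    then have 1: "weight_le a a (varX + const2 c * varY ^ a)"
      by (auto simp: weight_le_def split: if_splits)
    have 2: "weight_le a 1 (varY :: 'k poly poly)"
      by (auto simp: weight_le_def varY_def coeff_pCons split: nat.splits)
    have 3: "weight_le a 0 (const2 (cf f i j))"
      by (auto simp: weight_le_def coeff_pCons split: nat.splits)
    have "weight_le a (0 + i * a + j * 1) (const2 (cf f i j) * (varX + const2 c * varY ^ a) ^ i * varY ^ j)"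
      by (intro weight_le_mult weight_le_power 1 2 3)
    moreover have "a * i + j \<le> a * n" using wt t ij by (auto simp: weight_le_def supp2_def)
    then have "0 + i * a + j * 1 \<le> a * n" by (simp add: mult.commute)
    ultimately show "weight_le a (a * n) (case t of (k, l) \<Rightarrow> const2 (cf f k l) * (varX + const2 c * varY ^ a) ^ k * varY ^ l)"
      unfolding ij prod.case by (rule weight_le_mono)
  qed
  then have le: "a * k + l \<le> a * n" using kl by (auto simp: weight_le_def supp2_def)
  have "\<not> (k = 0 \<and> l = a * n)"
  proof
    assume *: "k = 0 \<and> l = a * n"
    define y where "y = ([:0, 1:] :: 'k poly)"
    have h1: "comm_ring_hom (\<lambda>c::'k. [:c:])" by simp
    \<comment> \<open>Setting x = 0 isolates the coefficients of the pure powers of y.\<close>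
    have cf0: "cf p 0 l = coeff (ev2 (\<lambda>c. [:c:]) p 0 y) l" for p l
    proof -
      interpret comm_ring_hom "\<lambda>c::'k. [:c:]" by simp
      have "(\<lambda>q. poly (map_poly (\<lambda>c. [:c:]) q) 0) = (\<lambda>q :: 'k poly. [:coeff q 0:])"
        by (rule ext) (simp add: poly_0_coeff_0)
      then have "ev2 (\<lambda>c. [:c:]) p 0 y = map_poly (\<lambda>q. coeff q 0) p \<circ>\<^sub>p y"
        unfolding ev2_def pcompose_altdef by (simp add: map_poly_map_poly o_def)
      also have "\<dots> = map_poly (\<lambda>q. coeff q 0) p" unfolding y_def by (rule pcompose_idR)
      finally show ?thesis by (simp add: coeff_map_poly)
    qed
    have "ev2 (\<lambda>c. [:c:]) ?F 0 y = ev2 (\<lambda>c. [:c:]) f (monom c a) y"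
    proof -
      have "ev2 (\<lambda>c. [:c:]) (varX + const2 c * varY ^ a) 0 y = [:c:] * y ^ a"
      proof -
        interpret comm_ring_hom "\<lambda>p. ev2 (\<lambda>c. [:c:]) p 0 y" by (rule comm_ring_hom_ev2[OF h1])
        show ?thesis by (simp only: hom_add hom_mult hom_power ev2_simps[OF h1] add_0)
      qed
      then show ?thesis by (simp add: ev2_subst2 upmap_def y_def monom_altdef)
    qed
    also have "\<dots> = (\<Sum>(i, j)\<in>supp2 f. monom (cf f i j * c ^ i) (a * i + j))"
    proof -
      have "[:d:] * monom c a ^ i * y ^ j = monom (d * c ^ i) (a * i + j)" for d i j
      proof -
        have "y ^ j = monom 1 j" by (simp add: y_def monom_altdef)
        then show ?thesis by (simp add: monom_power mult_monom smult_monom mult.commute add.commute)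
      qed
      then show ?thesis by (subst ev2_sum[OF h1 subset_refl]) (auto simp: case_prod_unfold)
    qed
    finally have "cf ?F 0 (a * n) = (\<Sum>(i, j)\<in>supp2 f. if a * i + j = a * n then cf f i j * c ^ i else 0)"
      unfolding cf0[of ?F] by (simp add: coeff_sum case_prod_unfold)
    also have "\<dots> = (\<Sum>(i, j)\<in>{t \<in> supp2 f. a * fst t + snd t = a * n}. cf f i j * c ^ i)"
      by (rule sum.mono_neutral_cong_right) (auto split: if_splits)
    also have "\<dots> = (\<Sum>(i, j)\<in>(\<lambda>m. (m, a * (n - m))) ` {..n}. cf f i j * c ^ i)"
    proof (rule sum.mono_neutral_left)
      show "{t \<in> supp2 f. a * fst t + snd t = a * n} \<subseteq> (\<lambda>m. (m, a * (n - m))) ` {..n}"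
      proof (clarsimp)
        fix i j assume "a * i + j = a * n"
        moreover from this have "a * i \<le> a * n" by linarith
        then have "i \<le> n" using a by simp
        ultimately show "(i, j) \<in> (\<lambda>m. (m, a * (n - m))) ` {..n}"
          by (intro image_eqI[of _ _ i]) (auto simp: diff_mult_distrib2)
      qed
      show "\<forall>t\<in>(\<lambda>m. (m, a * (n - m))) ` {..n} - {t \<in> supp2 f. a * fst t + snd t = a * n}. (case t of (i, j) \<Rightarrow> cf f i j * c ^ i) = 0"
        by (auto simp: supp2_def simp flip: add_mult_distrib2)
    qed simp
    also have "\<dots> = (\<Sum>m\<le>n. cf f m (a * (n - m)) * c ^ m)"
      by (subst sum.reindex) (auto simp: inj_on_def)
    also have "\<dots> = 0" by (rule root)
    finally show False using kl * by (simp add: supp2_def)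
  qed
  moreover have "k \<le> n"
  proof -
    have "a * k \<le> a * n" using le by linarith
    then show ?thesis using a by simp
  qed
  moreover have "l < a * n" if "k > 0 \<or> l \<noteq> a * n"
    using that le a by (cases "k > 0") (auto intro: le_neq_implies_less less_le_trans[of l "a * k + l"])
  ultimately show ?thesis by auto
qed

text \<open>With weight j for x and i for y, the corners (i, 0) and (0, j) of the box both have
  weight i j. The leading form inherits a flow, and \<open>invariant_quasihomogeneous\<close> shows
  that no larger weight occurs, so the support stays below the diagonal of the box.\<close>

lemma leading_reduction:
  fixes \<phi> :: "'k::field plane_map"
  assumes \<phi>: "\<phi> \<in> carrier Aut_plane" and ij: "0 < i" "0 < j"
    and box: "\<And>k l. (k, l) \<in> supp2 (fst \<phi>) \<Longrightarrow> k \<le> i \<and> l \<le> j"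
    and tight: "(i, l') \<in> supp2 (fst \<phi>)" "(k', j) \<in> supp2 (fst \<phi>)"
  shows "\<exists>a b n c. i = b * n \<and> j = a * n \<and> (a = 1 \<or> b = 1) \<and> c \<noteq> 0 \<and>
    (\<forall>k l. (k, l) \<in> supp2 (fst \<phi>) \<longrightarrow> j * k + i * l \<le> i * j) \<and>
    (\<Sum>m\<le>n. cf (fst \<phi>) (b * m) (a * (n - m)) * c ^ m) = 0"
proof -
  let ?f = "fst \<phi>"
  let ?w = "\<lambda>t. j * fst t + i * snd t"
  obtain s where s: "s \<in> supp2 ?f" "\<And>t. t \<in> supp2 ?f \<Longrightarrow> ?w t \<le> ?w s"
    by (rule ex_maximal_value[of "supp2 ?f" ?w, OF finite_supp2]) (use tight in blast)+
  define W where "W = ?w s"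
  have W: "j * k + i * l \<le> W" if "(k, l) \<in> supp2 ?f" for k l using s(2)[OF that] by (simp add: W_def)
  define h where "h = leading_form j i W ?f"
  have supp_h: "(k, l) \<in> supp2 h \<longleftrightarrow> (k, l) \<in> supp2 ?f \<and> j * k + i * l = W" for k l
    by (auto simp: supp2_def h_def cf_leading_form)
  obtain \<psi> where "comp2 \<psi> \<phi> = id2" "comp2 \<phi> \<psi> = id2" using \<phi> unfolding carrier_Aut_plane by blast
  then obtain P Q where "invariant_flow ?f P Q" using automorphism_flow by blast
  then have flow: "\<exists>P Q. invariant_flow h P Q"
    unfolding h_def by (rule invariant_flow_leading_form) (rule W)
  have "(fst s, snd s) \<in> supp2 h" unfolding supp_h using s(1) by (simp add: W_def)
  then have h0: "h \<noteq> 0" by (auto simp: supp2_def)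
  have Wij: "i * j \<le> W" using W[OF tight(1)] by (simp add: mult.commute)
  have line: "j * k + i * l = W \<and> k \<le> i \<and> l \<le> j" if "(k, l) \<in> supp2 h" for k l
    using that box[of k l] unfolding supp_h by simp
  \<comment> \<open>If no weight exceeds i j, the support points with k = i or l = j can only be the
    corners.\<close>
  have ends: "(i, 0) \<in> supp2 h \<and> (0, j) \<in> supp2 h" if "W = i * j"
  proof -
    have "l' = 0" using W[OF tight(1)] ij that by (simp add: mult.commute)
    moreover have "k' = 0" using W[OF tight(2)] ij that by (simp add: mult.commute)
    ultimately show ?thesis using tight that by (simp add: supp_h mult.commute)
  qed
  obtain a b n c where abn: "i = b * n" "j = a * n" "a = 1 \<or> b = 1" "c \<noteq> 0" "W = i * j"
      "(\<Sum>m\<le>n. cf h (b * m) (a * (n - m)) * c ^ m) = 0"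
    using invariant_quasihomogeneous[OF flow h0 ij Wij line ends] by auto
  have "cf h (b * m) (a * (n - m)) = cf ?f (b * m) (a * (n - m))" if "m \<le> n" for m
  proof -
    have "j * (b * m) + i * (a * (n - m)) = a * b * n * (m + (n - m))"
      unfolding abn(1,2) by (simp add: algebra_simps)
    also have "\<dots> = W" using that by (simp add: abn algebra_simps)
    finally show ?thesis by (simp add: h_def cf_leading_form)
  qed
  then have "(\<Sum>m\<le>n. cf ?f (b * m) (a * (n - m)) * c ^ m) = 0"
    using abn(6) by simp
  then show ?thesis using abn(1-4) W unfolding abn(5)
    by (intro exI[of _ a] exI[of _ b] exI[of _ n] exI[of _ c]) blast
qed

definition swap2 :: "'k::field plane_map" where "swap2 = (varY, varX)"

lemma swap2_lin: "swap2 = lin 0 1 1 0"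
  by (simp only: swap2_def lin_def const2_0_1 mult_zero_left mult_1_left add_0 add_0_right)

lemma swap2_swap2: "comp2 swap2 swap2 = id2"
  by (simp add: comp2_def swap2_def)

lemma comp2_swap2_swap2 [simp]: "comp2 (comp2 \<phi> swap2) swap2 = \<phi>"
  by (simp only: comp2_assoc swap2_swap2 comp2_id)

lemma cf_swap2: "cf (subst2 f swap2) k l = cf f l k"
proof -
  have "subst2 f swap2 = (\<Sum>(k, l)\<in>supp2 f. const2 (cf f k l) * varY ^ k * varX ^ l)"
    unfolding subst2_ev2 swap2_def fst_conv snd_conv by (rule ev2_sum) simp_all
  also have "\<dots> = (\<Sum>(k, l)\<in>supp2 f. monom (monom (cf f k l) l) k)"
    by (simp only: monom2[symmetric] mult.assoc mult.commute[of "varY ^ _"])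
  finally have "cf (subst2 f swap2) k l = (\<Sum>t\<in>supp2 f. if t = (l, k) then cf f l k else 0)"
    by (simp only: coeff_sum) (intro sum.cong refl, auto split: if_splits)
  also have "\<dots> = (if (l, k) \<in> supp2 f then cf f l k else 0)" by (rule sum.delta[OF finite_supp2])
  finally show ?thesis by (auto simp: supp2_def)
qed

lemma comp2_swap2_in_Aut0:
  assumes "\<phi> \<in> carrier Aut0_plane" shows "comp2 \<phi> swap2 \<in> carrier Aut0_plane"
proof (rule comp2_in_Aut0_plane[OF assms])
  have "comp2 swap2 swap2 = (id2 :: 'a plane_map)" by (simp add: comp2_def swap2_def)
  then have "swap2 \<in> carrier (Aut_plane :: 'a plane_map monoid)" unfolding carrier_Aut_plane by blast
  then show "swap2 \<in> carrier (Aut0_plane :: 'a plane_map monoid)"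
    by (simp add: carrier_Aut0_plane swap2_def)
qed

lemma upmap_weval: "upmap c a = weval [Up (monom c a)] id2"
  by (simp add: upmap_def papp_monom)

lemma comp2_upmap_in_Aut0:
  assumes "\<phi> \<in> carrier Aut0_plane" "0 < a" shows "comp2 \<phi> (upmap c a) \<in> carrier Aut0_plane"
proof (rule comp2_in_Aut0_plane[OF assms(1)])
  have "upmap c a \<in> carrier Aut_plane" unfolding upmap_weval by (rule weval_in_Aut_plane)
  then show "upmap c a \<in> carrier Aut0_plane"
    using assms(2) by (simp add: carrier_Aut0_plane upmap_weval cf_0_papp poly_monom power_0_left)
qed

lemma comp2_upmap_inverse: "comp2 (comp2 \<phi> (upmap c a)) (upmap (- c) a) = \<phi>"
proof -
  have "comp2 (upmap c a) (upmap (- c) a) = id2"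
  proof -
    have "X + - C * Z + C * Z = X" for C X Z :: "'a poly poly" by simp
    then show ?thesis by (simp only: upmap_def comp2_def fst_conv snd_conv subst2_simps const2_simps)
  qed
  then show ?thesis by (simp add: comp2_assoc)
qed

section \<open>Automorphisms whose first component depends on x alone\<close>

lemma poly_map_const_pcompose: "poly (map_poly (\<lambda>q. [:F q:]) p) g = map_poly F p \<circ>\<^sub>p g" if "F 0 = 0"
  unfolding pcompose_altdef using that by (simp add: map_poly_map_poly o_def)

lemma papp_const: "papp P [:q:] = [:P \<circ>\<^sub>p q:]"
proof -
  have h: "comm_ring_hom (\<lambda>q :: 'a poly. [:q:])" by simp
  interpret comm_ring_hom "\<lambda>q :: 'a poly. [:q:]" by (rule h)
  show ?thesis
    by (induction P) (simp_all add: papp_poly map_poly_pCons_0 pcompose_pCons)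
qed

lemma degree_1E:
  assumes "degree p = 1"
  obtains a b where "p = [:a, b:]" "b \<noteq> 0"
proof -
  obtain a q where p: "p = pCons a q" by (cases p)
  then have "q \<noteq> 0" "degree q = 0" using assms by (auto split: if_splits)
  then obtain b where "q = [:b:]" using degree_eq_zeroE by blast
  then show thesis using that p \<open>q \<noteq> 0\<close> by simp
qed

text \<open>As the first component is p(x), substituting \<phi> multiplies y-degrees by that of g.
  The inverse thus forces g to be linear in y with constant leading coefficient, and p to be linear;
  \<phi> is a \<open>Lo\<close> letter applied to a diagonal map.\<close>

lemma tame_if_fst_in_x:
  fixes \<phi> :: "'k::field plane_map"
  assumes \<phi>: "\<phi> \<in> carrier Aut0_plane" and deg: "degree (fst \<phi>) = 0"
  shows "tame \<phi>"
proof -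
  obtain p where p: "fst \<phi> = [:p:]" using deg degree_eq_zeroE by blast
  let ?g = "snd \<phi>"
  obtain \<psi> where \<psi>: "comp2 \<psi> \<phi> = id2" "comp2 \<phi> \<psi> = id2"
    using \<phi> by (auto simp: carrier_Aut0_plane carrier_Aut_plane)
  let ?h = "\<lambda>q. q \<circ>\<^sub>p p"
  have sub: "subst2 q \<phi> = map_poly ?h q \<circ>\<^sub>p ?g" for q
  proof -
    have "subst2 q \<phi> = poly (map_poly (\<lambda>q. papp q [:p:]) q) ?g"
      unfolding subst2_def p papp_poly ..
    then show ?thesis by (simp add: papp_const poly_map_const_pcompose)
  qed
  have p0: "coeff p 0 = 0" using \<phi> p by (simp add: carrier_Aut0_plane)
  have "fst \<phi> \<noteq> 0"
  proof
    assume "fst \<phi> = 0"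
    then have "fst (comp2 \<phi> \<psi>) = 0" by (simp add: comp2_def)
    then show False using \<psi>(2) by simp
  qed
  then have "p \<noteq> 0" by (simp add: p)
  have degp: "0 < degree p"
  proof (rule ccontr)
    assume "\<not> 0 < degree p"
    then have "degree p = 0" by simp
    then obtain a where "p = [:a:]" by (rule degree_eq_zeroE)
    then show False using p0 \<open>p \<noteq> 0\<close> by simp
  qed
  have inj: "?h q = 0 \<longleftrightarrow> q = 0" for q using pcompose_eq_0[of q p] degp by auto
  have degh: "degree (map_poly ?h q) = degree q" for q :: "'k poly poly"
    by (rule degree_map_poly) (simp add: inj)
  have X: "map_poly ?h (fst \<psi>) \<circ>\<^sub>p ?g = varX" and Y: "map_poly ?h (snd \<psi>) \<circ>\<^sub>p ?g = varY"
    using \<psi>(1) by (simp_all add: comp2_def sub[symmetric])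
  have "degree (snd \<psi>) * degree ?g = 1"
    using arg_cong[OF Y, of degree] by (simp add: degh varY_def)
  then have dg: "degree ?g = 1" and dY: "degree (snd \<psi>) = 1" by simp_all
  have "degree (fst \<psi>) * degree ?g = 0"
    using arg_cong[OF X, of degree] by (simp add: degh varX_def)
  then have "degree (fst \<psi>) = 0" using dg by simp
  then obtain X0 where "fst \<psi> = [:X0:]" using degree_eq_zeroE by blast
  then have "X0 \<circ>\<^sub>p p = [:0, 1:]" using X by (simp add: map_poly_pCons_0 varX_def)
  from arg_cong[OF this, of degree] have "degree X0 * degree p = 1" by simp
  then have "degree p = 1" by simp
  then obtain a c where "p = [:a, c:]" "c \<noteq> 0" by (rule degree_1E)
  then have c: "p = [:0, c:]" "c \<noteq> 0" using p0 by simp_all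
  obtain g0 g1 where g: "?g = [:g0, g1:]" using dg by (rule degree_1E)
  obtain Y0 Y1 where YY: "snd \<psi> = [:Y0, Y1:]" using dY by (rule degree_1E)
  have g1: "g1 * ?h Y1 = 1"
    using arg_cong[OF Y, of "\<lambda>q. coeff q 1"] by (simp add: YY g map_poly_pCons_0 pcompose_pCons varY_def mult.commute)
  then have "g1 \<noteq> 0" "?h Y1 \<noteq> 0" by auto
  then have "degree g1 = 0" using arg_cong[OF g1, of degree] degree_mult_eq[of g1 "?h Y1"] by simp
  then obtain d where d: "g1 = [:d:]" using degree_eq_zeroE by blast
  then have d0: "d \<noteq> 0" using \<open>g1 \<noteq> 0\<close> by auto
  have g00: "coeff g0 0 = 0" using \<phi> g by (simp add: carrier_Aut0_plane)
  \<comment> \<open>The letter acts on the first component c x, so R must satisfy R(c x) =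
    g0(x).\<close>
  define R where "R = g0 \<circ>\<^sub>p [:0, 1 / c:]"
  have "R \<circ>\<^sub>p [:0, c:] = g0 \<circ>\<^sub>p ([:0, 1 / c:] \<circ>\<^sub>p [:0, c:])" by (simp only: R_def pcompose_assoc)
  also have "[:0, 1 / c:] \<circ>\<^sub>p [:0, c:] = [:0, 1:]" using c by (simp add: pcompose_pCons)
  finally have R: "R \<circ>\<^sub>p [:0, c:] = g0" by (simp only: pcompose_idR)
  have "lin c 0 0 d = ([:[:0, c:]:], [:0, [:d:]:])"
    by (simp add: lin_def varX_def varY_def)
  then have "weval [Lo R] (lin c 0 0 d) = ([:[:0, c:]:], [:0, [:d:]:] + papp R [:[:0, c:]:])"
    by (simp only: weval_simps act.simps)
  then have "weval [Lo R] (lin c 0 0 d) = ([:p:], ?g)"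
    by (simp add: papp_const R g d c)
  then have "weval [Lo R] (lin c 0 0 d) = \<phi>" using p by (metis prod.collapse)
  moreover have "coeff R 0 = 0" using g00 by (simp add: R_def coeff_pcompose_0 poly_0_coeff_0)
  ultimately show ?thesis
    unfolding tame_def using c d0 by (intro exI[of _ "[Lo R]"] exI[of _ c] exI[of _ 0] exI[of _ d]) simp
qed

lemma degree_eq_0_if_supp2:
  assumes "\<And>k l. (k, l) \<in> supp2 p \<Longrightarrow> l = 0"
  shows "degree p = 0"
proof (rule ccontr)
  assume deg: "degree p \<noteq> 0"
  then have "coeff p (degree p) \<noteq> 0" by auto
  then obtain k where "cf p k (degree p) \<noteq> 0" unfolding poly_eq_iff by auto
  then have "(k, degree p) \<in> supp2 p" by (simp add: supp2_def)
  from assms[OF this] show False using deg by simp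
qed

text \<open>Induction over any box around the support instead of the exact degrees: it suffices to
  shrink one side, and exchanging x and y just exchanges the sides.\<close>

theorem jung_van_der_kulk_bounded:
  fixes \<phi> :: "'k::field plane_map"
  assumes "\<phi> \<in> carrier Aut0_plane" "\<And>k l. (k, l) \<in> supp2 (fst \<phi>) \<Longrightarrow> k \<le> i \<and> l \<le> j"
  shows "tame \<phi>"
  using assms
proof (induction "i + j" arbitrary: \<phi> i j rule: less_induct)
  case less
  note \<phi> = less.prems(1) and box = less.prems(2)
  have swap: "tame \<phi>" if "tame (comp2 \<phi> swap2)" for \<phi> :: "'k plane_map"
    using tame_comp_lin[OF that, of 0 0 1 1] by (simp add: swap2_lin[symmetric])
  show ?case
  proof (cases "i = 0 \<or> j = 0")
    case True
    then show ?thesis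
    proof
      assume "j = 0"
      have "degree (fst \<phi>) = 0"
        by (rule degree_eq_0_if_supp2) (use box \<open>j = 0\<close> in simp)
      then show ?thesis by (rule tame_if_fst_in_x[OF \<phi>])
    next
      assume "i = 0"
      have "degree (fst (comp2 \<phi> swap2)) = 0"
      proof (rule degree_eq_0_if_supp2)
        fix k l assume "(k, l) \<in> supp2 (fst (comp2 \<phi> swap2))"
        then have "(l, k) \<in> supp2 (fst \<phi>)" by (simp add: supp2_def cf_swap2)
        then show "l = 0" using box[of l k] \<open>i = 0\<close> by simp
      qed
      then show ?thesis by (rule swap[OF tame_if_fst_in_x[OF comp2_swap2_in_Aut0[OF \<phi>]]])
    qed
  next
    case False
    then have ij: "0 < i" "0 < j" by simp_all
    show ?thesis
    proof (cases "(\<exists>l. (i, l) \<in> supp2 (fst \<phi>)) \<and> (\<exists>k. (k, j) \<in> supp2 (fst \<phi>))")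
      case False
      then show ?thesis
      proof (cases "\<exists>l. (i, l) \<in> supp2 (fst \<phi>)")
        case True
        show ?thesis
        proof (rule less.hyps[of i "j - 1"])
          fix k l assume kl: "(k, l) \<in> supp2 (fst \<phi>)"
          then have "l \<noteq> j" using True False by blast
          then show "k \<le> i \<and> l \<le> j - 1" using box[OF kl] by linarith
        qed (use ij \<phi> in simp_all)
      next
        case no: False
        show ?thesis
        proof (rule less.hyps[of "i - 1" j])
          fix k l assume kl: "(k, l) \<in> supp2 (fst \<phi>)"
          then have "k \<noteq> i" using no by blast
          then show "k \<le> i - 1 \<and> l \<le> j" using box[OF kl] by linarith
        qed (use ij \<phi> in simp_all)
      qed
    next
      case True
      then obtain k' l' where tight: "(i, l') \<in> supp2 (fst \<phi>)" "(k', j) \<in> supp2 (fst \<phi>)" by blast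
      have \<phi>': "\<phi> \<in> carrier Aut_plane" using \<phi> by (simp add: carrier_Aut0_plane)
    obtain a b n c where ab: "i = b * n" "j = a * n" "a = 1 \<or> b = 1" "c \<noteq> 0"
      and wt: "\<forall>k l. (k, l) \<in> supp2 (fst \<phi>) \<longrightarrow> j * k + i * l \<le> i * j"
      and root: "(\<Sum>m\<le>n. cf (fst \<phi>) (b * m) (a * (n - m)) * c ^ m) = 0"
      using leading_reduction[OF \<phi>' ij box tight] by auto
    have pos: "0 < a" "0 < b" "0 < n" using ij by (simp_all add: ab)
    have wt': "a * k + b * l \<le> a * b * n" if "(k, l) \<in> supp2 (fst \<phi>)" for k l
    proof -
      have "j * k + i * l \<le> i * j" using wt that by blast
      moreover have "n * (a * k + b * l) = j * k + i * l" "n * (a * b * n) = i * j"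
        by (simp_all add: ab(1,2) algebra_simps)
      ultimately have "n * (a * k + b * l) \<le> n * (a * b * n)" by simp
      then show ?thesis using pos by simp
    qed
    show ?thesis
    proof (cases "b = 1")
      case True
      let ?\<phi> = "comp2 \<phi> (upmap c a)"
      have "weight_le a (a * n) (fst \<phi>)"
        using wt' True unfolding weight_le_def supp2_def by simp
      then have red: "k \<le> n \<and> l < a * n" if "(k, l) \<in> supp2 (fst ?\<phi>)" for k l
        using upmap_reduces[OF pos(1,3), of "fst \<phi>" c k l] root True that by simp
      have "tame ?\<phi>"
      proof (rule less.hyps[of i "j - 1"])
        fix k l assume "(k, l) \<in> supp2 (fst ?\<phi>)"
        from red[OF this] have "k \<le> i" "l < j" using True ab by simp_all
        then show "k \<le> i \<and> l \<le> j - 1" by linarith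
      qed (use ij \<phi> pos comp2_upmap_in_Aut0 in simp_all)
      then have "tame (comp2 ?\<phi> (upmap (- c) a))" by (rule tame_comp_upmap) (use pos in simp)
      then show ?thesis by (simp only: comp2_upmap_inverse)
    next
      case False
      then have a1: "a = 1" using ab by simp
      let ?\<psi> = "comp2 \<phi> swap2"
      \<comment> \<open>Exchanging x and y reverses the coefficients of the binary form, which
        inverts its roots.\<close>
      let ?c = "1 / c"
      let ?\<phi> = "comp2 ?\<psi> (upmap ?c b)"
      have "weight_le b (b * n) (fst ?\<psi>)"
        using wt' a1 unfolding weight_le_def supp2_def by (simp add: cf_swap2 add.commute)
      moreover have "(\<Sum>m\<le>n. cf (fst ?\<psi>) m (b * (n - m)) * ?c ^ m) = 0"
      proof -
        have "c ^ n * (\<Sum>m\<le>n. cf (fst ?\<psi>) m (b * (n - m)) * ?c ^ m) = (\<Sum>m\<le>n. cf (fst \<phi>) (b * (n - m)) m * c ^ (n - m))"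
          unfolding sum_distrib_left
        proof (intro sum.cong refl)
          fix m assume "m \<in> {..n}"
          then have "c ^ n = c ^ (n - m) * c ^ m" by (simp flip: power_add)
          then show "c ^ n * (cf (fst ?\<psi>) m (b * (n - m)) * ?c ^ m) = cf (fst \<phi>) (b * (n - m)) m * c ^ (n - m)"
            using ab(4) by (simp add: cf_swap2 power_divide)
        qed
        also have "\<dots> = (\<Sum>m\<le>n. cf (fst \<phi>) (b * m) (a * (n - m)) * c ^ m)"
          by (rule sum.reindex_bij_witness[of _ "\<lambda>m. n - m" "\<lambda>m. n - m"]) (auto simp: a1)
        finally show ?thesis using root ab(4) by simp
      qed
      ultimately have red: "k \<le> n \<and> l < b * n" if "(k, l) \<in> supp2 (fst ?\<phi>)" for k l
        using upmap_reduces[OF pos(2,3), of "fst ?\<psi>" ?c k l] that by simp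
      have "tame ?\<phi>"
      proof (rule less.hyps[of j "i - 1"])
        fix k l assume "(k, l) \<in> supp2 (fst ?\<phi>)"
        from red[OF this] have "k \<le> j" "l < i" using a1 ab by simp_all
        then show "k \<le> j \<and> l \<le> i - 1" by linarith
      next
        show "?\<phi> \<in> carrier Aut0_plane" by (rule comp2_upmap_in_Aut0[OF comp2_swap2_in_Aut0[OF \<phi>] pos(2)])
        show "j + (i - 1) < i + j" using ij by simp
      qed
      then have "tame (comp2 ?\<phi> (upmap (- ?c) b))" by (rule tame_comp_upmap) (use pos in simp)
      then have "tame ?\<psi>" by (simp only: comp2_upmap_inverse)
      then show ?thesis by (rule swap)
    qed
    qed
  qed
qed

theorem jung_van_der_kulk:
  assumes "\<phi> \<in> carrier Aut0_plane"
  shows "tame \<phi>"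
proof -
  let ?S = "supp2 (fst \<phi>)"
  show ?thesis
  proof (rule jung_van_der_kulk_bounded[OF assms])
    fix k l assume kl: "(k, l) \<in> ?S"
    have "k \<le> Max (fst ` ?S)" "l \<le> Max (snd ` ?S)" using kl by (force intro: Max_ge)+
    then show "k \<le> Max (fst ` ?S) \<and> l \<le> Max (snd ` ?S)" by simp
  qed
qed

section \<open>The differential at the origin\<close>

lemma comm_ring_hom_cf_0: "comm_ring_hom (\<lambda>p. cf p 0 0)"
  unfolding cf_0_ev2 by (rule comm_ring_hom_ev2[OF comm_ring_hom_id])

lemma cf_0_deriv_papp:
  assumes "cf f 0 0 = 0"
  shows "cf (dX (papp P f)) 0 0 = coeff P 1 * cf (dX f) 0 0" "cf (dY (papp P f)) 0 0 = coeff P 1 * cf (dY f) 0 0"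
proof -
  interpret h: comm_ring_hom "\<lambda>p :: 'a poly poly. cf p 0 0" by (rule comm_ring_hom_cf_0)
  have eq: "papp P f = subst2 [:P:] (f, 0)" for P by (simp add: papp_def subst2_ev2)
  have d: "dX [:P:] = [:pderiv P:]" "dY [:P:] = 0" by (simp_all add: map_poly_pCons_0 pderiv_pCons)
  have "dX (papp P f) = papp (pderiv P) f * dX f" "dY (papp P f) = papp (pderiv P) f * dY f"
    unfolding eq dX_subst2 dY_subst2 d by simp_all
  moreover have "cf (papp (pderiv P) f) 0 0 = coeff P 1"
    using assms by (simp add: cf_0_papp poly_0_coeff_0 coeff_pderiv)
  ultimately show "cf (dX (papp P f)) 0 0 = coeff P 1 * cf (dX f) 0 0" "cf (dY (papp P f)) 0 0 = coeff P 1 * cf (dY f) 0 0"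
    by (simp_all add: h.hom_mult)
qed

text \<open>\<open>Up\<close> letters have no linear term, and \<open>Lo\<close> letters add a
  multiple of the first row of the differential to the second.\<close>

lemma weval_linear_part:
  assumes "\<forall>l\<in>set w. valid l" "cf (fst \<phi>) 0 0 = 0" "cf (snd \<phi>) 0 0 = 0"
  shows "cf (dX (fst (weval w \<phi>))) 0 0 = cf (dX (fst \<phi>)) 0 0 \<and> cf (dY (fst (weval w \<phi>))) 0 0 = cf (dY (fst \<phi>)) 0 0 \<and>
    (\<exists>s. cf (dX (snd (weval w \<phi>))) 0 0 = cf (dX (snd \<phi>)) 0 0 + s * cf (dX (fst \<phi>)) 0 0 \<and>
         cf (dY (snd (weval w \<phi>))) 0 0 = cf (dY (snd \<phi>)) 0 0 + s * cf (dY (fst \<phi>)) 0 0)"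
  using assms(1)
proof (induction w)
  case Nil
  then show ?case by (auto intro: exI[of _ 0])
next
  case (Cons l w)
  then have v: "valid l" "\<forall>l\<in>set w. valid l" by simp_all
  obtain f g where fg: "weval w \<phi> = (f, g)" by (cases "weval w \<phi>")
  have 0: "cf f 0 0 = 0" "cf g 0 0 = 0" using weval_origin[OF v(2) assms(2,3)] by (simp_all add: fg)
  obtain s where IH: "cf (dX f) 0 0 = cf (dX (fst \<phi>)) 0 0" "cf (dY f) 0 0 = cf (dY (fst \<phi>)) 0 0"
     "cf (dX g) 0 0 = cf (dX (snd \<phi>)) 0 0 + s * cf (dX (fst \<phi>)) 0 0"
     "cf (dY g) 0 0 = cf (dY (snd \<phi>)) 0 0 + s * cf (dY (fst \<phi>)) 0 0"
    using Cons.IH[OF v(2)] by (auto simp: fg)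
  show ?case
  proof (cases l)
    case (Lo P)
    then show ?thesis
      by (intro conjI exI[of _ "s + coeff P 1"])
         (simp_all add: fg IH dX_derivation dY_derivation cf_0_deriv_papp[OF 0(1)] algebra_simps)
  next
    case (Up Q)
    then have "coeff Q 1 = 0" using v(1) by simp
    then show ?thesis
      using Up by (intro conjI exI[of _ s])
         (simp_all add: fg IH dX_derivation dY_derivation cf_0_deriv_papp[OF 0(2)] algebra_simps)
  qed
qed

lemma diff_at_0_entries:
  "diff_at_0 \<phi> $$ (0, 0) = cf (dX (fst \<phi>)) 0 0" "diff_at_0 \<phi> $$ (0, 1) = cf (dY (fst \<phi>)) 0 0"
  "diff_at_0 \<phi> $$ (1, 0) = cf (dX (snd \<phi>)) 0 0" "diff_at_0 \<phi> $$ (1, 1) = cf (dY (snd \<phi>)) 0 0"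
  using carrier_matD[OF jacobian_mat_entries(1)[of \<phi>]]
  by (simp_all add: diff_at_0_def eval2_0)

lemma lin_deriv:
  "cf (dX (fst (lin a b c d))) 0 0 = a" "cf (dY (fst (lin a b c d))) 0 0 = b"
  "cf (dX (snd (lin a b c d))) 0 0 = c" "cf (dY (snd (lin a b c d))) 0 0 = d"
  "cf (fst (lin a b c d)) 0 0 = 0" "cf (snd (lin a b c d)) 0 0 = 0"
  by (simp_all add: lin_def varX_def varY_def map_poly_pCons_0 pderiv_pCons)

text \<open>By \<open>weval_linear_part\<close> the linear factor has first row (1, 0) and then last
  entry 1; being lower unipotent, it is a \<open>Lo\<close> letter itself.\<close>

theorem Aut_U_words:
  assumes "\<phi> \<in> carrier (Aut_plane_with U_mats)"
  shows "\<exists>w. (\<forall>l\<in>set w. valid l) \<and> \<phi> = weval w id2"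
proof -
  have \<phi>: "\<phi> \<in> carrier Aut0_plane" and U: "diff_at_0 \<phi> \<in> U_mats"
    using assms by (auto simp: Aut_plane_with_def)
  obtain w a b c d where w: "\<forall>l\<in>set w. valid l" "\<phi> = weval w (lin a b c d)"
    using jung_van_der_kulk[OF \<phi>] unfolding tame_def by blast
  obtain t where "diff_at_0 \<phi> = mat_of_rows_list 2 [[1, 0], [t, 1]]" using U by (auto simp: U_mats_def)
  then have diff: "diff_at_0 \<phi> $$ (0, 0) = 1" "diff_at_0 \<phi> $$ (0, 1) = 0" "diff_at_0 \<phi> $$ (1, 1) = 1"
    by (simp_all add: mat_of_rows_list_def)
  obtain s where "diff_at_0 \<phi> $$ (0, 0) = a" "diff_at_0 \<phi> $$ (0, 1) = b" "diff_at_0 \<phi> $$ (1, 1) = d + s * b"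
    using weval_linear_part[OF w(1), of "lin a b c d"] unfolding diff_at_0_entries w(2) by (auto simp: lin_deriv)
  then have abd: "a = 1" "b = 0" "d = 1" using diff by auto
  have "lin 1 0 c 1 = weval [Lo [:0, c:]] id2"
    by (simp only: lin_def weval_simps act.simps papp_linear const2_0_1 mult_zero_left mult_1_left add_0_right add.commute)
  then have "\<phi> = weval (w @ [Lo [:0, c:]]) id2" unfolding w(2) abd weval_append by simp
  then show ?thesis using w(1) by (intro exI[of _ "w @ [Lo [:0, c:]]"]) auto
qed

section \<open>Reduced words\<close>

fun is_up :: "'p letter \<Rightarrow> bool" where
  "is_up (Lo P) = False"
| "is_up (Up P) = True"

fun nonzero :: "'k::field poly letter \<Rightarrow> bool" where
  "nonzero (Lo P) \<longleftrightarrow> P \<noteq> 0"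
| "nonzero (Up P) \<longleftrightarrow> P \<noteq> 0"

text \<open>The last clause is a default value; \<open>merge_letter\<close> adds only letters of the
  same kind.\<close>

fun add_letter :: "'k::field poly letter \<Rightarrow> 'k poly letter \<Rightarrow> 'k poly letter" where
  "add_letter (Lo P) (Lo Q) = Lo (P + Q)"
| "add_letter (Up P) (Up Q) = Up (P + Q)"
| "add_letter l l' = l"

fun reduced :: "'k::field poly letter list \<Rightarrow> bool" where
  "reduced [] \<longleftrightarrow> True"
| "reduced (l # w) \<longleftrightarrow> valid l \<and> nonzero l \<and> reduced w \<and> (w \<noteq> [] \<longrightarrow> is_up l \<noteq> is_up (hd w))"

text \<open>Only the head of \<open>w\<close> is affected: if two letters cancel, the tail that is
  uncovered is reduced already.\<close>

definition merge_letter :: "'k::field poly letter \<Rightarrow> 'k poly letter list \<Rightarrow> 'k poly letter list" where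
  "merge_letter l w = (if \<not> nonzero l then w else case w of [] \<Rightarrow> [l]
     | l' # w' \<Rightarrow> if is_up l = is_up l' then (if nonzero (add_letter l l') then add_letter l l' # w' else w') else l # w)"

text \<open>The unipotent matrices over K[t] applied to a column: the substitution
  \<open>papp P f\<close> in \<open>act\<close> becomes the product \<open>P * u\<close>.\<close>

fun mact :: "'k::field poly letter \<Rightarrow> 'k poly \<times> 'k poly \<Rightarrow> 'k poly \<times> 'k poly" where
  "mact (Lo P) (u, v) = (u, v + P * u)"
| "mact (Up Q) (u, v) = (u + Q * v, v)"

definition mweval :: "'k::field poly letter list \<Rightarrow> 'k poly \<times> 'k poly \<Rightarrow> 'k poly \<times> 'k poly" where
  "mweval w u = foldr mact w u"

lemma mweval_simps [simp]: "mweval [] u = u" "mweval (l # w) u = mact l (mweval w u)"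
  by (simp_all add: mweval_def)

lemma mweval_append: "mweval (v @ w) u = mweval v (mweval w u)"
  by (simp add: mweval_def)

lemma mact_inv_letter [simp]: "mact (inv_letter l) (mact l u) = u" "mact l (mact (inv_letter l) u) = u"
  by (cases l; cases u; simp)+

lemma mweval_inv_word [simp]: "mweval (inv_word w) (mweval w u) = u" "mweval w (mweval (inv_word w) u) = u"
proof -
  show "mweval (inv_word w) (mweval w u) = u"
    by (induction w arbitrary: u) (simp_all add: inv_word_def mweval_append)
  show "mweval w (mweval (inv_word w) u) = u"
    by (induction w arbitrary: u) (simp_all add: inv_word_def mweval_append)
qed

lemma act_add_letter:
  assumes "is_up l = is_up l'"
  shows "act (add_letter l l') \<phi> = act l (act l' \<phi>)" "mact (add_letter l l') u = mact l (mact l' u)"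
  using assms by (cases l; cases l'; cases \<phi>; cases u; simp add: algebra_simps)+

lemma act_zero:
  assumes "\<not> nonzero l" shows "act l \<phi> = \<phi>" "mact l u = u"
  using assms by (cases l; cases \<phi>; cases u; simp)+

lemma merge_letter_eval:
  "weval (merge_letter l w) \<phi> = act l (weval w \<phi>)" "mweval (merge_letter l w) u = mact l (mweval w u)"
  by (auto simp: merge_letter_def act_zero act_add_letter[symmetric] split: list.splits)

lemma valid_add_letter: "valid l \<Longrightarrow> valid l' \<Longrightarrow> valid (add_letter l l')"
  by (cases l; cases l') simp_all

lemma is_up_add_letter: "is_up l = is_up l' \<Longrightarrow> is_up (add_letter l l') = is_up l'"
  by (cases l; cases l') simp_all

lemma reduced_merge_letter: "valid l \<Longrightarrow> reduced w \<Longrightarrow> reduced (merge_letter l w)"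
  by (cases w) (auto simp: merge_letter_def valid_add_letter is_up_add_letter)

lemma exists_reduced:
  assumes "\<forall>l\<in>set w. valid l"
  shows "\<exists>v. reduced v \<and> weval v = weval w \<and> mweval v = mweval w"
  using assms
proof (induction w)
  case Nil
  show ?case by (intro exI[of _ "[]"]) simp
next
  case (Cons l w)
  then obtain v where v: "reduced v" "weval v = weval w" "mweval v = mweval w" by auto
  then show ?case using Cons.prems
    by (intro exI[of _ "merge_letter l v"]) (auto simp: fun_eq_iff merge_letter_eval reduced_merge_letter)
qed

lemma degree_papp: "degree (papp P f) = degree P * degree f"
proof -
  have "papp P f = map_poly (\<lambda>c. [:c:]) P \<circ>\<^sub>p f"
    unfolding papp_poly by (rule poly_map_const_pcompose) simp
  then show ?thesis by (simp add: degree_map_poly)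
qed

lemma degree_valid_Lo: "P \<noteq> 0 \<Longrightarrow> coeff P 0 = 0 \<Longrightarrow> 1 \<le> degree (P :: 'a::zero poly)"
  by (cases P) (auto split: if_splits)

lemma degree_valid_Up:
  assumes "Q \<noteq> 0" "coeff Q 0 = 0" "coeff Q 1 = 0"
  shows "2 \<le> degree (Q :: 'a::zero poly)"
proof -
  have "degree Q \<noteq> 0" "degree Q \<noteq> 1" using assms leading_coeff_0_iff[of Q] by (metis, metis)
  then show ?thesis by linarith
qed

text \<open>Degrees are taken in y and multiply under substitution. An \<open>Up\<close> letter has
  degree at least 2 and makes the first component strictly larger; a \<open>Lo\<close> letter may
  have degree 1, hence the weak inequality. Until an \<open>Up\<close> letter has acted, the first
  component is x, of y-degree 0; the last clause covers this.\<close>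

lemma reduced_degree:
  assumes "reduced w" "weval w id2 = (f, g)"
  shows "1 \<le> degree g \<and> (w \<noteq> [] \<and> is_up (hd w) \<longrightarrow> degree g < degree f)
    \<and> (w = [] \<or> \<not> is_up (hd w) \<longrightarrow> degree f \<le> degree g) \<and> ((\<exists>l\<in>set w. is_up l) \<longrightarrow> 1 \<le> degree f)
    \<and> (\<not> (\<exists>l\<in>set w. is_up l) \<longrightarrow> f = varX \<and> length w \<le> 1)"
  using assms
proof (induction w arbitrary: f g)
  case Nil
  then show ?case by (auto simp: varX_def varY_def)
next
  case (Cons l w)
  obtain f' g' where w: "weval w id2 = (f', g')" by (cases "weval w id2")
  have red: "reduced w" "valid l" "nonzero l" "w \<noteq> [] \<longrightarrow> is_up l \<noteq> is_up (hd w)" using Cons.prems by auto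
  note IH = Cons.IH[OF red(1) w]
  show ?case
  proof (cases l)
    case (Up Q)
    have fg: "f = f' + papp Q g'" "g = g'" using Cons.prems(2) by (auto simp: w Up)
    have "2 \<le> degree Q" using red Up by (intro degree_valid_Up) simp_all
    then have "2 * degree g' \<le> degree (papp Q g')" by (simp add: degree_papp)
    moreover have "degree f' \<le> degree g'" "1 \<le> degree g'" using IH red(4) Up by (cases "w = []"; auto)+
    ultimately have "degree f = degree (papp Q g')" "2 * degree g' \<le> degree f"
      unfolding fg by (simp_all add: degree_add_eq_right)
    then show ?thesis using \<open>1 \<le> degree g'\<close> by (auto simp: Up fg(2))
  next
    case (Lo P)
    have fg: "f = f'" "g = g' + papp P f'" using Cons.prems(2) by (auto simp: w Lo)
    have P: "1 \<le> degree P" using red Lo by (intro degree_valid_Lo) simp_all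
    show ?thesis
    proof (cases "w = []")
      case True
      then have "f' = varX" "g' = varY" using w by simp_all
      then have "degree (papp P f') = 0" "degree g' = 1" by (simp_all add: degree_papp varX_def varY_def)
      then have "degree g = 1" unfolding fg by (subst degree_add_eq_left) simp_all
      then show ?thesis using True \<open>f' = varX\<close> by (simp add: Lo fg(1) varX_def)
    next
      case False
      then have up: "is_up (hd w)" using red(4) Lo by auto
      then have "degree g' < degree f'" "\<exists>l\<in>set w. is_up l" "1 \<le> degree f'"
        using IH False by (auto intro!: bexI[of _ "hd w"])
      moreover have "degree f' \<le> degree (papp P f')" using P by (simp add: degree_papp)
      ultimately have "degree g = degree (papp P f')" unfolding fg by (intro degree_add_eq_right) simp
      then show ?thesis
        using \<open>degree f' \<le> degree (papp P f')\<close> \<open>1 \<le> degree f'\<close> \<open>\<exists>l\<in>set w. is_up l\<close> by (auto simp: Lo fg(1))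
    qed
  qed
qed

lemma reduced_weval_eq_id:
  assumes "reduced w" "weval w id2 = id2"
  shows "w = []"
proof (rule ccontr)
  assume ne: "w \<noteq> []"
  have "\<not> (\<exists>l\<in>set w. is_up l)" using reduced_degree[OF assms] by (auto simp: varX_def)
  then have "length w \<le> 1" using reduced_degree[OF assms] by blast
  then obtain l where l: "w = [l]" using ne by (cases w) auto
  then obtain P where P: "l = Lo P" using \<open>\<not> (\<exists>l\<in>set w. is_up l)\<close> by (cases l) auto
  have "papp P varX = 0" using assms(2) by (simp add: l P)
  moreover have "papp P varX = [:P:]" using papp_const[of P "[:0, 1:]"] unfolding varX_def pcompose_idR .
  ultimately show False using assms(1) l P by simp
qed

text \<open>The counterpart of \<open>reduced_degree\<close>, with degrees in t that add instead of
  multiplying. The column (0, 1) is fixed by a \<open>Lo\<close> letter that acts before any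
  \<open>Up\<close> letter, whence the last clause.\<close>

lemma reduced_degree_matrix:
  assumes "reduced w" "mweval w (0, 1) = (u, v)"
  shows "v \<noteq> 0 \<and> (w \<noteq> [] \<and> is_up (hd w) \<longrightarrow> degree v < degree u)
    \<and> (w = [] \<or> \<not> is_up (hd w) \<longrightarrow> degree u \<le> degree v) \<and> ((\<exists>l\<in>set w. is_up l) \<longrightarrow> u \<noteq> 0)
    \<and> (\<not> (\<exists>l\<in>set w. is_up l) \<longrightarrow> u = 0 \<and> length w \<le> 1)"
  using assms
proof (induction w arbitrary: u v)
  case Nil
  then show ?case by auto
next
  case (Cons l w)
  obtain u' v' where w: "mweval w (0, 1) = (u', v')" by (cases "mweval w (0, 1)")
  have red: "reduced w" "valid l" "nonzero l" "w \<noteq> [] \<longrightarrow> is_up l \<noteq> is_up (hd w)" using Cons.prems by auto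
  note IH = Cons.IH[OF red(1) w]
  show ?case
  proof (cases l)
    case (Up Q)
    have uv: "u = u' + Q * v'" "v = v'" using Cons.prems(2) by (auto simp: w Up)
    have Q: "2 \<le> degree Q" "Q \<noteq> 0" using red Up by (auto intro!: degree_valid_Up)
    have v': "v' \<noteq> 0" "degree u' \<le> degree v'" using IH red(4) Up by (cases "w = []"; auto)+
    then have "degree (Q * v') = degree Q + degree v'" using Q by (simp add: degree_mult_eq)
    then have "degree u = degree Q + degree v'" unfolding uv using Q v' by (subst degree_add_eq_right) simp_all
    then have "degree v < degree u" using Q by (simp add: uv)
    then have "u \<noteq> 0" by auto
    then show ?thesis using \<open>degree v < degree u\<close> v' by (auto simp: Up uv(2))
  next
    case (Lo P)
    have uv: "u = u'" "v = v' + P * u'" using Cons.prems(2) by (auto simp: w Lo)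
    have P: "1 \<le> degree P" "P \<noteq> 0" using red Lo degree_valid_Lo[of P] by auto
    show ?thesis
    proof (cases "w = []")
      case True
      then show ?thesis using w uv by (simp add: Lo)
    next
      case False
      then have up: "is_up (hd w)" using red(4) Lo by auto
      then have u': "degree v' < degree u'" "\<exists>l\<in>set w. is_up l" "u' \<noteq> 0"
        using IH False by (auto intro!: bexI[of _ "hd w"])
      then have "degree (P * u') = degree P + degree u'" using P by (simp add: degree_mult_eq)
      then have "degree v = degree P + degree u'" unfolding uv using u' by (subst degree_add_eq_right) simp_all
      then have "degree u \<le> degree v" "v \<noteq> 0" using P uv by auto
      then show ?thesis using u' by (auto simp: Lo uv(1))
    qed
  qed
qed

lemma reduced_mweval_eq_id:
  assumes "reduced w" "mweval w (1, 0) = (1, 0)" "mweval w (0, 1) = (0, 1)"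
  shows "w = []"
proof (rule ccontr)
  assume ne: "w \<noteq> []"
  have no: "\<not> (\<exists>l\<in>set w. is_up l)" using reduced_degree_matrix[OF assms(1,3)] by blast
  then have "length w \<le> 1" using reduced_degree_matrix[OF assms(1,3)] by blast
  then obtain l where l: "w = [l]" using ne by (cases w) auto
  then obtain P where P: "l = Lo P" using no by (cases l) auto
  show False using assms by (simp add: l P)
qed

lemma mweval_linear: "mweval w (p * u + q * u', p * v + q * v') =
   (p * fst (mweval w (u, v)) + q * fst (mweval w (u', v')), p * snd (mweval w (u, v)) + q * snd (mweval w (u', v')))"
proof (induction w)
  case (Cons l w)
  then show ?case
    by (cases l; cases "mweval w (u, v)"; cases "mweval w (u', v')") (simp_all add: algebra_simps)
qed simp

lemma mweval_basis: "mweval w (p, q) =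
   (p * fst (mweval w (1, 0)) + q * fst (mweval w (0, 1)), p * snd (mweval w (1, 0)) + q * snd (mweval w (0, 1)))"
  using mweval_linear[of w p 1 q 0 0 1] by simp

text \<open>Reduction preserves both actions, and in either of them a reduced word acts trivially
  only if it is empty. One direction makes the embedding well defined, the other one
  injective.\<close>

theorem weval_eq_id_iff:
  assumes "\<forall>l\<in>set w. valid l"
  shows "weval w id2 = id2 \<longleftrightarrow> mweval w = id"
proof -
  obtain v where v: "reduced v" "weval v = weval w" "mweval v = mweval w"
    using exists_reduced[OF assms] by blast
  show ?thesis
  proof
    assume "weval w id2 = id2"
    then have "weval v id2 = id2" by (simp only: v(2))
    then have "v = []" by (rule reduced_weval_eq_id[OF v(1)])
    then have "mweval v = id" by (simp add: fun_eq_iff)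
    then show "mweval w = id" by (simp only: v(3))
  next
    assume "mweval w = id"
    then have "v = []" using reduced_mweval_eq_id[OF v(1)] by (simp add: v(3))
    then have "weval v id2 = id2" by simp
    then show "weval w id2 = id2" by (simp only: v(2))
  qed
qed

corollary weval_eq_iff:
  assumes "\<forall>l\<in>set v. valid l" "\<forall>l\<in>set w. valid l"
  shows "weval v id2 = weval w id2 \<longleftrightarrow> mweval v = mweval w"
proof -
  have "weval (inv_word v @ w) id2 = id2 \<longleftrightarrow> weval v id2 = weval w id2"
  proof
    assume "weval (inv_word v @ w) id2 = id2"
    then have "weval v (weval (inv_word v) (weval w id2)) = weval v id2" by (simp add: weval_append)
    then show "weval v id2 = weval w id2" by simp
  next
    assume "weval v id2 = weval w id2"
    then have "weval (inv_word v) (weval v id2) = weval (inv_word v) (weval w id2)" by simp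
    then show "weval (inv_word v @ w) id2 = id2" by (simp add: weval_append)
  qed
  moreover have "mweval (inv_word v @ w) = id \<longleftrightarrow> mweval v = mweval w"
  proof
    assume eq: "mweval (inv_word v @ w) = id"
    show "mweval v = mweval w"
    proof
      fix u
      have "mweval v (mweval (inv_word v) (mweval w u)) = mweval v u"
        using fun_cong[OF eq, of u] by (simp add: mweval_append)
      then show "mweval v u = mweval w u" by simp
    qed
  next
    assume "mweval v = mweval w"
    then have "mweval (inv_word v @ w) u = u" for u
      using mweval_inv_word(1)[of v u] by (simp add: mweval_append)
    then show "mweval (inv_word v @ w) = id" by (simp add: fun_eq_iff)
  qed
  moreover have "\<forall>l\<in>set (inv_word v @ w). valid l" using assms by (simp add: ball_Un valid_inv_word)
  ultimately show ?thesis using weval_eq_id_iff by blast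
qed

section \<open>The embedding into \<open>SL\<^sub>2\<close>\<close>

definition wmat :: "'k::field poly letter list \<Rightarrow> 'k poly fract mat" where
  "wmat w = mat 2 2 (\<lambda>(i, j). to_fract ((if i = 0 then fst else snd) (mweval w (if j = 0 then (1, 0) else (0, 1)))))"

lemma wmat_carrier [simp]: "wmat w \<in> carrier_mat 2 2"
  by (simp add: wmat_def)

lemma wmat_mult: "wmat v * wmat w = wmat (v @ w)"
proof (rule eq_matI)
  fix i j assume "i < dim_row (wmat (v @ w))" "j < dim_col (wmat (v @ w))"
  then have ij: "i < 2" "j < 2" by (simp_all add: wmat_def)
  let ?c = "mweval w (if j = 0 then (1, 0) else (0, 1))"
  have "(wmat v * wmat w) $$ (i, j) = (\<Sum>t<2. wmat v $$ (i, t) * wmat w $$ (t, j))"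
    using ij by (simp add: wmat_def scalar_prod_def atLeast0LessThan)
  also have "\<dots> = to_fract ((if i = 0 then fst else snd) (mweval v (fst ?c, snd ?c)))"
    unfolding mweval_basis[of v "fst ?c" "snd ?c"] using ij
    by (auto simp: wmat_def numeral_2_eq_2 hom_distribs mult.commute)
  finally show "(wmat v * wmat w) $$ (i, j) = wmat (v @ w) $$ (i, j)"
    using ij by (simp add: wmat_def mweval_append)
qed (simp_all add: wmat_def)

lemma wmat_Nil: "wmat [] = 1\<^sub>m 2"
  by (rule eq_matI) (auto simp: wmat_def)

lemma wmat_eq_iff: "wmat v = wmat w \<longleftrightarrow> mweval v = mweval w"
proof
  assume eq: "wmat v = wmat w"
  have "(if i = (0::nat) then fst else snd) (mweval v (if j = (0::nat) then (1, 0) else (0, 1))) =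
      (if i = (0::nat) then fst else snd) (mweval w (if j = (0::nat) then (1, 0) else (0, 1)))" if "i < 2" "j < 2" for i j
    using arg_cong[OF eq, of "\<lambda>A. A $$ (i, j)"] that by (simp add: wmat_def)
  from this[of 0 0] this[of 0 1] this[of 1 0] this[of 1 1]
  have "mweval v (1, 0) = mweval w (1, 0)" "mweval v (0, 1) = mweval w (0, 1)"
    by (simp_all add: prod_eq_iff)
  then have "mweval v (p, q) = mweval w (p, q)" for p q
    unfolding mweval_basis[of v p q] mweval_basis[of w p q] by simp
  then show "mweval v = mweval w" by (auto simp: fun_eq_iff)
qed (simp add: wmat_def)

lemma wmat_det: "det (wmat w) = 1"
proof -
  have "fst (mweval w (1, 0)) * snd (mweval w (0, 1)) - fst (mweval w (0, 1)) * snd (mweval w (1, 0)) = 1"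
  proof (induction w)
    case (Cons l w)
    then show ?case
      by (cases l; cases "mweval w (1, 0)"; cases "mweval w (0, 1)") (simp_all add: algebra_simps)
  qed simp
  from arg_cong[OF this, of to_fract] show ?thesis
    by (simp add: det_2x2 wmat_def hom_distribs)
qed

lemma GL_carrier:
  fixes A :: "'r::{comm_ring, comm_monoid_mult} mat"
  shows "A \<in> carrier (GL n) \<longleftrightarrow> A \<in> carrier_mat n n \<and> (\<exists>B\<in>carrier_mat n n. B * A = 1\<^sub>m n \<and> A * B = 1\<^sub>m n)"
  by (auto simp: GL_def units_of_def Units_def)

lemma GL_simps [simp]:
  fixes A B :: "'r::{comm_ring, comm_monoid_mult} mat"
  shows "A \<otimes>\<^bsub>GL n\<^esub> B = A * B"
  by (simp add: GL_def units_of_def)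

lemma wmat_in_SL: "wmat w \<in> carrier (SL 2)"
proof -
  have "wmat (inv_word w) * wmat w = 1\<^sub>m 2" "wmat w * wmat (inv_word w) = 1\<^sub>m 2"
    unfolding wmat_mult wmat_Nil[symmetric] wmat_eq_iff by (auto simp: fun_eq_iff mweval_append)
  then show ?thesis unfolding SL_def by (auto simp: GL_carrier wmat_det intro!: bexI[of _ "wmat (inv_word w)"])
qed

theorem Aut_U_linear:
  "\<exists>\<rho>. \<rho> \<in> hom (Aut_plane_with (U_mats :: 'k::field mat set)) (SL 2 :: 'k poly fract mat monoid) \<and>
     inj_on \<rho> (carrier (Aut_plane_with (U_mats :: 'k mat set)))"
proof -
  \<comment> \<open>The choice does not matter: by \<open>weval_eq_iff\<close> all words for \<phi>
    have the same matrix.\<close>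
  define word where "word = (\<lambda>\<phi> :: 'k plane_map. SOME w. (\<forall>l\<in>set w. valid l) \<and> \<phi> = weval w id2)"
  define \<rho> where "\<rho> = (\<lambda>\<phi>. wmat (word \<phi>))"
  have word: "(\<forall>l\<in>set (word \<phi>). valid l) \<and> \<phi> = weval (word \<phi>) id2"
    if "\<exists>w. (\<forall>l\<in>set w. valid l) \<and> \<phi> = weval w id2" for \<phi>
    unfolding word_def using that by (rule someI_ex)
  have \<rho>: "\<rho> \<phi> = wmat w" if w: "\<forall>l\<in>set w. valid l" "\<phi> = weval w id2" for \<phi> w
  proof -
    have "(\<forall>l\<in>set (word \<phi>). valid l) \<and> \<phi> = weval (word \<phi>) id2" using w by (intro word) blast
    then show ?thesis using weval_eq_iff[of "word \<phi>" w] w unfolding \<rho>_def wmat_eq_iff by metis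
  qed
  have "\<rho> \<in> hom (Aut_plane_with U_mats) (SL 2)"
  proof (rule homI)
    fix \<phi> :: "'k plane_map" show "\<rho> \<phi> \<in> carrier (SL 2)" unfolding \<rho>_def by (rule wmat_in_SL)
  next
    fix \<phi> \<psi> :: "'k plane_map"
    assume "\<phi> \<in> carrier (Aut_plane_with U_mats)" "\<psi> \<in> carrier (Aut_plane_with U_mats)"
    then obtain v w where v: "\<forall>l\<in>set v. valid l" "\<phi> = weval v id2" and w: "\<forall>l\<in>set w. valid l" "\<psi> = weval w id2"
      using Aut_U_words by metis
    have "comp2 \<phi> \<psi> = weval (v @ w) id2" unfolding v(2) w(2) comp2_weval by (simp add: weval_append)
    then have "\<rho> (comp2 \<phi> \<psi>) = wmat (v @ w)" using v w by (intro \<rho>) auto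
    then show "\<rho> (\<phi> \<otimes>\<^bsub>Aut_plane_with U_mats\<^esub> \<psi>) = \<rho> \<phi> \<otimes>\<^bsub>SL 2\<^esub> \<rho> \<psi>"
      using \<rho>[OF v] \<rho>[OF w] by (simp add: wmat_mult SL_def)
  qed
  moreover have "inj_on \<rho> (carrier (Aut_plane_with U_mats))"
  proof (rule inj_onI)
    fix \<phi> \<psi> assume "\<phi> \<in> carrier (Aut_plane_with U_mats)" "\<psi> \<in> carrier (Aut_plane_with U_mats)" and eq: "\<rho> \<phi> = \<rho> \<psi>"
    then obtain v w where v: "\<forall>l\<in>set v. valid l" "\<phi> = weval v id2" and w: "\<forall>l\<in>set w. valid l" "\<psi> = weval w id2"
      using Aut_U_words by metis
    then show "\<phi> = \<psi>" using eq \<rho>[OF v] \<rho>[OF w] weval_eq_iff[OF v(1) w(1)] by (simp add: wmat_eq_iff)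
  qed
  ultimately show ?thesis by blast
qed

section \<open>Linear groups over arbitrary commutative rings\<close>

text \<open>The product with \<open>\<int>\<close> embeds a possibly zero ring into one with \<open>0 \<noteq> 1\<close>, where determinants are
  available.\<close>

typedef 'r with_int = "UNIV :: ('r \<times> int) set" by simp

setup_lifting type_definition_with_int

instantiation with_int :: ("{comm_ring, comm_monoid_mult}") comm_ring_1
begin

lift_definition zero_with_int :: "'a with_int" is "(0, 0)" .
lift_definition one_with_int :: "'a with_int" is "(1, 1)" .
lift_definition plus_with_int :: "'a with_int \<Rightarrow> 'a with_int \<Rightarrow> 'a with_int"
  is "\<lambda>x y. (fst x + fst y, snd x + snd y)" .
lift_definition minus_with_int :: "'a with_int \<Rightarrow> 'a with_int \<Rightarrow> 'a with_int"
  is "\<lambda>x y. (fst x - fst y, snd x - snd y)" .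
lift_definition uminus_with_int :: "'a with_int \<Rightarrow> 'a with_int"
  is "\<lambda>x. (- fst x, - snd x)" .
lift_definition times_with_int :: "'a with_int \<Rightarrow> 'a with_int \<Rightarrow> 'a with_int"
  is "\<lambda>x y. (fst x * fst y, snd x * snd y)" .

instance
  by standard (transfer; simp add: algebra_simps)+

end

lift_definition pair_int :: "'r \<Rightarrow> int \<Rightarrow> 'r with_int" is Pair .

lemma pair_int_simps:
  "pair_int a x + pair_int b y = pair_int (a + b) (x + y)" "pair_int a x * pair_int b y = pair_int (a * b) (x * y)"
  "pair_int 0 0 = 0" "pair_int 1 1 = 1" "pair_int a x = pair_int b y \<longleftrightarrow> a = b \<and> x = y"
  for a b :: "'r::{comm_ring, comm_monoid_mult}"
  by (transfer; simp)+

text \<open>The integer component is the identity matrix, which makes the extension compatible with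
  products and inverses.\<close>

definition ext_mat :: "nat \<Rightarrow> 'r::{comm_ring, comm_monoid_mult} mat \<Rightarrow> 'r with_int mat" where
  "ext_mat n A = mat n n (\<lambda>(i, j). pair_int (A $$ (i, j)) (if i = j then 1 else 0))"

lemma ext_mat_mult:
  assumes "A \<in> carrier_mat n n" "B \<in> carrier_mat n n"
  shows "ext_mat n (A * B) = ext_mat n A * ext_mat n B"
proof (rule eq_matI)
  fix i j assume "i < dim_row (ext_mat n A * ext_mat n B)" "j < dim_col (ext_mat n A * ext_mat n B)"
  then have ij: "i < n" "j < n" by (simp_all add: ext_mat_def)
  have sum: "(\<Sum>t\<in>T. pair_int (f t) (g t)) = pair_int (sum f T) (sum g T)" for f :: "nat \<Rightarrow> 'a" and g and T :: "nat set"
    by (induction T rule: infinite_finite_induct) (simp_all add: pair_int_simps)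
  have "(\<Sum>t = 0..<n. (if i = t then 1 else 0) * (if t = j then 1 else 0)) = (\<Sum>t = 0..<n. if t = j then (if i = t then 1 else 0) else (0::int))"
    by (intro sum.cong) auto
  also have "\<dots> = (if i = j then 1 else 0)" using ij by simp
  finally show "ext_mat n (A * B) $$ (i, j) = (ext_mat n A * ext_mat n B) $$ (i, j)"
    using ij assms by (simp add: ext_mat_def scalar_prod_def pair_int_simps sum)
qed (simp_all add: ext_mat_def)

lemma ext_mat_one: "ext_mat n (1\<^sub>m n :: 'r::{comm_ring, comm_monoid_mult} mat) = 1\<^sub>m n"
  by (rule eq_matI) (auto simp: ext_mat_def pair_int_simps)

lemma ext_mat_inj:
  assumes "A \<in> carrier_mat n n" "B \<in> carrier_mat n n" "ext_mat n A = ext_mat n B"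
  shows "A = B"
proof (rule eq_matI)
  fix i j assume "i < dim_row B" "j < dim_col B"
  then have "ext_mat n A $$ (i, j) = ext_mat n B $$ (i, j)" "i < n" "j < n" using assms by auto
  then show "A $$ (i, j) = B $$ (i, j)" by (simp add: ext_mat_def pair_int_simps)
qed (use assms in auto)

lemma ext_mat_hom: "ext_mat n \<in> hom (GL n :: 'r::{comm_ring, comm_monoid_mult} mat monoid) (GL n)"
proof (rule homI)
  fix A :: "'r mat" assume "A \<in> carrier (GL n)"
  then obtain B where AB: "A \<in> carrier_mat n n" "B \<in> carrier_mat n n" "B * A = 1\<^sub>m n" "A * B = 1\<^sub>m n"
    by (auto simp: GL_carrier)
  have c: "ext_mat n C \<in> carrier_mat n n" for C :: "'r mat" by (simp add: ext_mat_def)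
  have "ext_mat n B * ext_mat n A = 1\<^sub>m n" "ext_mat n A * ext_mat n B = 1\<^sub>m n"
    by (simp_all add: AB ext_mat_one flip: ext_mat_mult)
  then show "ext_mat n A \<in> carrier (GL n)" using c by (auto simp: GL_carrier)
next
  fix A B :: "'r mat" assume "A \<in> carrier (GL n)" "B \<in> carrier (GL n)"
  then show "ext_mat n (A \<otimes>\<^bsub>GL n\<^esub> B) = ext_mat n A \<otimes>\<^bsub>GL n\<^esub> ext_mat n B"
    by (simp add: GL_carrier ext_mat_mult)
qed

section \<open>Nonlinearity\<close>

lemma Jac_act: "Jac (act l \<phi>) = Jac \<phi>"
proof -
  have eq: "papp P f = subst2 [:P:] (f, 0)" for P and f :: "'a poly poly" by (simp add: papp_def subst2_ev2)
  have d: "dX (papp P f) = subst2 (dX [:P:]) (f, 0) * dX f" "dY (papp P f) = subst2 (dX [:P:]) (f, 0) * dY f"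
    for P and f :: "'a poly poly"
  proof -
    have "dY [:P:] = 0" by (simp add: pderiv_pCons)
    then show "dX (papp P f) = subst2 (dX [:P:]) (f, 0) * dX f" "dY (papp P f) = subst2 (dX [:P:]) (f, 0) * dY f"
      unfolding eq dX_subst2 dY_subst2 by simp_all
  qed
  show ?thesis
    by (cases l; cases \<phi>) (simp_all add: Jac_eq dX_derivation dY_derivation d algebra_simps)
qed

lemma Jac_weval: "Jac (weval w \<phi>) = Jac \<phi>"
  by (induction w) (simp_all add: Jac_act)

lemma weval_in_SAut0: "\<forall>l\<in>set w. valid l \<Longrightarrow> weval w id2 \<in> carrier SAut0_plane"
  by (simp add: SAut0_plane_def weval_in_Aut0_plane Jac_weval) (simp add: Jac_eq dX_var)

lemma lin_id: "lin 1 0 0 1 = id2"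
  by (simp only: lin_def const2_0_1 mult_zero_left mult_1_left add_0 add_0_right)

lemma lin_in_SAut0:
  assumes "a * d - b * c = 1"
  shows "lin a b c d \<in> carrier SAut0_plane"
proof -
  have "comp2 (lin d (- b) (- c) a) (lin a b c d) = id2" "comp2 (lin a b c d) (lin d (- b) (- c) a) = id2"
    unfolding comp2_lin lin_id[symmetric] using assms by (simp_all add: algebra_simps)
  then have "lin a b c d \<in> carrier Aut_plane" unfolding carrier_Aut_plane by blast
  moreover have "Jac (lin a b c d) = 1"
  proof -
    have "dX (fst (lin a b c d)) = const2 a" "dY (fst (lin a b c d)) = const2 b"
      "dX (snd (lin a b c d)) = const2 c" "dY (snd (lin a b c d)) = const2 d"
      by (simp_all add: lin_def varX_def varY_def map_poly_pCons_0 pderiv_pCons)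
    then have "Jac (lin a b c d) = const2 (a * d - b * c)" by (simp add: Jac_eq)
    then show ?thesis by (simp only: assms const2_0_1)
  qed
  ultimately show ?thesis by (simp add: SAut0_plane_def carrier_Aut0_plane lin_deriv)
qed

section \<open>Iterated commutators and their images\<close>

definition commutator_word :: "'k::field poly letter list \<Rightarrow> 'k poly letter \<Rightarrow> 'k poly letter list" where
  "commutator_word w l = w @ [l] @ inv_word w @ [inv_letter l]"

text \<open>All letters after the first are \<open>Up\<close> letters, because commutators of
  \<open>Lo\<close> letters are trivial. The conjugation by the rotation is thereby built
  in.\<close>

fun iterated_commutator :: "(nat \<Rightarrow> nat) \<Rightarrow> nat \<Rightarrow> 'k::field poly letter list" where
  "iterated_commutator M 0 = [Lo (monom 1 (M 0))]"
| "iterated_commutator M (Suc k) = commutator_word (iterated_commutator M k) (Up (monom 1 (M (Suc k))))"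

lemma valid_iterated_commutator:
  assumes "\<And>i. 2 \<le> M i"
  shows "\<forall>l\<in>set (iterated_commutator M k). valid l"
proof -
  have "M i \<noteq> 0 \<and> M i \<noteq> Suc 0" for i
    using assms[of i] by auto
  then show ?thesis
    by (induction k) (simp_all add: commutator_word_def ball_Un valid_inv_word)
qed

text \<open>The lower left entry is followed. If it is c for the matrix of \<open>w\<close> and q
  for its inverse, then the commutator with \<open>Up Q\<close> has lower left entry Q q c, and q is
  nonzero because c is.\<close>

lemma iterated_commutator_nontrivial:
  "snd (mweval (iterated_commutator M k) (1, 0)) \<noteq> (0 :: 'k::field poly)"
proof (induction k)
  case 0
  show ?case by simp
next
  case (Suc k)
  define w where "w = (iterated_commutator M k :: 'k poly letter list)"
  define Q where "Q = (monom 1 (M (Suc k)) :: 'k poly)"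
  obtain a c where ac: "mweval w (1, 0) = (a, c)" by (cases "mweval w (1, 0)")
  obtain p q where pq: "mweval (inv_word w) (1, 0) = (p, q)" by (cases "mweval (inv_word w) (1, 0)")
  have c: "c \<noteq> 0" using Suc ac by (simp add: w_def)
  have wpq: "mweval w (p, q) = (1, 0)" using mweval_inv_word(2)[of w "(1, 0)"] by (simp add: pq)
  have "q \<noteq> 0"
  proof
    assume "q = 0"
    then have "p * a = 1" "p * c = 0" using wpq mweval_basis[of w p q] by (simp_all add: ac)
    then show False using c by auto
  qed
  have "mweval (commutator_word w (Up Q)) (1, 0) = mweval w (p + Q * q, q)"
    by (simp add: commutator_word_def mweval_append pq)
  also have "snd \<dots> = snd (mweval w (p, q)) + Q * q * c"
    unfolding mweval_basis[of w "p + Q * q" q] mweval_basis[of w p q] by (simp add: ac algebra_simps)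
  finally have "snd (mweval (commutator_word w (Up Q)) (1, 0)) = Q * q * c" by (simp add: wpq)
  moreover have "Q \<noteq> 0" by (simp add: Q_def)
  ultimately have "snd (mweval (commutator_word w (Up Q)) (1, 0)) \<noteq> 0" using \<open>q \<noteq> 0\<close> c by simp
  then show ?case by (simp add: w_def Q_def)
qed

text \<open>Conjugation by (x / s, s y) multiplies c in (x, y + c x^M) by s^(M + 1), which explains
  the weights \<open>Suc (M i)\<close>. The bound 2 makes \<open>Up\<close> letters with these
  exponents valid; in characteristic p it excludes p^0.\<close>

lemma separated_exponents:
  assumes inf: "infinite (UNIV :: 'k::field set)"
  shows "\<exists>M :: nat \<Rightarrow> nat. (\<forall>i. 2 \<le> M i) \<and> (\<forall>i j. i < j \<longrightarrow> weights_separated TYPE('k) TYPE('r::comm_ring_1) (Suc (M i)) (Suc (M j)))"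
proof (cases "CHAR('k) = 0")
  case True
  then show ?thesis
    by (intro exI[of _ "\<lambda>i::nat. i + 2"]) (simp add: weights_separated_char_0)
next
  case False
  define p where "p = CHAR('k)"
  have p: "prime p" using False prime_CHAR_semidom[where 'a = 'k] by (simp add: p_def)
  have "2 \<le> p ^ Suc i" for i
  proof -
    have "p ^ 1 \<le> p ^ Suc i" using prime_ge_2_nat[OF p] by (intro power_increasing) simp_all
    then show ?thesis by (rule order_trans[rotated]) (simp add: prime_ge_2_nat[OF p])
  qed
  moreover have "weights_separated TYPE('k) TYPE('r) (Suc (p ^ Suc i)) (Suc (p ^ Suc j))" if "i < j" for i j
    by (rule weights_separated_char_p[OF p _ inf]) (use that in \<open>simp_all add: p_def\<close>)
  ultimately show ?thesis by (intro exI[of _ "\<lambda>i. p ^ Suc i"]) blast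
qed

text \<open>If all products of entries of \<open>\<rho> u\<^sub>i - 1\<close>, \<open>i \<le> k\<close>, are annihilated by \<open>r\<close>, then so is \<open>\<rho> u - 1\<close> for an
  iterated commutator \<open>u\<close> of conjugates of the \<open>u\<^sub>i\<close>.\<close>

theorem SAut0_not_linear:
  fixes \<rho> :: "'k::field plane_map \<Rightarrow> 'r::comm_ring_1 mat"
  assumes inf: "infinite (UNIV :: 'k set)"
    and hom: "\<rho> \<in> hom SAut0_plane (GL n)" and inj: "inj_on \<rho> (carrier SAut0_plane)"
  shows False
proof -
  define m where "m = Suc (n * n)"
  obtain M :: "nat \<Rightarrow> nat" where M: "\<And>i. 2 \<le> M i"
    and sep: "\<And>i j. i < j \<Longrightarrow> weights_separated TYPE('k) TYPE('r) (Suc (M i)) (Suc (M j))"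
    using separated_exponents[OF inf, where 'r = 'r] by blast
  let ?S = "carrier (SAut0_plane :: 'k plane_map monoid)"
  have GL: "\<rho> \<phi> \<in> carrier (GL n)" if "\<phi> \<in> ?S" for \<phi> using hom that by (auto simp: hom_def)
  have mult: "\<rho> (comp2 \<phi> \<psi>) = \<rho> \<phi> * \<rho> \<psi>" if "\<phi> \<in> ?S" "\<psi> \<in> ?S" for \<phi> \<psi>
    using hom_mult[OF hom that] by simp
  have car: "\<rho> \<phi> \<in> carrier_mat n n" if "\<phi> \<in> ?S" for \<phi> using GL[OF that] by (simp add: GL_carrier)
  have id_in: "id2 \<in> ?S" using weval_in_SAut0[of "[]"] by simp
  have \<rho>_id: "\<rho> id2 = 1\<^sub>m n"
  proof -
    obtain B where B: "B \<in> carrier_mat n n" "B * \<rho> id2 = 1\<^sub>m n" using GL[OF id_in] by (auto simp: GL_carrier)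
    have "\<rho> id2 = B * \<rho> id2 * \<rho> id2" using B car[OF id_in] by simp
    also have "\<dots> = B * \<rho> (comp2 id2 id2)"
      using assoc_mult_mat[OF B(1) car[OF id_in] car[OF id_in]] mult[OF id_in id_in] by simp
    also have "\<dots> = 1\<^sub>m n" using B by simp
    finally show ?thesis .
  qed
  have word_in: "weval w id2 \<in> ?S" if "\<forall>l\<in>set w. valid l" for w using that by (rule weval_in_SAut0)
  define \<rho>w where "\<rho>w = (\<lambda>w. \<rho> (weval w id2))"
  have \<rho>w_car: "\<rho>w w \<in> carrier_mat n n" if "\<forall>l\<in>set w. valid l" for w
    unfolding \<rho>w_def using that by (intro car word_in)
  have \<rho>w_append: "\<rho>w (v @ w) = \<rho>w v * \<rho>w w" if "\<forall>l\<in>set v. valid l" "\<forall>l\<in>set w. valid l" for v w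
    using mult[OF word_in word_in, OF that] by (simp add: \<rho>w_def comp2_weval weval_append)
  have \<rho>w_inv: "\<rho>w w * \<rho>w (inv_word w) = 1\<^sub>m n" if "\<forall>l\<in>set w. valid l" for w
  proof -
    have "\<rho>w w * \<rho>w (inv_word w) = \<rho>w (w @ inv_word w)"
      using that by (simp add: \<rho>w_append valid_inv_word)
    then show ?thesis by (simp add: \<rho>w_def weval_append \<rho>_id)
  qed
  define e where "e = (\<lambda>i c. \<rho>w [Lo (monom c (M i))])"
  define H where "H = (\<lambda>x. \<rho> (lin (1 / x) 0 0 x))"
  \<comment> \<open>Conjugating the letter \<open>Up\<close> with x^M by the rotation (y, -x) gives
    a \<open>Lo\<close> letter with coefficient (-1)^M. Index 0 belongs to the \<open>Lo\<close>
    letter at the start, which is not conjugated.\<close>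
  define c where "c = (\<lambda>i :: nat. if i = 0 then 1 else (- 1) ^ M i :: 'k)"
  define z where "z = (\<lambda>i. e i (c i) - 1\<^sub>m n)"
  have M0: "M i \<noteq> 0" "M i \<noteq> Suc 0" for i using M[of i] by auto
  have valid_Lo: "\<forall>l\<in>set [Lo (monom a (M i))]. valid l" for a :: 'k and i by (simp add: M0)
  have e_car: "e i a \<in> carrier_mat n n" for i a unfolding e_def by (rule \<rho>w_car) (simp add: M0)
  have prod0: "(\<Prod>i<m. z i $$ q i) = 0" if "\<And>i. i < m \<Longrightarrow> q i \<in> {..<n} \<times> {..<n}" for q
    unfolding z_def
  proof (rule prod_unipotent_entries_eq_0[OF inf, where H = H and Hi = "\<lambda>x. \<rho> (lin x 0 0 (1 / x))" and d = "\<lambda>i. Suc (M i)"])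
    show "n * n < m" by (simp add: m_def)
    show "e i 0 = 1\<^sub>m n" for i by (simp add: e_def \<rho>w_def \<rho>_id)
    show "e i (a + b) = e i a * e i b" for i a b
    proof -
      have "e i a * e i b = \<rho>w ([Lo (monom a (M i))] @ [Lo (monom b (M i))])"
        unfolding e_def by (rule \<rho>w_append[symmetric]) (simp_all add: M0)
      also have "\<dots> = e i (a + b)" by (simp add: e_def \<rho>w_def add_monom[symmetric] add_ac)
      finally show ?thesis ..
    qed
    fix x :: 'k assume x: "x \<noteq> 0"
    have lin_in: "lin (1 / x) 0 0 x \<in> ?S" "lin x 0 0 (1 / x) \<in> ?S" using x by (simp_all add: lin_in_SAut0)
    show "H x \<in> carrier_mat n n" "\<rho> (lin x 0 0 (1 / x)) \<in> carrier_mat n n"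
      unfolding H_def by (rule car[OF lin_in(1)], rule car[OF lin_in(2)])
    show "H x * \<rho> (lin x 0 0 (1 / x)) = 1\<^sub>m n"
      unfolding H_def mult[OF lin_in, symmetric] comp2_lin using x by (simp add: lin_id \<rho>_id)
    fix i a
    have "comp2 (lin (1 / x) 0 0 x) (weval [Lo (monom a (M i))] id2) =
        comp2 (weval [Lo (monom (x ^ Suc (M i) * a) (M i))] id2) (lin (1 / x) 0 0 x)"
    proof -
      have "x * a = x ^ Suc (M i) * a * (1 / x) ^ M i" using x by (simp add: power_divide)
      then have "const2 x * const2 a = const2 (x ^ Suc (M i) * a) * const2 (1 / x) ^ M i"
        by (simp only: const2_simps[symmetric])
      then have k: "const2 x * (varY + const2 a * varX ^ M i) = const2 x * varY + const2 (x ^ Suc (M i) * a) * (const2 (1 / x) * varX) ^ M i"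
        by (simp only: power_mult_distrib distrib_left mult.assoc[symmetric])
      show ?thesis
        unfolding comp2_weval comp2_id
        by (simp only: weval_simps lin_def act.simps papp_monom comp2_def fst_conv snd_conv subst2_simps
            const2_0_1 mult_zero_left add_0 add_0_right k)
    qed
    then show "H x * e i a = e i (x ^ Suc (M i) * a) * H x"
      unfolding H_def e_def \<rho>w_def
      by (simp only: mult[OF lin_in(1) word_in[OF valid_Lo], symmetric] mult[OF word_in[OF valid_Lo] lin_in(1), symmetric])
  qed (use that e_car sep in auto)
  \<comment> \<open>\<open>r\<close> is arbitrary so that the induction step can absorb an entry of
    \<open>z (Suc k)\<close> into it.\<close>
  have ann: "r * (\<rho>w (iterated_commutator M k) - 1\<^sub>m n) $$ (a, b) = 0"
    if "k < m" "a < n" "b < n"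
      and "\<And>q. (\<And>i. i \<le> k \<Longrightarrow> q i \<in> {..<n} \<times> {..<n}) \<Longrightarrow> r * (\<Prod>i\<le>k. z i $$ q i) = 0" for r k a b
    using that
  proof (induction k arbitrary: r a b)
    case 0
    show ?case using "0.prems"(4)[of "\<lambda>_. (a, b)"] "0.prems"(2,3) by (simp add: z_def e_def c_def)
  next
    case (Suc k)
    let ?u = "iterated_commutator M k :: 'k poly letter list"
    let ?l = "Up (monom 1 (M (Suc k))) :: 'k poly letter"
    have u: "\<forall>l\<in>set ?u. valid l" by (rule valid_iterated_commutator[OF M])
    have l: "\<forall>l\<in>set [?l]. valid l" by (simp add: M0)
    define U V where "U = \<rho>w ?u" and "V = \<rho>w [?l]"
    have UV: "U \<in> carrier_mat n n" "V \<in> carrier_mat n n" unfolding U_def V_def using u l by (intro \<rho>w_car; simp)+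
    have rz: "r * z (Suc k) $$ q' * (U - 1\<^sub>m n) $$ (s, t) = 0" if "q' \<in> {..<n} \<times> {..<n}" "s < n" "t < n" for q' s t
      unfolding U_def
    proof (rule Suc.IH)
      fix q :: "nat \<Rightarrow> nat \<times> nat" assume q: "\<And>i. i \<le> k \<Longrightarrow> q i \<in> {..<n} \<times> {..<n}"
      have "r * (\<Prod>i\<le>Suc k. z i $$ (q(Suc k := q')) i) = 0"
        by (rule Suc.prems(4)) (use q that in \<open>auto simp: le_Suc_eq\<close>)
      moreover have "(\<Prod>i\<le>k. z i $$ (q(Suc k := q')) i) = (\<Prod>i\<le>k. z i $$ q i)" by (intro prod.cong) auto
      ultimately show "r * z (Suc k) $$ q' * (\<Prod>i\<le>k. z i $$ q i) = 0" by (simp add: mult_ac)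
    qed (use Suc.prems that in simp_all)
    define R where "R = \<rho> (lin 0 1 (- 1) 0)"
    have rot: "lin 0 1 (- 1) 0 \<in> ?S" "lin 0 (- 1) 1 0 \<in> ?S" by (simp_all add: lin_in_SAut0)
    define Ri where "Ri = \<rho> (lin 0 (- 1) 1 0)"
    have RR: "R \<in> carrier_mat n n" "Ri \<in> carrier_mat n n" unfolding R_def Ri_def using rot by (simp_all add: car)
    have RRi: "R * Ri = 1\<^sub>m n"
      unfolding R_def Ri_def mult[OF rot, symmetric] comp2_lin by (simp add: lin_id \<rho>_id)
    have VR: "V * R = R * e (Suc k) (c (Suc k))"
    proof -
      have "comp2 (weval [?l] id2) (lin 0 1 (- 1) 0) = comp2 (lin 0 1 (- 1) 0) (weval [Lo (monom (c (Suc k)) (M (Suc k)))] id2)"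
      proof -
        have "(- 1) ^ M (Suc k) = c (Suc k)" by (simp add: c_def)
        then have k: "const2 1 * (const2 (- 1) * varX) ^ M (Suc k) = const2 (c (Suc k)) * varX ^ M (Suc k)"
          by (simp only: power_mult_distrib const2_simps(4)[symmetric] const2_0_1 mult_1_left)
        show ?thesis
          unfolding comp2_weval comp2_id
          by (simp only: weval_simps lin_def act.simps papp_monom comp2_def fst_conv snd_conv subst2_simps
              const2_0_1 mult_zero_left mult_1_left add_0 add_0_right k[unfolded const2_0_1 mult_1_left])
      qed
      then show ?thesis
        unfolding R_def V_def e_def \<rho>w_def
        by (simp only: mult[OF rot(1) word_in[OF valid_Lo], symmetric] mult[OF word_in[OF l] rot(1), symmetric])
    qed
    have zc: "z (Suc k) \<in> carrier_mat n n" by (simp add: z_def minus_carrier_mat)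
    \<comment> \<open>Hence the entries of V - 1 are R-linear combinations of those of
      \<open>z (Suc k)\<close>.\<close>
    have V1: "V - 1\<^sub>m n = R * z (Suc k) * Ri"
    proof -
      have "R * z (Suc k) = R * e (Suc k) (c (Suc k)) - R * 1\<^sub>m n"
        unfolding z_def by (rule mult_minus_distrib_mat[OF RR(1) e_car]) simp
      also have "\<dots> = V * R - 1\<^sub>m n * R" using VR RR by simp
      also have "\<dots> = (V - 1\<^sub>m n) * R" by (rule minus_mult_distrib_mat[symmetric]) (use UV RR in auto)
      finally have "R * z (Suc k) * Ri = (V - 1\<^sub>m n) * (R * Ri)"
        using assoc_mult_mat[of "V - 1\<^sub>m n" n n R n Ri n] RR by (simp add: minus_carrier_mat)
      then show ?thesis using RRi right_mult_one_mat[of "V - 1\<^sub>m n" n n] by (simp add: minus_carrier_mat)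
    qed
    have AB: "r * ((U - 1\<^sub>m n) $$ (s, t) * (V - 1\<^sub>m n) $$ (s', t')) = 0" if "s < n" "t < n" "s' < n" "t' < n" for s t s' t'
    proof -
      have "r * ((U - 1\<^sub>m n) $$ (s, t) * (V - 1\<^sub>m n) $$ (s', t')) =
          (\<Sum>(i, j)\<in>{..<n} \<times> {..<n}. (R $$ (s', i) * Ri $$ (j, t')) * (r * z (Suc k) $$ (i, j) * (U - 1\<^sub>m n) $$ (s, t)))"
        unfolding V1 mat_mult3_entry[OF RR(1) zc RR(2) that(3,4)] sum_distrib_left
        by (intro sum.cong refl) (simp add: case_prod_unfold mult_ac)
      also have "\<dots> = 0"
        by (intro sum.neutral) (use rz that in auto)
      finally show ?thesis .
    qed
    have comm: "r * (U * V) $$ (s, t) = r * (V * U) $$ (s, t)" if st: "s < n" "t < n" for s t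
    proof -
      \<comment> \<open>A B = (A - 1) (B - 1) + A + B - 1: apart from the first summand, which
        \<open>r\<close> annihilates for \<open>U\<close> and \<open>V\<close> in either order, this
        is symmetric in A and B.\<close>
      have exp: "(A * B) $$ (s, t) = (\<Sum>i<n. (A - 1\<^sub>m n) $$ (s, i) * (B - 1\<^sub>m n) $$ (i, t)) + A $$ (s, t) + B $$ (s, t) - 1\<^sub>m n $$ (s, t)"
        if A: "A \<in> carrier_mat n n" and B: "B \<in> carrier_mat n n" for A B :: "'r mat"
      proof -
        have "(\<Sum>i<n. (A - 1\<^sub>m n) $$ (s, i) * (B - 1\<^sub>m n) $$ (i, t)) =
            (\<Sum>i<n. A $$ (s, i) * B $$ (i, t) - (if i = t then A $$ (s, i) else 0) - (if i = s then B $$ (i, t) else 0)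
              + (if i = t then (if s = t then 1 else 0) else 0))"
          using st A B by (intro sum.cong refl) (auto simp: algebra_simps)
        also have "\<dots> = (\<Sum>i<n. A $$ (s, i) * B $$ (i, t)) - A $$ (s, t) - B $$ (s, t) + (if s = t then 1 else 0)"
          using st by (simp add: sum.distrib sum_subtractf)
        finally show ?thesis using mat_mult_entry[OF A B st] st by simp
      qed
      have "r * (\<Sum>i<n. (U - 1\<^sub>m n) $$ (s, i) * (V - 1\<^sub>m n) $$ (i, t)) = 0"
        "r * (\<Sum>i<n. (V - 1\<^sub>m n) $$ (s, i) * (U - 1\<^sub>m n) $$ (i, t)) = 0"
        unfolding sum_distrib_left using AB st
        by (intro sum.neutral ballI; simp only: lessThan_iff mult.commute[of "(V - 1\<^sub>m n) $$ _"])+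
      then show ?thesis unfolding exp[OF UV] exp[OF UV(2,1)] by (simp add: algebra_simps)
    qed
    define W where "W = \<rho>w (inv_word ?u) * \<rho>w [inv_letter ?l]"
    have iv: "\<forall>l\<in>set (inv_word ?u). valid l" "\<forall>l\<in>set [inv_letter ?l]. valid l"
      using u l by (simp_all add: valid_inv_word)
    have ivc: "\<rho>w (inv_word ?u) \<in> carrier_mat n n" "\<rho>w [inv_letter ?l] \<in> carrier_mat n n"
      using iv by (auto intro: \<rho>w_car)
    have Wc: "W \<in> carrier_mat n n" unfolding W_def using ivc by (rule mult_carrier_mat)
    have UVW: "\<rho>w (iterated_commutator M (Suc k)) = U * V * W"
    proof -
      have "\<rho>w (iterated_commutator M (Suc k)) = U * (V * W)"
        unfolding U_def V_def W_def iterated_commutator.simps commutator_word_def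
        using u l iv by (simp only: \<rho>w_append set_append ball_Un simp_thms)
      then show ?thesis using assoc_mult_mat[OF UV Wc] by simp
    qed
    have VUW: "V * U * W = 1\<^sub>m n"
    proof -
      have "U * \<rho>w (inv_word ?u) = 1\<^sub>m n" unfolding U_def by (rule \<rho>w_inv[OF u])
      moreover have "V * \<rho>w [inv_letter ?l] = 1\<^sub>m n" using \<rho>w_inv[OF l] by (simp add: V_def inv_word_def)
      moreover have "V * U * W = V * ((U * \<rho>w (inv_word ?u)) * \<rho>w [inv_letter ?l])"
        unfolding W_def using UV ivc assoc_mult_mat[OF UV(2,1) Wc] assoc_mult_mat[OF UV(1) ivc] by (simp add: W_def)
      ultimately show ?thesis using ivc by simp
    qed
    \<comment> \<open>\<open>U * V * W\<close> is the commutator, whereas \<open>V * U * W\<close>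
      is the identity.\<close>
    have "r * (U * V * W) $$ (a, b) = r * (V * U * W) $$ (a, b)"
      using comm Suc.prems(2,3)
      unfolding mat_mult_entry[OF mult_carrier_mat[OF UV] Wc Suc.prems(2,3)]
        mat_mult_entry[OF mult_carrier_mat[OF UV(2,1)] Wc Suc.prems(2,3)] sum_distrib_left mult.assoc[symmetric]
      by (intro sum.cong refl) simp
    then show ?case
      unfolding UVW VUW using Suc.prems(2,3) mult_carrier_mat[OF mult_carrier_mat[OF UV] Wc]
      by (subst index_minus_mat) (auto simp: right_diff_distrib)
  qed
  let ?w = "iterated_commutator M (n * n) :: 'k poly letter list"
  have valid: "\<forall>l\<in>set ?w. valid l" by (rule valid_iterated_commutator[OF M])
  have "\<rho>w ?w = 1\<^sub>m n"
  proof (rule eq_matI)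
    fix a b assume "a < dim_row (1\<^sub>m n :: 'r mat)" "b < dim_col (1\<^sub>m n :: 'r mat)"
    then have ab: "a < n" "b < n" by simp_all
    have "1 * (\<rho>w ?w - 1\<^sub>m n) $$ (a, b) = 0"
    proof (rule ann[OF _ ab])
      fix q :: "nat \<Rightarrow> nat \<times> nat" assume "\<And>i. i \<le> n * n \<Longrightarrow> q i \<in> {..<n} \<times> {..<n}"
      then show "1 * (\<Prod>i\<le>n * n. z i $$ q i) = 0"
        using prod0[of q] by (simp add: m_def lessThan_Suc_atMost)
    qed (simp add: m_def)
    then show "\<rho>w ?w $$ (a, b) = 1\<^sub>m n $$ (a, b)" using ab by simp
  qed (use carrier_matD[OF \<rho>w_car[OF valid]] in auto)
  then have "\<rho> (weval ?w id2) = \<rho> id2" by (simp add: \<rho>w_def \<rho>_id)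
  then have "weval ?w id2 = id2" using inj word_in[OF valid] id_in by (meson inj_onD)
  then have "mweval ?w = id" using weval_eq_id_iff[OF valid] by blast
  then have "snd (mweval ?w (1, 0)) = 0" by simp
  then show False using iterated_commutator_nontrivial by blast
qed

theorem theoremA:
  shows "(infinite (UNIV :: 'k::field set) \<longrightarrow>
      \<not> (\<exists>n \<ge> 1. \<exists>\<rho>.
          \<rho> \<in> hom (SAut0_plane :: 'k plane_map monoid)
                  (GL n :: 'r::{comm_ring, comm_monoid_mult} mat monoid) \<and>
          inj_on \<rho> (carrier (SAut0_plane :: 'k plane_map monoid))))
    \<and> (\<exists>\<rho>.
          \<rho> \<in> hom (Aut_plane_with (U_mats :: 'k mat set)) (SL 2 :: 'k poly fract mat monoid) \<and>
          inj_on \<rho> (carrier (Aut_plane_with (U_mats :: 'k mat set))))"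
proof (intro conjI impI notI)
  assume inf: "infinite (UNIV :: 'k set)"
  assume "\<exists>n \<ge> 1. \<exists>\<rho>. \<rho> \<in> hom (SAut0_plane :: 'k plane_map monoid) (GL n :: 'r mat monoid) \<and>
      inj_on \<rho> (carrier (SAut0_plane :: 'k plane_map monoid))"
  then obtain n and \<rho> :: "'k plane_map \<Rightarrow> 'r mat" where hom: "\<rho> \<in> hom SAut0_plane (GL n)" and inj: "inj_on \<rho> (carrier SAut0_plane)"
    by blast
  have "ext_mat n \<circ> \<rho> \<in> hom SAut0_plane (GL n)"
    by (rule hom_compose[OF hom ext_mat_hom])
  moreover have "inj_on (ext_mat n \<circ> \<rho>) (carrier SAut0_plane)"
  proof (rule comp_inj_on[OF inj])
    have "\<rho> ` carrier SAut0_plane \<subseteq> carrier_mat n n" using hom by (auto simp: hom_def GL_carrier)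
    then show "inj_on (ext_mat n) (\<rho> ` carrier SAut0_plane)"
      by (intro inj_onI) (meson ext_mat_inj subsetD)
  qed
  ultimately show False using SAut0_not_linear[OF inf] by blast
next
  show "\<exists>\<rho>. \<rho> \<in> hom (Aut_plane_with (U_mats :: 'k mat set)) (SL 2 :: 'k poly fract mat monoid) \<and>
      inj_on \<rho> (carrier (Aut_plane_with (U_mats :: 'k mat set)))"
    by (rule Aut_U_linear)
qed

end
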